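(* Let $\alpha>0$. There exists at least one minimizer of the discrete optimization problem $$\min_{\sigma_h\in K_h}\ \phi_\alpha(\sigma_h)=G_h(\sigma_h)+\alpha\,|D\sigma_h|(\Omega_C).$$
   Context: Setting (fixed throughout). $\Omega\subset\mathbb R^3$ is a convex bounded domain consisting of a non-conducting part $\Omega_0$ and a conducting part $\Omega_C=\Omega_1\cup\overline{\Omega}_2$, both polyhedral. $\Gamma$ is the upper boundary of $\Omega$ (part of $\partial\Omega_0$), $\Gamma_D$ is the rest of $\partial\Omega$, and $n$ is the unit outer normal. $\mu>0$ is constant, $\varepsilon>0$ is the permittivity in $\Omega_0$, $\omega>0$ is the angular frequency, $\mathbf J_s\in L^2(\Omega)^3$ with $\nabla\cdot\mathbf J_s=0$ in $\Omega$. The background conductivity $\sigma_0$ vanishes in $\Omega_0$ and is a positive constant in $\Omega_C$. $\mathbf E^{obs}\times n\in L^2(\Gamma)^3$ is the given data. Conductivities are real-valued and extended by zero outside $\Omega_C$. $H_\Gamma(\mathrm{curl};\Omega)=\{\mathbf u\in L^2(\Omega)^3:\nabla\times\mathbf u\in L^2(\Omega)^3,\ n\times\mathbf u=0\text{ on }\Gamma_D\}$, $H^1_\Gamma(\Omega_0)=\{v\in H^1(\Omega_0): v=0\text{ on }\partial\Omega_0\setminus\Gamma\}$ (complex-valued). Discretization. $\mathcal M_h$ is a shape regular, quasi-uniform tetrahedral mesh of $\Omega$ of mesh size $h$, with sub-meshes $\mathcal M_0,\mathcal M_C$ fitting $\Omega_0,\Omega_C$. $R_h\subset H_\Gamma(\mathrm{curl};\Omega)$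 is the lowest-order Nédélec edge element space; $U_h\subset H^1_\Gamma(\Omega_0)$ and $V_h\subset H^1_0(\Omega_C)$ (real-valued) are the linear Lagrange element spaces on $\mathcal M_0$ and $\mathcal M_C$. With $M>m>-\sigma_0|_{\Omega_C}$, let $K=\{\sigma\in BV(\Omega_C):\sigma\text{ compactly supported in }\Omega_C,\ m\le\sigma\le M\}$ and $K_h=V_h\cap K$. For $\sigma_h\in K_h$ put $a_h(\mathbf E_h,\mathbf F_h)=\int_\Omega\mu^{-1}\nabla\times\mathbf E_h\cdot\nabla\times\overline{\mathbf F_h}-i\omega(\sigma_h+\sigma_0)\mathbf E_h\cdot\overline{\mathbf F_h}\,dx$ and $b(\mathbf E,\mathbf F)=\int_{\Omega_0}\varepsilon\mathbf E\cdot\overline{\mathbf F}\,dx$. The discrete state $\mathbf E_h=\mathbf E_h(\sigma_h)\in R_h$, together with $\phi_h\in U_h$, solves $a_h(\mathbf E_h,\mathbf F_h)+b(\nabla\phi_h,\mathbf F_h)=i\omega\int_\Omega\mathbf J_s\cdot\overline{\mathbf F_h}\,dx$ for all $\mathbf F_h\in R_h$, and $b(\mathbf E_h,\nabla\psi_h)=0$ for all $\psi_h\in U_h$. The discrete objective functional is $G_h(\sigma_h)=\frac12\|\mathbf E_h(\sigma_h)\times n-\mathbf E^{obs}\times n\|_{L^2(\Gamma)}^2$. The total variation is $|Du|(\Omega_C)=\sup\{\int_{\Omega_C}u\,\nabla\cdot g\,dx:\ g\in C_0^1(\Omega_C)^3,\ |g(x)|\le1\text{ in }\Omega_C\}$.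
   Formalization: It is assumed in addition that K_h is nonempty (it is empty when m>0) and that for every σ_h in K_h the discrete system determines exactly one E_h(σ_h), which can fail, e.g. if Ω_C lies strictly inside Ω, so that G_h would be undefined. *)

theory Defs
  imports "HOL-Analysis.Analysis"
begin

type_synonym pt = "real^3"
type_synonym cvec = "complex^3"


section \<open>Vector calculus\<close>

definition cvec :: "real^3 \<Rightarrow> complex^3" where
  "cvec x = (\<chi> i. complex_of_real (x $ i))"

definition hdot :: "complex^3 \<Rightarrow> complex^3 \<Rightarrow> complex" where
  "hdot u v = (\<Sum>i\<in>UNIV. u $ i * cnj (v $ i))"

(* The library's cross3 is restricted to real vectors. *)
definition ccross :: "complex^3 \<Rightarrow> complex^3 \<Rightarrow> complex^3" where
  "ccross a b = vector [a$2 * b$3 - a$3 * b$2, a$3 * b$1 - a$1 * b$3, a$1 * b$2 - a$2 * b$1]"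

definition partial :: "3 \<Rightarrow> (pt \<Rightarrow> 'b::real_normed_vector) \<Rightarrow> pt \<Rightarrow> 'b" where
  "partial i f x = frechet_derivative f (at x) (axis i 1)"

definition grad :: "(pt \<Rightarrow> 'b::real_normed_vector) \<Rightarrow> pt \<Rightarrow> 'b^3" where
  "grad v x = (\<chi> i. partial i v x)"

definition divg :: "(pt \<Rightarrow> ('b::real_normed_vector)^3) \<Rightarrow> pt \<Rightarrow> 'b" where
  "divg u x = (\<Sum>i\<in>UNIV. partial i (\<lambda>y. u y $ i) x)"

(* For finite element functions grad and curl are used as pointwise classical derivatives; these
   exist in the interior of every element, hence almost everywhere, and agree there with the weak
   derivatives of conforming functions. *)
definition curl :: "(pt \<Rightarrow> ('b::real_normed_vector)^3) \<Rightarrow> pt \<Rightarrow> 'b^3" where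
  "curl u x = vector
     [partial 2 (\<lambda>y. u y $ 3) x - partial 3 (\<lambda>y. u y $ 2) x,
      partial 3 (\<lambda>y. u y $ 1) x - partial 1 (\<lambda>y. u y $ 3) x,
      partial 1 (\<lambda>y. u y $ 2) x - partial 2 (\<lambda>y. u y $ 1) x]"

(* C^1 functions on the whole space whose support is a compact subset of S. *)
definition C1_compact :: "pt set \<Rightarrow> (pt \<Rightarrow> 'b::real_normed_vector) set" where
  "C1_compact S = {g. (\<forall>x. g differentiable (at x)) \<and> (\<forall>i. continuous_on UNIV (partial i g)) \<and>
      compact (closure {x. g x \<noteq> 0}) \<and> closure {x. g x \<noteq> 0} \<subseteq> S}"


section \<open>Surface measure and outer normal\<close>

(* Two-dimensional Hausdorff outer measure, normalised so that it is surface area. *)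
definition hausdorff2 :: "pt set \<Rightarrow> ennreal" where
  "hausdorff2 A = (SUP \<delta>\<in>{0<..}. INF C\<in>{C :: nat \<Rightarrow> pt set.
      A \<subseteq> (\<Union>i. C i) \<and> (\<forall>i. bounded (C i) \<and> diameter (C i) \<le> \<delta>)}.
      (\<Sum>i. ennreal (pi / 4 * (diameter (C i))\<^sup>2)))"

definition surface_on :: "pt set \<Rightarrow> pt measure" where
  "surface_on S = restrict_space (completion (measure_of UNIV (sets borel) hausdorff2)) S"

(* Outer unit normal of a convex set; the value 0 is used at edges and corners, where
   the supporting hyperplane is not unique (a null set for the surface measure of a polytope). *)
definition outer_normal :: "pt set \<Rightarrow> pt \<Rightarrow> pt" where
  "outer_normal \<Omega> x =
     (let is_normal = (\<lambda>\<nu>. norm \<nu> = 1 \<and> (\<forall>y\<in>\<Omega>. \<nu> \<bullet> (y - x) \<le> 0))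
      in if (\<exists>!\<nu>. is_normal \<nu>) then (THE \<nu>. is_normal \<nu>) else 0)"

definition boundary_trace :: "pt set \<Rightarrow> (pt \<Rightarrow> cvec) \<Rightarrow> pt \<Rightarrow> cvec" where
  "boundary_trace \<Omega> u x = Lim (at x within \<Omega>) u"


section \<open>Function spaces\<close>

definition L2 :: "'a measure \<Rightarrow> ('a \<Rightarrow> 'b::euclidean_space) set" where
  "L2 M = {u \<in> borel_measurable M. integrable M (\<lambda>x. (norm (u x))\<^sup>2)}"

definition weakly_div_free :: "pt set \<Rightarrow> (pt \<Rightarrow> cvec) \<Rightarrow> bool" where
  "weakly_div_free \<Omega> J \<longleftrightarrow>
     (\<forall>\<psi> \<in> C1_compact \<Omega>. (LINT x|lebesgue_on \<Omega>. hdot (J x) (cvec (grad \<psi> x))) = 0)"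

(* H_Gamma(curl; Omega). The field w is the weak curl of u. Test fields need not vanish on
   Gamma_D = frontier Omega - Gamma, so by Green's formula (which defines the tangential
   trace in H(curl)) the identity also says that n x u = 0 on Gamma_D. *)
definition H_curl :: "pt set \<Rightarrow> pt set \<Rightarrow> (pt \<Rightarrow> cvec) set" where
  "H_curl \<Omega> \<Gamma> = {u \<in> L2 (lebesgue_on \<Omega>). \<exists>w \<in> L2 (lebesgue_on \<Omega>). \<forall>\<psi> \<in> C1_compact (- \<Gamma>).
      (LINT x|lebesgue_on \<Omega>. hdot (u x) (cvec (curl \<psi> x))) =
      (LINT x|lebesgue_on \<Omega>. hdot (w x) (cvec (\<psi> x)))}"

definition total_variation :: "pt set \<Rightarrow> (pt \<Rightarrow> real) \<Rightarrow> ereal" where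
  "total_variation S u =
     (SUP g\<in>{g \<in> C1_compact S. \<forall>x\<in>S. norm (g x) \<le> 1}. ereal (LINT x|lebesgue_on S. u x * divg g x))"

definition BV :: "pt set \<Rightarrow> (pt \<Rightarrow> real) set" where
  "BV S = {u. integrable (lebesgue_on S) u \<and> total_variation S u < \<infinity>}"

(* The set K. Functions are extended by zero outside S. *)
definition admissible :: "pt set \<Rightarrow> real \<Rightarrow> real \<Rightarrow> (pt \<Rightarrow> real) set" where
  "admissible S m M = {\<sigma> \<in> BV S. (\<forall>x. x \<notin> S \<longrightarrow> \<sigma> x = 0) \<and>
      (\<exists>C. compact C \<and> C \<subseteq> S \<and> (AE x in lebesgue_on S. x \<notin> C \<longrightarrow> \<sigma> x = 0)) \<and>
      (AE x in lebesgue_on S. m \<le> \<sigma> x \<and> \<sigma> x \<le> M)}"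


section \<open>Geometry, meshes and finite element spaces\<close>

(* Regular openness excludes cracks and similar artefacts not visible in the closure. *)
definition polyhedral :: "pt set \<Rightarrow> bool" where
  "polyhedral S \<longleftrightarrow> S \<noteq> {} \<and> interior (closure S) = S \<and>
     (\<exists>P. finite P \<and> (\<forall>p\<in>P. polytope p) \<and> closure S = \<Union>P)"

definition tetrahedral_mesh :: "pt set set \<Rightarrow> pt set \<Rightarrow> bool" where
  "tetrahedral_mesh T S \<longleftrightarrow> triangulation T \<and> (\<forall>t\<in>T. 3 simplex t) \<and> \<Union>T = closure S"

definition shape_regular :: "real \<Rightarrow> pt set set \<Rightarrow> bool" where
  "shape_regular \<kappa> T \<longleftrightarrow> (\<forall>t\<in>T. \<exists>x r. 0 < r \<and> cball x r \<subseteq> t \<and> diameter t \<le> \<kappa> * r)"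

definition quasi_uniform :: "real \<Rightarrow> real \<Rightarrow> pt set set \<Rightarrow> bool" where
  "quasi_uniform \<kappa> h T \<longleftrightarrow> (\<forall>t\<in>T. h \<le> \<kappa> * diameter t)"

(* Lowest-order Nedelec space. The value 0 on the element boundaries (a null set) fixes
   one representative of each class of almost everywhere equal fields. *)
definition nedelec_space :: "pt set set \<Rightarrow> pt set \<Rightarrow> pt set \<Rightarrow> (pt \<Rightarrow> cvec) set" where
  "nedelec_space T \<Omega> \<Gamma> = {u \<in> H_curl \<Omega> \<Gamma>.
      (\<forall>t\<in>T. \<exists>a b. \<forall>x \<in> interior t. u x = a + ccross b (cvec x)) \<and>
      (\<forall>x. x \<notin> (\<Union>t\<in>T. interior t) \<longrightarrow> u x = 0)}"

(* Linear Lagrange functions vanishing outside S; being affine on closed elements that share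
   their faces, they are continuous on the union of the elements. For an open set D meshed by T:
   S = D gives zero boundary values on frontier D, and S = D Un Gamma gives them on
   frontier D - Gamma. *)
definition lagrange_space :: "pt set set \<Rightarrow> pt set \<Rightarrow> (pt \<Rightarrow> 'b::real_normed_vector) set" where
  "lagrange_space T S = {v.
      (\<forall>t\<in>T. \<exists>a b. \<forall>x\<in>t. v x = a + (\<Sum>i\<in>UNIV. x $ i *\<^sub>R b i)) \<and>
      (\<forall>x. x \<notin> S \<longrightarrow> v x = 0)}"


section \<open>Discrete state and objective\<close>

definition form_a ::
  "pt set \<Rightarrow> real \<Rightarrow> real \<Rightarrow> (pt \<Rightarrow> real) \<Rightarrow> (pt \<Rightarrow> cvec) \<Rightarrow> (pt \<Rightarrow> cvec) \<Rightarrow> complex" where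
  "form_a \<Omega> \<mu> \<omega> s E F = (LINT x|lebesgue_on \<Omega>.
      complex_of_real (1 / \<mu>) * hdot (curl E x) (curl F x)
      - \<i> * complex_of_real (\<omega> * s x) * hdot (E x) (F x))"

definition form_b :: "pt set \<Rightarrow> (pt \<Rightarrow> real) \<Rightarrow> (pt \<Rightarrow> cvec) \<Rightarrow> (pt \<Rightarrow> cvec) \<Rightarrow> complex" where
  "form_b \<Omega>0 \<epsilon> E F = (LINT x|lebesgue_on \<Omega>0. complex_of_real (\<epsilon> x) * hdot (E x) (F x))"

(* s is the total conductivity, i.e. sigma_h + sigma_0. *)
definition is_discrete_state ::
  "pt set \<Rightarrow> pt set \<Rightarrow> (pt \<Rightarrow> cvec) set \<Rightarrow> (pt \<Rightarrow> complex) set \<Rightarrow> real \<Rightarrow> (pt \<Rightarrow> real) \<Rightarrow> real \<Rightarrow>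
   (pt \<Rightarrow> cvec) \<Rightarrow> (pt \<Rightarrow> real) \<Rightarrow> (pt \<Rightarrow> cvec) \<Rightarrow> bool" where
  "is_discrete_state \<Omega> \<Omega>0 R U \<mu> \<epsilon> \<omega> J s E \<longleftrightarrow> E \<in> R \<and>
     (\<exists>\<phi>\<in>U.
       (\<forall>F\<in>R. form_a \<Omega> \<mu> \<omega> s E F + form_b \<Omega>0 \<epsilon> (grad \<phi>) F
          = \<i> * complex_of_real \<omega> * (LINT x|lebesgue_on \<Omega>. hdot (J x) (F x))) \<and>
       (\<forall>\<psi>\<in>U. form_b \<Omega>0 \<epsilon> E (grad \<psi>) = 0))"

definition cross_normal :: "pt set \<Rightarrow> (pt \<Rightarrow> cvec) \<Rightarrow> pt \<Rightarrow> cvec" where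
  "cross_normal \<Omega> v x = ccross (v x) (cvec (outer_normal \<Omega> x))"

definition misfit :: "pt set \<Rightarrow> pt set \<Rightarrow> (pt \<Rightarrow> cvec) \<Rightarrow> (pt \<Rightarrow> cvec) \<Rightarrow> real" where
  "misfit \<Omega> \<Gamma> Eobs E = 1 / 2 * (LINT x|surface_on \<Gamma>.
      (norm (cross_normal \<Omega> (boundary_trace \<Omega> E) x - cross_normal \<Omega> Eobs x))\<^sup>2)"

end

theory Submission
  imports Defs
begin

text \<open>
  The objective is minimized along a sequence of conductivities by compactness in finite dimension:
  the bounds \<open>m \<le> \<sigma> \<le> M\<close> bound the nodal values, so a subsequence converges pointwise to some
  Lagrange function \<open>\<sigma>\<close>. Compact support is a closed condition because a piecewise affine function
  with compact support in \<open>\<Omega>C\<close> vanishes on every tetrahedron that touches the boundary of \<open>\<Omega>C\<close>.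
  The total variation is a supremum of functionals that converge along the sequence, hence lower
  semicontinuous; in particular the limit has bounded variation. The states converge along a further
  subsequence because the limiting saddle point problem is uniquely solvable, and their tangential
  traces depend linearly on the states off the edges of the mesh, which have zero area.
\<close>

section \<open>Area and the boundary of a simplex\<close>

text \<open>Unique solvability is granted only for conductivities in \<open>Kh\<close>, so the limit
  conductivity must be shown to lie in \<open>Kh\<close> before the states can be passed to the
  limit. The total variation is therefore estimated twice: first crudely, from a nonnegative misfit
  and the first value of the minimizing sequence, which yields membership; then sharply, with the
  limit of the misfit, which yields minimality. Each time a single test field is frozen, since the
  integrals against it are convergent real numbers, and the supremum is taken last. The finite
  element spaces are sets of functions without a topology. Coordinates replace it: finitely many
  point values reconstruct every member linearly. The other obstacle is the surface. Traces are
  pointwise limits and the normal is defined by a unique supporting hyperplane, so both have to be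
  computed at almost every point of \<Gamma>. Barycentric coordinates do this: at a boundary point
  inside a facet, the domain agrees locally with one tetrahedron and has only one normal.\<close>

lemma ccross_nth [simp]:
  "ccross a b $ 1 = a$2 * b$3 - a$3 * b$2"
  "ccross a b $ 2 = a$3 * b$1 - a$1 * b$3"
  "ccross a b $ 3 = a$1 * b$2 - a$2 * b$1"
  unfolding ccross_def by (simp_all add: vector_3)

lemma linear_cvec: "linear cvec"
  by (rule linearI) (simp_all add: cvec_def vec_eq_iff scaleR_conv_of_real[symmetric])

lemma bounded_linear_cvec: "bounded_linear cvec"
  using linear_cvec linear_conv_bounded_linear by blast

lemma bounded_bilinear_ccross: "bounded_bilinear ccross"
proof -
  have "bilinear ccross"
    unfolding bilinear_def
    by (auto intro!: linearI simp: vec_eq_iff forall_3 algebra_simps scaleR_conv_of_real[where 'a = complex])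
  then show ?thesis using bilinear_conv_bounded_bilinear by blast
qed

text \<open>Conjugation commutes with real scalars, so the sesquilinear product is bilinear over the
  reals.\<close>

lemma bounded_bilinear_hdot: "bounded_bilinear hdot"
proof -
  have "bilinear hdot"
    unfolding bilinear_def hdot_def
    by (auto intro!: linearI
        simp: algebra_simps scaleR_conv_of_real[where 'a = complex] sum.distrib sum_distrib_left)
  then show ?thesis using bilinear_conv_bounded_bilinear by blast
qed

text \<open>The difference of the two coefficient families sums to zero and represents the zero
  vector, so a nonzero entry would make it an affine dependence.\<close>

lemma affine_combination_unique:
  fixes C :: "'a::real_vector set"
  assumes "\<not> affine_dependent C" "finite C" "v \<in> C"
    and "sum a C = 1" "sum b C = 1" "(\<Sum>v\<in>C. a v *\<^sub>R v) = (\<Sum>v\<in>C. b v *\<^sub>R v)"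
  shows "a v = b v"
proof (rule ccontr)
  assume "a v \<noteq> b v"
  then have "\<exists>U. sum U C = 0 \<and> (\<exists>v\<in>C. U v \<noteq> 0) \<and> (\<Sum>v\<in>C. U v *\<^sub>R v) = 0"
    using assms(3-6)
    by (intro exI[of _ "\<lambda>v. a v - b v"]) (auto simp: sum_subtractf scaleR_diff_left)
  then show False using assms(1) affine_dependent_explicit_finite[OF assms(2)] by blast
qed

text \<open>Uniqueness of the coefficients turns an arbitrary choice of them into affine functions
  of the point: both sides of each linearity identity are coefficient families of the same point.
  Here \<open>c\<close> is the value at the origin and \<open>g\<close> the linear part.\<close>

lemma barycentric_coordinates:
  fixes C :: "'a::euclidean_space set"
  assumes "\<not> affine_dependent C" "affine hull C = UNIV"
  obtains c g where "\<And>v. v \<in> C \<Longrightarrow> linear (g v)"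
    "\<And>y. (\<Sum>v\<in>C. c v + g v y) = 1" "\<And>y. (\<Sum>v\<in>C. (c v + g v y) *\<^sub>R v) = y"
proof -
  have fin: "finite C" by (rule aff_independent_finite[OF assms(1)])
  have "\<forall>y. \<exists>u. sum u C = 1 \<and> (\<Sum>v\<in>C. u v *\<^sub>R v) = y"
    using assms(2) affine_hull_finite[OF fin] by auto
  then obtain lam where lam: "\<And>y. sum (lam y) C = 1" "\<And>y. (\<Sum>v\<in>C. lam y v *\<^sub>R v) = y"
    by metis
  have unique: "u v = lam y v" if "sum u C = 1" "(\<Sum>v\<in>C. u v *\<^sub>R v) = y" "v \<in> C" for u v y
    by (rule affine_combination_unique[OF assms(1) fin that(3,1) lam(1)]) (simp only: that(2) lam(2))
  define g where "g v y = lam y v - lam 0 v" for v y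
  have "linear (g v)" if v: "v \<in> C" for v
  proof (rule linearI)
    fix x y
    have "lam x v + lam y v - lam 0 v = lam (x + y) v"
      by (rule unique[OF _ _ v])
        (simp_all add: sum.distrib sum_subtractf scaleR_add_left scaleR_diff_left lam)
    then show "g v (x + y) = g v x + g v y" unfolding g_def by simp
  next
    fix r x
    have "r * lam x v + (1 - r) * lam 0 v = lam (r *\<^sub>R x) v"
    proof (rule unique[OF _ _ v])
      show "(\<Sum>v\<in>C. r * lam x v + (1 - r) * lam 0 v) = 1"
        by (simp add: sum.distrib lam flip: sum_distrib_left)
      show "(\<Sum>v\<in>C. (r * lam x v + (1 - r) * lam 0 v) *\<^sub>R v) = r *\<^sub>R x"
        by (simp add: sum.distrib lam scaleR_add_left flip: scaleR_scaleR scaleR_sum_right)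
    qed
    then show "g v (r *\<^sub>R x) = r *\<^sub>R g v x" unfolding g_def by (simp add: algebra_simps)
  qed
  then show ?thesis
    using that[of g "\<lambda>v. lam 0 v"] lam unfolding g_def by simp
qed

section \<open>Covering estimates for the two-dimensional Hausdorff measure\<close>

text \<open>A finite cover becomes a countable one by padding with empty sets, whose diameter is
  zero. The bound \<open>c\<close> has to be the same for all \<delta> because the measure is a
  supremum over \<delta>.\<close>

lemma hausdorff2_le:
  assumes "\<And>\<delta>. \<delta> > 0 \<Longrightarrow> \<exists>N d C. 0 \<le> d \<and> d \<le> \<delta> \<and> A \<subseteq> (\<Union>i<N. C i) \<and>
      (\<forall>i<N. bounded (C i) \<and> diameter (C i) \<le> d) \<and> pi / 4 * real N * d\<^sup>2 \<le> c"
  shows "hausdorff2 A \<le> ennreal c"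
  unfolding hausdorff2_def
proof (rule SUP_least)
  fix \<delta> :: real assume "\<delta> \<in> {0<..}"
  then obtain N d C where C: "0 \<le> d" "d \<le> \<delta>" "A \<subseteq> (\<Union>i<N. C i)"
      "\<forall>i<N. bounded (C i) \<and> diameter (C i) \<le> d" "pi / 4 * real N * d\<^sup>2 \<le> c"
    using assms[of \<delta>] by auto
  define C' where "C' i = (if i < N then C i else {})" for i
  have C': "bounded (C' i)" "diameter (C' i) \<le> \<delta>" for i using C by (auto simp: C'_def)
  have "A \<subseteq> (\<Union>i. C' i)"
  proof
    fix x assume "x \<in> A"
    then obtain i where "i < N" "x \<in> C i" using C(3) by blast
    then have "x \<in> C' i" by (simp add: C'_def)
    then show "x \<in> (\<Union>i. C' i)" by blast
  qed
  then have "(INF C\<in>{C. A \<subseteq> (\<Union>i. C i) \<and> (\<forall>i. bounded (C i) \<and> diameter (C i) \<le> \<delta>)}.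
      \<Sum>i. ennreal (pi / 4 * (diameter (C i))\<^sup>2)) \<le> (\<Sum>i. ennreal (pi / 4 * (diameter (C' i))\<^sup>2))"
    using C' by (intro INF_lower) auto
  also have "\<dots> = (\<Sum>i<N. ennreal (pi / 4 * (diameter (C' i))\<^sup>2))"
    by (rule suminf_finite) (auto simp: C'_def)
  also have "\<dots> \<le> (\<Sum>i<N. ennreal (pi / 4 * d\<^sup>2))"
    using C(1,4) diameter_ge_0 by (intro sum_mono ennreal_leI mult_left_mono power_mono) (auto simp: C'_def)
  also have "\<dots> = ennreal (pi / 4 * real N * d\<^sup>2)"
    by (simp add: ennreal_of_nat_eq_real_of_nat ennreal_mult'[symmetric] algebra_simps)
  also have "\<dots> \<le> ennreal c" by (rule ennreal_leI[OF C(5)])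
  finally show "(INF C\<in>{C. A \<subseteq> (\<Union>i. C i) \<and> (\<forall>i. bounded (C i) \<and> diameter (C i) \<le> \<delta>)}.
      \<Sum>i. ennreal (pi / 4 * (diameter (C i))\<^sup>2)) \<le> ennreal c" .
qed

text \<open>Rounding down gives the index. Since only indices below \<open>n\<close> are allowed,
  the endpoint 1 is served by \<open>n - 1\<close>, at distance exactly
  \<open>1 / n\<close>.\<close>

lemma unit_interval_grid:
  fixes a :: real
  assumes "0 \<le> a" "a \<le> 1" "0 < n"
  obtains i where "i < n" "\<bar>a - real i / real n\<bar> \<le> 1 / real n"
proof (cases "a = 1")
  case True
  then have "\<bar>a - real (n - 1) / real n\<bar> \<le> 1 / real n"
    using assms(3) by (simp add: of_nat_diff field_simps)
  then show ?thesis using that[of "n - 1"] assms(3) by simp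
next
  case False
  define i where "i = nat \<lfloor>a * real n\<rfloor>"
  have "a * real n < real n" using False assms by simp
  then have "i < n" unfolding i_def using assms by (simp add: floor_less_iff nat_less_iff)
  moreover have "real i \<le> a * real n" "a * real n < real i + 1"
    unfolding i_def using assms by (simp_all add: of_nat_nat)
  then have "\<bar>a * real n - real i\<bar> / real n \<le> 1 / real n"
    by (intro divide_right_mono) auto
  then have "\<bar>a - real i / real n\<bar> \<le> 1 / real n"
    using assms(3) by (metis abs_divide abs_of_nat diff_divide_distrib nonzero_mult_div_cancel_right
        of_nat_0_less_iff order_less_irrefl)
  ultimately show ?thesis by (rule that)
qed

lemma cball_cover_bounds:
  fixes x :: "'a::euclidean_space"
  assumes "0 \<le> r"
  shows "bounded (cball x r)" "diameter (cball x r) \<le> 2 * r"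
  using assms by (auto simp: diameter_cball)

text \<open>A segment of length \<open>L\<close> is covered by \<open>n\<close> balls of radius
  \<open>L / n\<close>, whose total contribution \<open>pi * L\<^sup>2 / n\<close> tends to
  zero.\<close>

lemma hausdorff2_segment: "hausdorff2 (closed_segment p q) = 0"
proof -
  have "hausdorff2 (closed_segment p q) \<le> ennreal c" if c: "c > 0" for c
  proof (rule hausdorff2_le)
    fix \<delta> :: real assume \<delta>: "\<delta> > 0"
    define L where "L = norm (q - p)"
    have L: "L \<ge> 0" unfolding L_def by simp
    \<comment> \<open>The three lower bounds make \<open>n\<close> positive, the diameters
      \<open>2 * L / n\<close> at most \<delta>, and the total contribution at most
      \<open>c\<close>.\<close>
    obtain n where n: "real n > max 1 (max (2 * L / \<delta>) (pi * L\<^sup>2 / c))" using reals_Archimedean2 by blast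
    have n0: "n > 0" "real n > 0" using n by auto
    define d where "d = 2 * (L / real n)"
    define C where "C i = cball (p + (real i / real n) *\<^sub>R (q - p)) (L / real n)" for i
    have "closed_segment p q \<subseteq> (\<Union>i<n. C i)"
    proof
      fix x assume "x \<in> closed_segment p q"
      then obtain a where a: "0 \<le> a" "a \<le> 1" "x = p + a *\<^sub>R (q - p)"
        by (auto simp: in_segment algebra_simps)
      obtain i where i: "i < n" "\<bar>a - real i / real n\<bar> \<le> 1 / real n"
        using unit_interval_grid[OF a(1,2) n0(1)] .
      have "norm (p + (real i / real n) *\<^sub>R (q - p) - x) = \<bar>a - real i / real n\<bar> * L"
      proof -
        have "p + (real i / real n) *\<^sub>R (q - p) - x = (real i / real n - a) *\<^sub>R (q - p)"
          unfolding a by (simp add: algebra_simps)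
        then show ?thesis unfolding L_def by (simp add: abs_minus_commute)
      qed
      also have "\<dots> \<le> L / real n" using mult_right_mono[OF i(2) L] by simp
      finally have "x \<in> C i" unfolding C_def by (simp add: dist_norm)
      then show "x \<in> (\<Union>i<n. C i)" using i(1) by blast
    qed
    moreover have "\<forall>i<n. bounded (C i) \<and> diameter (C i) \<le> d"
      unfolding C_def d_def using cball_cover_bounds[of "L / real n"] L by simp
    moreover have "0 \<le> d" "d \<le> \<delta>" using n n0 L \<delta> unfolding d_def by (auto simp: field_simps)
    moreover have "pi / 4 * real n * d\<^sup>2 \<le> c"
    proof -
      have "pi / 4 * real n * d\<^sup>2 = pi * L\<^sup>2 / real n"
        unfolding d_def using n0 by (simp add: power2_eq_square field_simps)
      also have "\<dots> \<le> c" using n n0 c by (simp add: field_simps)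
      finally show ?thesis .
    qed
    ultimately show "\<exists>N d C. 0 \<le> d \<and> d \<le> \<delta> \<and> closed_segment p q \<subseteq> (\<Union>i<N. C i) \<and>
        (\<forall>i<N. bounded (C i) \<and> diameter (C i) \<le> d) \<and> pi / 4 * real N * d\<^sup>2 \<le> c" by blast
  qed
  then have "hausdorff2 (closed_segment p q) \<le> 0 + ennreal c" if "c > 0" for c
    using that by simp
  then have "hausdorff2 (closed_segment p q) \<le> 0" by (rule ennreal_le_epsilon)
  then show ?thesis by simp
qed

text \<open>In two directions \<open>n * n\<close> balls of radius \<open>L / n\<close> are used,
  and their contribution \<open>pi * L\<^sup>2\<close> does not depend on \<open>n\<close>: the area
  is finite.\<close>

lemma hausdorff2_parallelogram:
  "hausdorff2 {p + a *\<^sub>R u + b *\<^sub>R w | a b. 0 \<le> a \<and> a \<le> 1 \<and> 0 \<le> b \<and> b \<le> 1} < \<infinity>"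
proof -
  let ?A = "{p + a *\<^sub>R u + b *\<^sub>R w | a b. 0 \<le> a \<and> a \<le> 1 \<and> 0 \<le> b \<and> b \<le> 1}"
  define L where "L = norm u + norm w"
  have L: "L \<ge> 0" unfolding L_def by simp
  have "hausdorff2 ?A \<le> ennreal (pi * L\<^sup>2)"
  proof (rule hausdorff2_le)
    fix \<delta> :: real assume \<delta>: "\<delta> > 0"
    obtain n where n: "real n > max 1 (2 * L / \<delta>)" using reals_Archimedean2 by blast
    have n0: "n > 0" "real n > 0" using n by auto
    define d where "d = 2 * (L / real n)"
    \<comment> \<open>Quotient and remainder modulo \<open>n\<close> enumerate the two-dimensional
      grid by a single index.\<close>
    define C where "C k = cball (p + (real (k div n) / real n) *\<^sub>R u + (real (k mod n) / real n) *\<^sub>R w)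
        (L / real n)" for k
    have "?A \<subseteq> (\<Union>i<n * n. C i)"
    proof
      fix x assume "x \<in> ?A"
      then obtain a b where ab: "0 \<le> a" "a \<le> 1" "0 \<le> b" "b \<le> 1" "x = p + a *\<^sub>R u + b *\<^sub>R w" by blast
      obtain i where i: "i < n" "\<bar>a - real i / real n\<bar> \<le> 1 / real n"
        using unit_interval_grid[OF ab(1,2) n0(1)] .
      obtain j where j: "j < n" "\<bar>b - real j / real n\<bar> \<le> 1 / real n"
        using unit_interval_grid[OF ab(3,4) n0(1)] .
      define k where "k = i * n + j"
      have k: "k div n = i" "k mod n = j" unfolding k_def using j(1) by auto
      have "k < Suc i * n" unfolding k_def using j(1) by simp
      also have "\<dots> \<le> n * n" using i(1) by (intro mult_le_mono1) simp
      finally have kn: "k < n * n" .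
      have "norm (p + (real i / real n) *\<^sub>R u + (real j / real n) *\<^sub>R w - x)
          = norm ((real i / real n - a) *\<^sub>R u + (real j / real n - b) *\<^sub>R w)"
        unfolding ab by (simp add: algebra_simps)
      also have "\<dots> \<le> \<bar>a - real i / real n\<bar> * norm u + \<bar>b - real j / real n\<bar> * norm w"
        by (rule order_trans[OF norm_triangle_ineq]) (simp add: abs_minus_commute)
      also have "\<dots> \<le> 1 / real n * norm u + 1 / real n * norm w"
        by (intro add_mono mult_right_mono i j norm_ge_zero)
      also have "\<dots> = L / real n" unfolding L_def by (simp add: add_divide_distrib)
      finally have "x \<in> C k" unfolding C_def k by (simp add: dist_norm)
      then show "x \<in> (\<Union>i<n * n. C i)" using kn by blast
    qed
    moreover have "\<forall>i<n * n. bounded (C i) \<and> diameter (C i) \<le> d"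
      unfolding C_def d_def using cball_cover_bounds[of "L / real n"] L by simp
    moreover have "0 \<le> d" "d \<le> \<delta>" using n n0 L \<delta> unfolding d_def by (auto simp: field_simps)
    moreover have "pi / 4 * real (n * n) * d\<^sup>2 \<le> pi * L\<^sup>2"
      unfolding d_def using n0 by (simp add: power2_eq_square field_simps)
    ultimately show "\<exists>N d C. 0 \<le> d \<and> d \<le> \<delta> \<and> ?A \<subseteq> (\<Union>i<N. C i) \<and>
        (\<forall>i<N. bounded (C i) \<and> diameter (C i) \<le> d) \<and> pi / 4 * real N * d\<^sup>2 \<le> pi * L\<^sup>2" by blast
  qed
  then show ?thesis by (simp add: le_less_trans)
qed

lemma hausdorff2_mono: "A \<subseteq> B \<Longrightarrow> hausdorff2 A \<le> hausdorff2 B"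
  unfolding hausdorff2_def by (intro SUP_subset_mono INF_superset_mono order_refl) auto

section \<open>The completed area measure\<close>

abbreviation area :: "pt measure" where
  "area \<equiv> completion (measure_of UNIV (sets borel) hausdorff2)"

lemma sets_hausdorff2: "sets (measure_of UNIV (sets borel) hausdorff2) = sets (borel :: pt measure)"
  using sets.sigma_sets_eq[of "borel :: pt measure"] by (simp add: sets_measure_of)

lemma space_hausdorff2: "space (measure_of UNIV (sets borel) hausdorff2) = UNIV"
  by (simp add: space_measure_of)

lemma borel_sets_area: "A \<in> sets borel \<Longrightarrow> A \<in> sets area"
  by (intro sets_completionI_sets) (simp add: sets_hausdorff2)

text \<open>If \<^const>\<open>hausdorff2\<close> were not countably additive on the Borel sets, \<^const>\<open>measure_of\<close> would
  be the null measure; either way the inequality holds, and additivity is never needed.\<close>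

lemma emeasure_area_le:
  assumes "A \<in> sets borel"
  shows "emeasure area A \<le> hausdorff2 A"
proof -
  have "emeasure area A = emeasure (measure_of UNIV (sets borel) hausdorff2) A"
    using assms by (simp add: sets_hausdorff2)
  also have "\<dots> \<le> hausdorff2 A"
    by (simp add: emeasure_measure_of_conv)
  finally show ?thesis .
qed

section \<open>Facets, edges and outer normals of a tetrahedron\<close>

lemma convex_outer_normal_exists:
  fixes x :: "'a::euclidean_space"
  assumes "convex \<Omega>" "\<Omega> \<noteq> {}" "x \<notin> \<Omega>"
  obtains \<nu> where "norm \<nu> = 1" "\<And>y. y \<in> \<Omega> \<Longrightarrow> \<nu> \<bullet> (y - x) \<le> 0"
proof -
  obtain a b where ab: "a \<noteq> 0" "\<forall>y\<in>\<Omega>. a \<bullet> y \<le> b" "\<forall>y\<in>{x}. b \<le> a \<bullet> y"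
    using separating_hyperplane_sets[of \<Omega> "{x}"] assms by auto
  have "(a /\<^sub>R norm a) \<bullet> (y - x) \<le> 0" if "y \<in> \<Omega>" for y
  proof -
    have "a \<bullet> (y - x) \<le> 0" using ab that by (force simp: inner_diff_right)
    then show ?thesis by (simp add: mult_nonneg_nonpos)
  qed
  then show ?thesis using that[of "a /\<^sub>R norm a"] ab(1) by simp
qed

lemma interior_simplex_barycentric:
  fixes C :: "'a::euclidean_space set"
  assumes "\<not> affine_dependent C" "card C = Suc DIM('a)"
    and "(\<Sum>v\<in>C. l v) = 1" "(\<Sum>v\<in>C. l v *\<^sub>R v) = y" "\<And>v. v \<in> C \<Longrightarrow> 0 < l v"
  shows "y \<in> interior (convex hull C)"
  using assms by (auto simp: interior_convex_hull_explicit_minimal intro!: exI[of _ l])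

text \<open>The barycentric coordinates \<open>lam\<close> are affine on the whole space, not just
  on the tetrahedron, so their signs also locate points outside it relative to the planes of the
  facets.\<close>

locale full_simplex =
  fixes C :: "pt set" and lam :: "pt \<Rightarrow> pt \<Rightarrow> real"
  assumes independent: "\<not> affine_dependent C" and card: "card C = 4"
    and affine: "\<And>v. v \<in> C \<Longrightarrow> \<exists>c g. linear g \<and> lam v = (\<lambda>y. c + g y)"
    and sum_lam: "\<And>y. (\<Sum>v\<in>C. lam v y) = 1" and lam_point: "\<And>y. (\<Sum>v\<in>C. lam v y *\<^sub>R v) = y"
begin

lemma finite_vertices: "finite C"
  by (rule aff_independent_finite[OF independent])

lemma continuous_lam: "v \<in> C \<Longrightarrow> continuous_on UNIV (lam v)"
proof -
  assume "v \<in> C"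
  then obtain c g where g: "linear g" "lam v = (\<lambda>y. c + g y)" using affine by blast
  have "continuous_on UNIV g" using g(1) by (simp add: linear_continuous_on linear_conv_bounded_linear)
  then show ?thesis unfolding g(2) by (intro continuous_intros)
qed

lemma lam_unique:
  assumes "(\<Sum>v\<in>C. u v) = 1" "(\<Sum>v\<in>C. u v *\<^sub>R v) = y" "v \<in> C"
  shows "u v = lam v y"
  by (rule affine_combination_unique[OF independent finite_vertices assms(3,1) sum_lam])
    (simp only: assms(2) lam_point)

lemma lam_nonneg: "x \<in> convex hull C \<Longrightarrow> v \<in> C \<Longrightarrow> 0 \<le> lam v x"
proof -
  assume x: "x \<in> convex hull C" and v: "v \<in> C"
  then obtain u where "\<forall>v\<in>C. 0 \<le> u v" "sum u C = 1" "(\<Sum>v\<in>C. u v *\<^sub>R v) = x"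
    unfolding convex_hull_finite[OF finite_vertices] by blast
  then show ?thesis using lam_unique[OF _ _ v, of u x] v by auto
qed

lemma interiorI: "(\<And>v. v \<in> C \<Longrightarrow> 0 < lam v y) \<Longrightarrow> y \<in> interior (convex hull C)"
  by (rule interior_simplex_barycentric[OF independent _ sum_lam lam_point]) (auto simp: card)

text \<open>The relatively open facet opposite to \<open>w\<close>. Strict positivity removes the
  edges, where the outer normal may fail to be unique and several tetrahedra may meet.\<close>

definition facet_interior :: "pt \<Rightarrow> pt set" where
  "facet_interior w = {x. lam w x = 0 \<and> (\<forall>v\<in>C - {w}. 0 < lam v x)}"

lemma facet_interior_subset: "w \<in> C \<Longrightarrow> facet_interior w \<subseteq> convex hull C"
proof
  fix x assume "w \<in> C" "x \<in> facet_interior w"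
  then have "0 \<le> lam v x" if "v \<in> C" for v
    using that unfolding facet_interior_def by (cases "v = w") (auto simp: less_imp_le)
  then show "x \<in> convex hull C"
    unfolding convex_hull_finite[OF finite_vertices]
    by (intro CollectI exI[of _ "\<lambda>v. lam v x"] conjI ballI sum_lam lam_point)
qed

text \<open>Some coordinate vanishes at a boundary point. If it is the only one, the point is in an
  open facet; if a second one vanishes, the two remaining vertices span an edge through the
  point.\<close>

lemma boundary_cases:
  assumes "x \<in> convex hull C" "x \<notin> interior (convex hull C)"
  shows "(\<exists>w\<in>C. x \<in> facet_interior w) \<or> (\<exists>p\<in>C. \<exists>q\<in>C. x \<in> closed_segment p q)"
proof -
  obtain w where w: "w \<in> C" "lam w x = 0"
    using interiorI[of x] lam_nonneg[OF assms(1)] assms(2) by (metis less_eq_real_def)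
  show ?thesis
  proof (cases "\<exists>z\<in>C - {w}. lam z x = 0")
    case False
    then have "x \<in> facet_interior w"
      unfolding facet_interior_def using w lam_nonneg[OF assms(1)] by (force simp: less_eq_real_def)
    then show ?thesis using w(1) by blast
  next
    case True
    then obtain z where z: "z \<in> C" "z \<noteq> w" "lam z x = 0" by blast
    have "card (C - {w, z}) = 2" using card w z finite_vertices by (simp add: card_Diff_subset)
    then obtain p q where pq: "C - {w, z} = {p, q}" "p \<noteq> q" by (meson card_2_iff)
    have "(\<Sum>v\<in>C. lam v x) = (\<Sum>v\<in>{p, q}. lam v x)"
      using finite_vertices w z by (intro sum.mono_neutral_right) (auto simp flip: pq(1))
    moreover have "(\<Sum>v\<in>C. lam v x *\<^sub>R v) = (\<Sum>v\<in>{p, q}. lam v x *\<^sub>R v)"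
      using finite_vertices w z by (intro sum.mono_neutral_right) (auto simp flip: pq(1))
    ultimately have "lam p x + lam q x = 1" "lam p x *\<^sub>R p + lam q x *\<^sub>R q = x"
      using sum_lam[of x] lam_point[of x] pq(2) by auto
    then have "x = (1 - lam q x) *\<^sub>R p + lam q x *\<^sub>R q" "lam q x = 1 - lam p x"
      by (metis add_diff_cancel_right', simp)
    moreover have pqC: "p \<in> C" "q \<in> C" using pq by auto
    ultimately have "x \<in> closed_segment p q"
      unfolding in_segment using lam_nonneg[OF assms(1) pqC(1)] lam_nonneg[OF assms(1) pqC(2)]
      by (intro exI[of _ "lam q x"]) simp
    then show ?thesis using pqC by blast
  qed
qed

lemma facet_interior_borel: "w \<in> C \<Longrightarrow> facet_interior w \<in> sets borel"
proof -
  assume w: "w \<in> C"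
  have vimage: "lam v -` A \<in> sets borel" if "v \<in> C" "A \<in> sets borel" for v A
    using measurable_sets_borel[OF borel_measurable_continuous_onI[OF continuous_lam[OF that(1)]] that(2)] .
  have eq: "facet_interior w = (lam w -` {0}) \<inter> (\<Inter>v\<in>C - {w}. lam v -` {0<..})"
    unfolding facet_interior_def by auto
  have "card (C - {w}) = 3" using card w finite_vertices by simp
  then have "C - {w} \<noteq> {}" by (metis card.empty zero_neq_numeral)
  then have "(\<Inter>v\<in>C - {w}. lam v -` {0<..}) \<in> sets borel"
    using finite_vertices by (intro sets.finite_INT vimage) auto
  then show ?thesis unfolding eq using w by (intro sets.Int vimage) auto
qed

lemma facet_interior_area: "w \<in> C \<Longrightarrow> hausdorff2 (facet_interior w) < \<infinity>"
proof -
  assume w: "w \<in> C"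
  have "card (C - {w}) = 3" using card w finite_vertices by simp
  then obtain p q r where pqr: "C - {w} = {p, q, r}" "p \<noteq> q" "q \<noteq> r" "p \<noteq> r" by (metis card_3_iff)
  \<comment> \<open>The triangle is contained in the parallelogram spanned by two of its sides,
    whose area is already known to be finite.\<close>
  have "facet_interior w \<subseteq> {p + a *\<^sub>R (q - p) + b *\<^sub>R (r - p) | a b. 0 \<le> a \<and> a \<le> 1 \<and> 0 \<le> b \<and> b \<le> 1}"
  proof
    fix x assume x: "x \<in> facet_interior w"
    then have pos: "0 < lam p x" "0 < lam q x" "0 < lam r x" and zero: "lam w x = 0"
      unfolding facet_interior_def pqr(1) by auto
    have "(\<Sum>v\<in>C. lam v x) = (\<Sum>v\<in>{p, q, r}. lam v x)"
      using finite_vertices w zero by (intro sum.mono_neutral_right) (auto simp flip: pqr(1))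
    then have s: "lam p x = 1 - lam q x - lam r x" using sum_lam[of x] pqr by auto
    have "x = (\<Sum>v\<in>C. lam v x *\<^sub>R v)" by (rule lam_point[symmetric])
    also have "\<dots> = (\<Sum>v\<in>{p, q, r}. lam v x *\<^sub>R v)"
      using finite_vertices w zero by (intro sum.mono_neutral_right) (auto simp flip: pqr(1))
    also have "\<dots> = lam p x *\<^sub>R p + lam q x *\<^sub>R q + lam r x *\<^sub>R r" using pqr(2-4) by simp
    also have "\<dots> = p + lam q x *\<^sub>R (q - p) + lam r x *\<^sub>R (r - p)"
      unfolding s by (simp add: algebra_simps)
    finally show "x \<in> {p + a *\<^sub>R (q - p) + b *\<^sub>R (r - p) | a b. 0 \<le> a \<and> a \<le> 1 \<and> 0 \<le> b \<and> b \<le> 1}"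
      using pos s by (intro CollectI exI[of _ "lam q x"] exI[of _ "lam r x"]) simp
  qed
  from hausdorff2_mono[OF this] show ?thesis by (rule le_less_trans[OF _ hausdorff2_parallelogram])
qed

context
  fixes \<Omega> :: "pt set" and w :: pt
  assumes \<Omega>: "open \<Omega>" "convex \<Omega>" "\<Omega> \<noteq> {}" and sub: "convex hull C \<subseteq> closure \<Omega>" and w: "w \<in> C"
begin

text \<open>A supporting functional at a point of the open facet vanishes on that facet, hence is a
  negative multiple of the barycentric coordinate of the opposite vertex.\<close>

lemma facet_normal:
  assumes "x \<in> facet_interior w" "norm \<nu> = 1" "\<And>y. y \<in> \<Omega> \<Longrightarrow> \<nu> \<bullet> (y - x) \<le> 0"
  shows "\<exists>\<kappa><0. \<forall>y. \<nu> \<bullet> (y - x) = \<kappa> * lam w y"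
proof -
  have le: "\<nu> \<bullet> (y - x) \<le> 0" if "y \<in> closure \<Omega>" for y
  proof -
    have "closure \<Omega> \<subseteq> {y. \<nu> \<bullet> y \<le> \<nu> \<bullet> x}"
      using assms(3) by (intro closure_minimal closed_halfspace_le) (auto simp: inner_diff_right)
    then show ?thesis using that by (auto simp: inner_diff_right)
  qed
  have leC: "\<nu> \<bullet> (v - x) \<le> 0" if "v \<in> C" for v
    using le sub hull_inc[OF that] by blast
  have expand: "\<nu> \<bullet> (y - x) = (\<Sum>v\<in>C. lam v y * (\<nu> \<bullet> (v - x)))" for y
  proof -
    have "y - x = (\<Sum>v\<in>C. lam v y *\<^sub>R (v - x))"
      using lam_point[of y] sum_lam[of y]
      by (simp add: scaleR_diff_right sum_subtractf flip: scaleR_sum_left)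
    then show ?thesis by (simp add: inner_sum_right)
  qed
  \<comment> \<open>At \<open>y = x\<close> the expansion is a vanishing sum of nonpositive terms.
    The weights of the three vertices other than \<open>w\<close> are positive, so the functional is
    zero at each of these vertices.\<close>
  have "(\<Sum>v\<in>C. - (lam v x * (\<nu> \<bullet> (v - x)))) = 0" using expand[of x] by (simp add: sum_negf)
  moreover have "0 \<le> - (lam v x * (\<nu> \<bullet> (v - x)))" if "v \<in> C" for v
    using leC[OF that] lam_nonneg[OF _ that] facet_interior_subset[OF w] assms(1)
    by (simp add: mult_nonneg_nonpos subsetD)
  ultimately have z0: "lam v x * (\<nu> \<bullet> (v - x)) = 0" if "v \<in> C" for v
    using sum_nonneg_eq_0_iff[OF finite_vertices, of "\<lambda>v. - (lam v x * (\<nu> \<bullet> (v - x)))"] that by force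
  have z: "\<nu> \<bullet> (v - x) = 0" if "v \<in> C" "v \<noteq> w" for v
    using z0[OF that(1)] assms(1) that unfolding facet_interior_def by force
  define \<kappa> where "\<kappa> = \<nu> \<bullet> (w - x)"
  have eq: "\<nu> \<bullet> (y - x) = \<kappa> * lam w y" for y
  proof -
    have "(\<Sum>v\<in>C. lam v y * (\<nu> \<bullet> (v - x))) = (\<Sum>v\<in>{w}. lam v y * (\<nu> \<bullet> (v - x)))"
      using w finite_vertices z by (intro sum.mono_neutral_right) auto
    then show ?thesis using expand[of y] by (simp add: \<kappa>_def mult.commute)
  qed
  \<comment> \<open>Moving from \<open>x\<close> by the unit vector \<nu> itself changes the
    functional by 1.\<close>
  have "\<kappa> \<noteq> 0"
    using eq[of "x + \<nu>"] assms(2) by (auto simp: dot_square_norm)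
  then have "\<kappa> < 0" using leC[OF w] unfolding \<kappa>_def by linarith
  then show ?thesis using eq by blast
qed

text \<open>Both normals induce negative multiples of the coordinate \<open>lam w\<close>, hence are
  positive multiples of each other, and the unit length fixes the factor. As the base points may
  differ, this gives uniqueness at one point and constancy along the facet together.\<close>

lemma facet_normal_unique:
  assumes "x \<in> facet_interior w" "norm \<nu> = 1" "\<And>y. y \<in> \<Omega> \<Longrightarrow> \<nu> \<bullet> (y - x) \<le> 0"
    and "x' \<in> facet_interior w" "norm \<nu>' = 1" "\<And>y. y \<in> \<Omega> \<Longrightarrow> \<nu>' \<bullet> (y - x') \<le> 0"
  shows "\<nu> = \<nu>'"
proof -
  obtain \<kappa> where \<kappa>: "\<kappa> < 0" "\<And>y. \<nu> \<bullet> (y - x) = \<kappa> * lam w y"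
    using facet_normal[OF assms(1-3)] by blast
  obtain \<kappa>' where \<kappa>': "\<kappa>' < 0" "\<And>y. \<nu>' \<bullet> (y - x') = \<kappa>' * lam w y"
    using facet_normal[OF assms(4-6)] by blast
  define \<rho> where "\<rho> = \<kappa> / \<kappa>'"
  have \<rho>: "\<rho> > 0" unfolding \<rho>_def using \<kappa>(1) \<kappa>'(1) by (simp add: divide_neg_neg)
  have eq: "\<nu> \<bullet> (y - x) = \<rho> * (\<nu>' \<bullet> (y - x'))" for y
    unfolding \<kappa>(2) \<kappa>'(2) \<rho>_def using \<kappa>'(1) by simp
  have "\<nu> \<bullet> z = (\<rho> *\<^sub>R \<nu>') \<bullet> z" for z
  proof -
    have "\<nu> \<bullet> z = \<rho> * (\<nu>' \<bullet> (x - x')) + \<rho> * (\<nu>' \<bullet> z)"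
      using eq[of "x + z"] by (simp add: algebra_simps inner_diff_right inner_add_right)
    then show ?thesis using eq[of x] by simp
  qed
  then have e: "\<nu> = \<rho> *\<^sub>R \<nu>'" by (rule vector_eq_rdot[THEN iffD1, rule_format])
  then have "\<rho> = 1" using assms(2,5) \<rho> by simp
  then show ?thesis using e by simp
qed

text \<open>Outside the convex set a supporting normal exists, and by uniqueness it is the same at
  all such points of the facet. A facet contained in \<Omega> satisfies this vacuously, so facets
  need not be sorted into interior and boundary ones.\<close>

lemma outer_normal_facet:
  "\<exists>\<nu>. \<forall>x \<in> facet_interior w - \<Omega>. outer_normal \<Omega> x = \<nu>"
proof (cases "facet_interior w - \<Omega> = {}")
  case True
  then show ?thesis by blast
next
  case False
  then obtain x0 where x0: "x0 \<in> facet_interior w" "x0 \<notin> \<Omega>" by blast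
  obtain \<nu> where \<nu>: "norm \<nu> = 1" "\<And>y. y \<in> \<Omega> \<Longrightarrow> \<nu> \<bullet> (y - x0) \<le> 0"
    using convex_outer_normal_exists[OF \<Omega>(2,3) x0(2)] by blast
  have "outer_normal \<Omega> x = \<nu>" if "x \<in> facet_interior w - \<Omega>" for x
  proof -
    have x: "x \<in> facet_interior w" "x \<notin> \<Omega>" using that by auto
    obtain \<nu>' where \<nu>': "norm \<nu>' = 1" "\<And>y. y \<in> \<Omega> \<Longrightarrow> \<nu>' \<bullet> (y - x) \<le> 0"
      using convex_outer_normal_exists[OF \<Omega>(2,3) x(2)] by blast
    have uniq: "\<mu> = \<nu>" if "norm \<mu> = 1 \<and> (\<forall>y\<in>\<Omega>. \<mu> \<bullet> (y - x) \<le> 0)" for \<mu>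
      using facet_normal_unique[OF x(1) _ _ x0(1) \<nu>, of \<mu>] that by blast
    have "\<nu>' = \<nu>" using uniq \<nu>' by blast
    then have ex: "norm \<nu> = 1 \<and> (\<forall>y\<in>\<Omega>. \<nu> \<bullet> (y - x) \<le> 0)" using \<nu>' by blast
    then have "\<exists>!\<mu>. norm \<mu> = 1 \<and> (\<forall>y\<in>\<Omega>. \<mu> \<bullet> (y - x) \<le> 0)" using uniq by blast
    moreover have "(THE \<mu>. norm \<mu> = 1 \<and> (\<forall>y\<in>\<Omega>. \<mu> \<bullet> (y - x) \<le> 0)) = \<nu>"
      by (rule the_equality, rule ex, rule uniq)
    ultimately show ?thesis unfolding outer_normal_def Let_def by (simp only: if_True)
  qed
  then show ?thesis by blast
qed

text \<open>This reduces a boundary trace to the field of one tetrahedron. The coordinate of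
  \<open>w\<close> is positive on all of \<Omega>, because \<Omega> lies on one side of the facet;
  the other three are positive near \<open>x\<close> by continuity.\<close>

lemma eventually_interior_facet:
  assumes x: "x \<in> facet_interior w" "x \<notin> \<Omega>"
  shows "\<forall>\<^sub>F y in at x within \<Omega>. y \<in> interior (convex hull C)"
proof -
  obtain \<nu> where \<nu>: "norm \<nu> = 1" "\<And>y. y \<in> \<Omega> \<Longrightarrow> \<nu> \<bullet> (y - x) \<le> 0"
    using convex_outer_normal_exists[OF \<Omega>(2,3) x(2)] by blast
  obtain \<kappa> where \<kappa>: "\<kappa> < 0" "\<And>y. \<nu> \<bullet> (y - x) = \<kappa> * lam w y"
    using facet_normal[OF x(1) \<nu>] by blast
  \<comment> \<open>Openness leaves room for a step of length \<open>e / 2\<close> along the normal,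
    which makes the supporting inequality strict.\<close>
  have "0 < lam w y" if y: "y \<in> \<Omega>" for y
  proof -
    obtain e where e: "e > 0" "ball y e \<subseteq> \<Omega>" using \<Omega>(1) y open_contains_ball by blast
    have "y + (e / 2) *\<^sub>R \<nu> \<in> \<Omega>" using e \<nu>(1) by (intro subsetD[OF e(2)]) (simp add: dist_norm)
    from \<nu>(2)[OF this] have "\<nu> \<bullet> (y - x) + e / 2 \<le> 0"
      using \<nu>(1) by (simp add: inner_diff_right inner_add_right dot_square_norm)
    then have "\<kappa> * lam w y < 0" using \<kappa>(2)[of y] e(1) by linarith
    then show ?thesis using \<kappa>(1) by (simp add: mult_less_0_iff)
  qed
  then have 1: "\<forall>\<^sub>F y in at x within \<Omega>. 0 < lam w y"
    by (auto simp: eventually_at_filter)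
  have "\<forall>\<^sub>F y in at x within \<Omega>. 0 < lam v y" if "v \<in> C - {w}" for v
  proof -
    have "isCont (lam v) x" using continuous_lam[of v] that by (simp add: continuous_on_eq_continuous_at)
    then have "(lam v \<longlongrightarrow> lam v x) (at x within \<Omega>)"
      using continuous_at_imp_continuous_at_within continuous_within by blast
    moreover have "0 < lam v x" using x(1) that unfolding facet_interior_def by blast
    ultimately show ?thesis by (rule order_tendstoD(1))
  qed
  then have "\<forall>\<^sub>F y in at x within \<Omega>. \<forall>v\<in>C - {w}. 0 < lam v y"
    using finite_vertices by (intro eventually_ball_finite) auto
  with 1 show ?thesis
    by eventually_elim (rule interiorI, auto)
qed

end

end

lemma full_simplex_exists:
  assumes "3 simplex (t :: pt set)"
  obtains C lam where "full_simplex C lam" "t = convex hull C"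
proof -
  obtain C where C: "\<not> affine_dependent C" "int (card C) = 3 + 1" "t = convex hull C"
    using assms unfolding simplex_def by blast
  have "affine hull C = UNIV" using C by (intro affine_independent_span_eq) auto
  with C(1) obtain c g where cg: "\<And>v. v \<in> C \<Longrightarrow> linear (g v)"
    "\<And>y. (\<Sum>v\<in>C. c v + g v y) = 1" "\<And>y. (\<Sum>v\<in>C. (c v + g v y) *\<^sub>R v) = y"
    by (rule barycentric_coordinates) (rule that; assumption)
  have "full_simplex C (\<lambda>v y. c v + g v y)"
    using C cg by unfold_locales auto
  then show ?thesis using that C(3) by blast
qed

text \<open>A piece consists of an open facet, its tetrahedron and the outer normal on the part
  outside \<Omega>; \<open>B\<close> collects the edges. Recording the tetrahedron in the triple
  allows the pieces of a whole mesh to be merged into one finite set.\<close>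

lemma simplex_boundary_pieces:
  assumes "open \<Omega>" "convex \<Omega>" "\<Omega> \<noteq> {}" "3 simplex t" "t \<subseteq> closure \<Omega>"
  shows "\<exists>\<P> B. finite \<P> \<and> B \<in> null_sets area \<and> t - interior t \<subseteq> B \<union> (\<Union>(P, s, \<nu>)\<in>\<P>. P) \<and>
    (\<forall>(P, s, \<nu>)\<in>\<P>. P \<in> sets borel \<and> emeasure area P < \<infinity> \<and> s = t \<and>
      (\<forall>x\<in>P - \<Omega>. outer_normal \<Omega> x = \<nu> \<and> (\<forall>\<^sub>F y in at x within \<Omega>. y \<in> interior t)))"
proof -
  obtain C lam where "full_simplex C lam" and t: "t = convex hull C"
    using full_simplex_exists[OF assms(4)] by blast
  interpret full_simplex C lam by fact
  have sub: "convex hull C \<subseteq> closure \<Omega>" using assms(5) t by simp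
  have "\<forall>w\<in>C. \<exists>\<nu>. \<forall>x \<in> facet_interior w - \<Omega>. outer_normal \<Omega> x = \<nu>"
    using outer_normal_facet[OF assms(1-3) sub] by blast
  then obtain n where n: "\<And>w x. w \<in> C \<Longrightarrow> x \<in> facet_interior w - \<Omega> \<Longrightarrow> outer_normal \<Omega> x = n w"
    by metis
  define \<P> where "\<P> = (\<lambda>w. (facet_interior w, t, n w)) ` C"
  define B where "B = (\<Union>p\<in>C. \<Union>q\<in>C. closed_segment p q)"
  have "closed_segment p q \<in> null_sets area" for p q :: pt
    using emeasure_area_le[of "closed_segment p q"] hausdorff2_segment[of p q]
    by (intro null_setsI borel_sets_area) auto
  then have B: "B \<in> null_sets area" unfolding B_def using finite_vertices
    by (intro null_sets.finite_UN) auto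
  have cover: "t - interior t \<subseteq> B \<union> (\<Union>(P, s, \<nu>)\<in>\<P>. P)"
    using boundary_cases unfolding t B_def \<P>_def by fastforce
  have "emeasure area (facet_interior w) < \<infinity>" if "w \<in> C" for w
    using emeasure_area_le[OF facet_interior_borel[OF that]] facet_interior_area[OF that]
    by (rule le_less_trans)
  then have "\<forall>(P, s, \<nu>)\<in>\<P>. P \<in> sets borel \<and> emeasure area P < \<infinity> \<and> s = t \<and>
      (\<forall>x\<in>P - \<Omega>. outer_normal \<Omega> x = \<nu> \<and> (\<forall>\<^sub>F y in at x within \<Omega>. y \<in> interior t))"
    unfolding \<P>_def using facet_interior_borel n eventually_interior_facet[OF assms(1-3) sub] t by auto
  moreover have "finite \<P>" unfolding \<P>_def using finite_vertices by simp
  ultimately show ?thesis using B cover by blast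
qed

section \<open>Finite-dimensional spaces of functions\<close>

text \<open>Scalars are real throughout, also for complex-valued fields, so that sesquilinear forms
  count as linear in both arguments.\<close>

definition fun_subspace :: "('p \<Rightarrow> 'v::real_vector) set \<Rightarrow> bool" where
  "fun_subspace X \<longleftrightarrow> (\<lambda>_. 0) \<in> X \<and> (\<forall>u\<in>X. \<forall>v\<in>X. \<forall>c. (\<lambda>x. u x + c *\<^sub>R v x) \<in> X)"

definition fun_linear :: "('p \<Rightarrow> 'v::real_vector) set \<Rightarrow> (('p \<Rightarrow> 'v) \<Rightarrow> 'w::real_vector) \<Rightarrow> bool" where
  "fun_linear X T \<longleftrightarrow> (\<forall>u\<in>X. \<forall>v\<in>X. \<forall>c. T (\<lambda>x. u x + c *\<^sub>R v x) = T u + c *\<^sub>R T v)"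

lemma fun_subspaceD:
  assumes "fun_subspace X"
  shows "(\<lambda>_. 0) \<in> X" "u \<in> X \<Longrightarrow> v \<in> X \<Longrightarrow> (\<lambda>x. u x + c *\<^sub>R v x) \<in> X"
  using assms unfolding fun_subspace_def by auto

lemma fun_subspace_scale:
  assumes "fun_subspace X" "u \<in> X"
  shows "(\<lambda>x. c *\<^sub>R u x) \<in> X"
  using fun_subspaceD(2)[OF assms(1) fun_subspaceD(1)[OF assms(1)] assms(2), of c] by simp

lemma fun_linearD:
  "fun_linear X T \<Longrightarrow> u \<in> X \<Longrightarrow> v \<in> X \<Longrightarrow> T (\<lambda>x. u x + c *\<^sub>R v x) = T u + c *\<^sub>R T v"
  unfolding fun_linear_def by auto

lemma fun_linear_zero:
  assumes "fun_subspace X" "fun_linear X T"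
  shows "T (\<lambda>_. 0) = 0"
proof -
  have "(\<lambda>_. 0) \<in> X" by (rule fun_subspaceD(1)[OF assms(1)])
  from fun_linearD[OF assms(2) this this, of 1] show ?thesis by simp
qed

lemma fun_subspace_sum:
  assumes "fun_subspace X" "finite J" "\<And>j. j \<in> J \<Longrightarrow> G j \<in> X"
  shows "(\<lambda>x. \<Sum>j\<in>J. c j *\<^sub>R G j x) \<in> X"
  using assms(2,3)
proof (induction J rule: finite_induct)
  case empty
  then show ?case using fun_subspaceD(1)[OF assms(1)] by simp
next
  case (insert j J)
  have "(\<lambda>x. (\<Sum>i\<in>J. c i *\<^sub>R G i x) + c j *\<^sub>R G j x) \<in> X"
    using insert by (intro fun_subspaceD(2)[OF assms(1)]) auto
  then show ?case using insert by (simp add: add.commute)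
qed

lemma fun_linear_sum:
  assumes "fun_subspace X" "fun_linear X T" "finite J" "\<And>j. j \<in> J \<Longrightarrow> G j \<in> X"
  shows "T (\<lambda>x. \<Sum>j\<in>J. c j *\<^sub>R G j x) = (\<Sum>j\<in>J. c j *\<^sub>R T (G j))"
  using assms(3,4)
proof (induction J rule: finite_induct)
  case empty
  then show ?case using fun_linear_zero[OF assms(1,2)] by simp
next
  case (insert j J)
  have "T (\<lambda>x. (\<Sum>i\<in>J. c i *\<^sub>R G i x) + c j *\<^sub>R G j x)
      = T (\<lambda>x. \<Sum>i\<in>J. c i *\<^sub>R G i x) + c j *\<^sub>R T (G j)"
    using insert by (intro fun_linearD[OF assms(2)] fun_subspace_sum[OF assms(1)]) auto
  then show ?case using insert by (simp add: add.commute)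
qed

lemma fun_linear_expand:
  assumes "fun_subspace X" "fun_linear X T" "finite J" "\<And>j. j \<in> J \<Longrightarrow> G j \<in> X"
    and "u = (\<lambda>x. \<Sum>j\<in>J. c j *\<^sub>R G j x)"
  shows "T u = (\<Sum>j\<in>J. c j *\<^sub>R T (G j))"
  unfolding assms(5) by (rule fun_linear_sum[OF assms(1-4)])

lemma fun_linear_scale:
  assumes "fun_subspace X" "fun_linear X T" "u \<in> X"
  shows "T (\<lambda>x. c *\<^sub>R u x) = c *\<^sub>R T u"
  using fun_linearD[OF assms(2) fun_subspaceD(1)[OF assms(1)] assms(3), of c]
    fun_linear_zero[OF assms(1,2)] by simp

text \<open>Gaussian elimination: the coefficients of \<open>u\<close> are the given functionals themselves.\<close>

lemma fun_dual_family:
  fixes \<l> :: "'j \<Rightarrow> ('p \<Rightarrow> 'v::real_vector) \<Rightarrow> real"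
  assumes "finite J" "fun_subspace X" "\<And>j. j \<in> J \<Longrightarrow> fun_linear X (\<l> j)"
    and "\<And>u. u \<in> X \<Longrightarrow> (\<forall>j\<in>J. \<l> j u = 0) \<Longrightarrow> u = (\<lambda>_. 0)"
  shows "\<exists>G. (\<forall>j\<in>J. G j \<in> X) \<and> (\<forall>u\<in>X. u = (\<lambda>x. \<Sum>j\<in>J. \<l> j u *\<^sub>R G j x))"
  using assms
proof (induction J arbitrary: X rule: finite_induct)
  case empty
  then show ?case by auto
next
  case (insert j J)
  have lin: "fun_linear X (\<l> i)" if "i \<in> insert j J" for i
    using insert.prems(2) that .
  define Y where "Y = {u \<in> X. \<l> j u = 0}"
  have Y: "fun_subspace Y"
    unfolding fun_subspace_def Y_def
    using fun_subspaceD[OF insert.prems(1)] fun_linear_zero[OF insert.prems(1) lin[of j]]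
      fun_linearD[OF lin[of j]] by auto
  have "\<exists>G. (\<forall>i\<in>J. G i \<in> Y) \<and> (\<forall>u\<in>Y. u = (\<lambda>x. \<Sum>i\<in>J. \<l> i u *\<^sub>R G i x))"
  proof (rule insert.IH[OF Y])
    show "fun_linear Y (\<l> i)" if "i \<in> J" for i
      using lin[of i] that unfolding fun_linear_def Y_def by auto
    show "u = (\<lambda>_. 0)" if "u \<in> Y" "\<forall>i\<in>J. \<l> i u = 0" for u
      using insert.prems(3)[of u] that unfolding Y_def by auto
  qed
  then obtain G where G: "\<And>i. i \<in> J \<Longrightarrow> G i \<in> Y"
    and rec: "\<And>u. u \<in> Y \<Longrightarrow> u = (\<lambda>x. \<Sum>i\<in>J. \<l> i u *\<^sub>R G i x)" by blast
  have GX: "G i \<in> X" if "i \<in> J" for i using G that unfolding Y_def by auto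
  show ?case
  proof (cases "\<forall>u\<in>X. \<l> j u = 0")
    case True
    then have "Y = X" unfolding Y_def by auto
    \<comment> \<open>The coefficient of the new element is always zero in this case, so any member
      of \<open>X\<close> can be inserted.\<close>
    define G' where "G' = G(j := (\<lambda>_. 0))"
    have "(\<Sum>i\<in>J. \<l> i u *\<^sub>R G' i x) = (\<Sum>i\<in>J. \<l> i u *\<^sub>R G i x)" for u x
      using insert.hyps by (intro sum.cong) (auto simp: G'_def)
    then have "(\<Sum>i\<in>insert j J. \<l> i u *\<^sub>R G' i x) = (\<Sum>i\<in>J. \<l> i u *\<^sub>R G i x)" for u x
      using insert.hyps by (simp add: G'_def)
    then have "\<forall>u\<in>X. u = (\<lambda>x. \<Sum>i\<in>insert j J. \<l> i u *\<^sub>R G' i x)"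
      using rec \<open>Y = X\<close> by simp
    moreover have "\<forall>i\<in>insert j J. G' i \<in> X"
      using GX fun_subspaceD(1)[OF insert.prems(1)] by (auto simp: G'_def)
    ultimately show ?thesis by blast
  next
    case False
    then obtain e0 where e0: "e0 \<in> X" "\<l> j e0 \<noteq> 0" by blast
    define e where "e = (\<lambda>x. (1 / \<l> j e0) *\<^sub>R e0 x)"
    have e: "e \<in> X" unfolding e_def by (rule fun_subspace_scale[OF insert.prems(1) e0(1)])
    have ej: "\<l> j e = 1"
      using fun_linear_scale[OF insert.prems(1) lin[of j] e0(1), of "1 / \<l> j e0"] e0(2)
      unfolding e_def by simp
    \<comment> \<open>Subtracting the multiple \<open>\<l> j u\<close> of \<open>e\<close> moves
      \<open>u\<close> into the kernel \<open>Y\<close> but alters its other coefficients. The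
      correction built into \<open>g\<close> compensates for this, so that the coefficients
      \<open>\<l> i u\<close> of \<open>u\<close> itself appear.\<close>
    define g where "g = (\<lambda>x. e x + (-1) *\<^sub>R (\<Sum>i\<in>J. \<l> i e *\<^sub>R G i x))"
    have g: "g \<in> X" unfolding g_def
      by (intro fun_subspaceD(2)[OF insert.prems(1)] e fun_subspace_sum[OF insert.prems(1)] insert.hyps GX)
    define G' where "G' = G(j := g)"
    have "u = (\<lambda>x. \<Sum>i\<in>insert j J. \<l> i u *\<^sub>R G' i x)" if u: "u \<in> X" for u
    proof -
      define v where "v = (\<lambda>x. u x + (- \<l> j u) *\<^sub>R e x)"
      have lv: "\<l> i v = \<l> i u - \<l> j u * \<l> i e" if "i \<in> insert j J" for i
        unfolding v_def using fun_linearD[OF lin[OF that] u e, of "- \<l> j u"] by simp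
      have "v \<in> Y"
        using fun_subspaceD(2)[OF insert.prems(1) u e, of "- \<l> j u"] lv[of j] ej
        unfolding Y_def v_def by simp
      from rec[OF this] have v: "v x = (\<Sum>i\<in>J. \<l> i v *\<^sub>R G i x)" for x by metis
      show ?thesis
      proof
        fix x
        have "u x = v x + \<l> j u *\<^sub>R e x" unfolding v_def by simp
        also have "v x = (\<Sum>i\<in>J. \<l> i u *\<^sub>R G i x - \<l> j u *\<^sub>R (\<l> i e *\<^sub>R G i x))"
          unfolding v[of x] by (intro sum.cong refl) (simp add: lv scaleR_diff_left)
        also have "\<dots> = (\<Sum>i\<in>J. \<l> i u *\<^sub>R G i x) - \<l> j u *\<^sub>R (\<Sum>i\<in>J. \<l> i e *\<^sub>R G i x)"
          by (simp only: sum_subtractf scaleR_sum_right)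
        finally have "u x = (\<Sum>i\<in>J. \<l> i u *\<^sub>R G i x) + \<l> j u *\<^sub>R g x"
          unfolding g_def by (simp add: algebra_simps)
        also have "(\<Sum>i\<in>J. \<l> i u *\<^sub>R G i x) = (\<Sum>i\<in>J. \<l> i u *\<^sub>R G' i x)"
          using insert.hyps by (intro sum.cong) (auto simp: G'_def)
        finally show "u x = (\<Sum>i\<in>insert j J. \<l> i u *\<^sub>R G' i x)"
          using insert.hyps by (simp add: G'_def add.commute)
      qed
    qed
    moreover have "\<forall>i\<in>insert j J. G' i \<in> X" using GX g by (auto simp: G'_def)
    ultimately show ?thesis by blast
  qed
qed

text \<open>With the components of point values as functionals, convergence at the points of
  \<open>P\<close> controls convergence everywhere. The domain type is arbitrary, so the lemma also
  applies to spaces of functionals, whose points are fields.\<close>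

lemma fun_reconstruction:
  fixes X :: "('p \<Rightarrow> 'v::euclidean_space) set"
  assumes "finite P" "fun_subspace X" "\<And>u. u \<in> X \<Longrightarrow> (\<forall>p\<in>P. u p = 0) \<Longrightarrow> u = (\<lambda>_. 0)"
  shows "\<exists>G. (\<forall>j\<in>P \<times> Basis. G j \<in> X) \<and>
    (\<forall>u\<in>X. u = (\<lambda>x. \<Sum>j\<in>P \<times> Basis. (u (fst j) \<bullet> snd j) *\<^sub>R G j x))"
proof (rule fun_dual_family[where \<l> = "\<lambda>j u. u (fst j) \<bullet> snd j"])
  show "finite (P \<times> (Basis :: 'v set))" using assms(1) by simp
  show "fun_linear X (\<lambda>u. u (fst j) \<bullet> snd j)" for j :: "'p \<times> 'v"
    unfolding fun_linear_def by (simp add: inner_add_left)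
  show "u = (\<lambda>_. 0)" if "u \<in> X" "\<forall>j\<in>P \<times> Basis. u (fst j) \<bullet> snd j = 0" for u
  proof (rule assms(3)[OF that(1)], rule ballI)
    show "u p = 0" if "p \<in> P" for p
      using that \<open>\<forall>j\<in>P \<times> Basis. u (fst j) \<bullet> snd j = 0\<close> by (intro euclidean_eqI[of "u p"]) simp
  qed
qed (rule assms(2))

section \<open>Compactness and the limit of saddle point problems\<close>

lemma bounded_family_convergent_subseq:
  fixes c :: "nat \<Rightarrow> 'j \<Rightarrow> 'a::heine_borel"
  assumes "finite J" "\<And>j. j \<in> J \<Longrightarrow> bounded (range (\<lambda>n. c n j))"
  shows "\<exists>r d. strict_mono (r :: nat \<Rightarrow> nat) \<and> (\<forall>j\<in>J. (\<lambda>n. c (r n) j) \<longlonglongrightarrow> d j)"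
  using assms
proof (induction J rule: finite_induct)
  case empty
  then show ?case using strict_mono_id by auto
next
  case (insert j J)
  then obtain r d where r: "strict_mono (r :: nat \<Rightarrow> nat)"
    and d: "\<And>i. i \<in> J \<Longrightarrow> (\<lambda>n. c (r n) i) \<longlonglongrightarrow> d i" by (metis insertCI)
  have "bounded (range (\<lambda>n. c n j))" using insert.prems by simp
  then have "bounded (range (\<lambda>n. c (r n) j))" by (rule bounded_subset) auto
  then obtain l q where q: "strict_mono (q :: nat \<Rightarrow> nat)"
    and l: "((\<lambda>n. c (r n) j) \<circ> q) \<longlonglongrightarrow> l"
    using bounded_imp_convergent_subsequence by blast
  have "strict_mono (r \<circ> q)" using r q by (rule strict_mono_o)
  moreover have "(\<lambda>n. c ((r \<circ> q) n) i) \<longlonglongrightarrow> (d(j := l)) i" if "i \<in> insert j J" for i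
    using that l LIMSEQ_subseq_LIMSEQ[OF d q, of i] by (auto simp: o_def)
  ultimately show ?case by blast
qed

text \<open>\<open>W\<close> stands for the functionals that the potentials induce on test fields
  and \<open>D\<close> for the constraints. A potential enters only through its functional, so
  potentials inducing the same one are identified.\<close>

definition saddle_solution ::
  "('p \<Rightarrow> 'v) set \<Rightarrow> (('p \<Rightarrow> 'v) \<Rightarrow> complex) set \<Rightarrow> (('p \<Rightarrow> 'v) \<Rightarrow> complex) set \<Rightarrow>
   (('p \<Rightarrow> 'v) \<Rightarrow> ('p \<Rightarrow> 'v) \<Rightarrow> complex) \<Rightarrow> (('p \<Rightarrow> 'v) \<Rightarrow> complex) \<Rightarrow> ('p \<Rightarrow> 'v) \<Rightarrow> bool" where
  "saddle_solution X W D a l E \<longleftrightarrow>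
     E \<in> X \<and> (\<exists>w\<in>W. \<forall>F\<in>X. a E F + w F = l F) \<and> (\<forall>d\<in>D. d E = 0)"

text \<open>No inf-sup constant is needed: rescaling the solution and the right-hand side together by
  \<open>\<tau> \<le> 1\<close> keeps the sequence bounded, and uniqueness for the limit problem excludes \<open>\<tau> \<rightarrow> 0\<close>. The
  multipliers need not be bounded separately, because the finite-dimensional space \<open>W\<close> of
  functionals is closed.\<close>

lemma saddle_solution_limit:
  fixes X :: "('p \<Rightarrow> 'v::euclidean_space) set" and W D :: "(('p \<Rightarrow> 'v) \<Rightarrow> complex) set"
    and \<l> :: "'j \<Rightarrow> ('p \<Rightarrow> 'v) \<Rightarrow> real"
  assumes X: "fun_subspace X" "finite J" "\<And>j. j \<in> J \<Longrightarrow> G j \<in> X" "\<And>j. j \<in> J \<Longrightarrow> fun_linear X (\<l> j)"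
      "\<And>u. u \<in> X \<Longrightarrow> u = (\<lambda>x. \<Sum>j\<in>J. \<l> j u *\<^sub>R G j x)"
    and W: "fun_subspace W" "\<And>w. w \<in> W \<Longrightarrow> fun_linear X w" "\<And>w F. w \<in> W \<Longrightarrow> F \<notin> X \<Longrightarrow> w F = 0"
    and D: "\<And>d. d \<in> D \<Longrightarrow> fun_linear X d"
    and l: "fun_linear X l"
    and A: "\<And>k F. F \<in> X \<Longrightarrow> fun_linear X (\<lambda>E. A k E F)"
    and B: "\<And>F. F \<in> X \<Longrightarrow> fun_linear X (\<lambda>E. B E F)" "\<And>E. E \<in> X \<Longrightarrow> fun_linear X (B E)"
    and AB: "\<And>i j. i \<in> J \<Longrightarrow> j \<in> J \<Longrightarrow> (\<lambda>k. A k (G i) (G j)) \<longlonglongrightarrow> B (G i) (G j)"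
    and sol: "\<And>k. saddle_solution X W D (A k) l (E k)" "saddle_solution X W D B l E'"
    and unique: "\<And>F. saddle_solution X W D B l F \<Longrightarrow> F = E'"
  shows "\<exists>r. strict_mono (r :: nat \<Rightarrow> nat) \<and> (\<forall>j\<in>J. (\<lambda>k. \<l> j (E (r k))) \<longlonglongrightarrow> \<l> j E')"
proof -
  define \<tau> where "\<tau> k = 1 / max 1 (\<Sum>j\<in>J. \<bar>\<l> j (E k)\<bar>)" for k
  define c where "c k j = \<tau> k * \<l> j (E k)" for k j
  have \<tau>: "0 < \<tau> k" "\<tau> k \<le> 1" for k unfolding \<tau>_def by auto
  have c_le: "\<bar>c k j\<bar> \<le> 1" if "j \<in> J" for k j
  proof -
    have "\<bar>\<l> j (E k)\<bar> \<le> (\<Sum>j\<in>J. \<bar>\<l> j (E k)\<bar>)"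
      using that X(2) by (intro member_le_sum) auto
    then have "\<bar>\<l> j (E k)\<bar> \<le> max 1 (\<Sum>j\<in>J. \<bar>\<l> j (E k)\<bar>)" by linarith
    then show ?thesis unfolding c_def \<tau>_def by (simp add: abs_mult divide_simps)
  qed
  \<comment> \<open>Either \<open>\<tau> k\<close> is 1 or the scaled coefficients have absolute sum
    1, so scale and coefficients cannot tend to zero together.\<close>
  have norm1: "1 \<le> \<tau> k + (\<Sum>j\<in>J. \<bar>c k j\<bar>)" for k
  proof -
    have "(\<Sum>j\<in>J. \<bar>c k j\<bar>) = \<tau> k * (\<Sum>j\<in>J. \<bar>\<l> j (E k)\<bar>)"
      using \<tau>(1)[of k] unfolding c_def by (simp add: abs_mult sum_distrib_left)
    then show ?thesis
      using sum_nonneg[of J "\<lambda>j. \<bar>\<l> j (E k)\<bar>"] unfolding \<tau>_def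
      by (auto simp: max_def divide_simps)
  qed
  \<comment> \<open>The option type joins the scale (\<open>None\<close>) and the coefficients in
    one finite family, so one extraction serves both.\<close>
  define f where "f k q = (case q of None \<Rightarrow> \<tau> k | Some j \<Rightarrow> c k j)" for k q
  have "\<exists>r d. strict_mono (r :: nat \<Rightarrow> nat) \<and> (\<forall>q\<in>insert None (Some ` J). (\<lambda>n. f (r n) q) \<longlonglongrightarrow> d q)"
  proof (rule bounded_family_convergent_subseq)
    show "bounded (range (\<lambda>n. f n q))" if "q \<in> insert None (Some ` J)" for q
    proof (rule boundedI[of _ 1])
      fix z assume "z \<in> range (\<lambda>n. f n q)"
      then obtain n where "z = f n q" by blast
      then show "norm z \<le> 1"
        using that c_le \<tau>[of n] by (auto simp: f_def)
    qed
  qed (use X(2) in simp)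
  then obtain r d' where r: "strict_mono (r :: nat \<Rightarrow> nat)"
    and d': "\<And>q. q \<in> insert None (Some ` J) \<Longrightarrow> (\<lambda>n. f (r n) q) \<longlonglongrightarrow> d' q" by blast
  define t where "t = d' None"
  define d where "d j = d' (Some j)" for j
  have t: "(\<lambda>k. \<tau> (r k)) \<longlonglongrightarrow> t" using d'[of None] by (simp add: f_def t_def)
  have d: "(\<lambda>k. c (r k) j) \<longlonglongrightarrow> d j" if "j \<in> J" for j
    using d'[of "Some j"] that by (simp add: f_def d_def)
  define H where "H = (\<lambda>x. \<Sum>j\<in>J. d j *\<^sub>R G j x)"
  have HX: "H \<in> X" unfolding H_def by (rule fun_subspace_sum[OF X(1,2,3)])
  have EX: "E k \<in> X" for k using sol(1)[of k] unfolding saddle_solution_def by simp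
  have E'X: "E' \<in> X" using sol(2) unfolding saddle_solution_def by simp
  have expand: "T u = (\<Sum>j\<in>J. \<l> j u *\<^sub>R T (G j))" if "u \<in> X" "fun_linear X T"
    for u and T :: "('p \<Rightarrow> 'v) \<Rightarrow> complex"
    by (rule fun_linear_expand[where c = "\<lambda>j. \<l> j u", OF X(1) that(2) X(2,3) X(5)[OF that(1)]])
  have scaled: "\<tau> k *\<^sub>R T (E k) = (\<Sum>j\<in>J. c k j *\<^sub>R T (G j))" if "fun_linear X T"
    for k and T :: "('p \<Rightarrow> 'v) \<Rightarrow> complex"
    unfolding expand[OF EX that] c_def by (simp add: scaleR_sum_right)
  have Hlin: "T H = (\<Sum>j\<in>J. d j *\<^sub>R T (G j))" if "fun_linear X T"
    for T :: "('p \<Rightarrow> 'v) \<Rightarrow> complex"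
    unfolding H_def by (rule fun_linear_sum[where G = G, OF X(1) that X(2,3)])
  \<comment> \<open>The functions \<open>G j\<close> may be linearly dependent, so \<open>d\<close>
    need not be the coordinates of \<open>H\<close> by definition. It is, because the coordinates of
    the states satisfy a linear relation that survives the limit.\<close>
  have lH: "\<l> i H = d i" if i: "i \<in> J" for i
  proof -
    have "c k i = (\<Sum>j\<in>J. c k j * \<l> i (G j))" for k
    proof -
      have "\<l> i (E k) = (\<Sum>j\<in>J. \<l> j (E k) *\<^sub>R \<l> i (G j))"
        by (rule fun_linear_expand[where c = "\<lambda>j. \<l> j (E k)", OF X(1) X(4)[OF i] X(2,3) X(5)[OF EX]])
      then show ?thesis unfolding c_def
        by (metis (no_types, lifting) mult.assoc real_scaleR_def sum.cong sum_distrib_left)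
    qed
    moreover have "(\<lambda>k. \<Sum>j\<in>J. c (r k) j * \<l> i (G j)) \<longlonglongrightarrow> (\<Sum>j\<in>J. d j * \<l> i (G j))"
      by (intro tendsto_intros d)
    ultimately have "(\<lambda>k. c (r k) i) \<longlonglongrightarrow> (\<Sum>j\<in>J. d j * \<l> i (G j))" by simp
    then have "d i = (\<Sum>j\<in>J. d j * \<l> i (G j))" using d[OF i] LIMSEQ_unique by blast
    also have "\<dots> = \<l> i H"
      unfolding H_def
      using fun_linear_sum[where G = G and c = d, OF X(1) X(4)[OF i] X(2,3)] by simp
    finally show ?thesis by simp
  qed
  have "\<exists>w\<in>W. \<forall>F\<in>X. a E0 F + w F = l F" if "saddle_solution X W D a l E0" for a E0
    using that unfolding saddle_solution_def by auto
  then have "\<forall>k. \<exists>w\<in>W. \<forall>F\<in>X. A k (E k) F + w F = l F" using sol(1) by blast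
  then obtain w where w: "\<And>k. w k \<in> W" "\<And>k F. F \<in> X \<Longrightarrow> A k (E k) F + w k F = l F" by metis
  define v where "v k = (\<lambda>F. \<tau> k *\<^sub>R w k F)" for k
  have vW: "v k \<in> W" for k unfolding v_def by (rule fun_subspace_scale[OF W(1) w(1)])
  \<comment> \<open>The equation expresses the multiplier through the state and the source, so its
    values converge with theirs.\<close>
  have lim: "(\<lambda>k. v (r k) (G i)) \<longlonglongrightarrow> t *\<^sub>R l (G i) - B H (G i)" if i: "i \<in> J" for i
  proof -
    have "v k (G i) = \<tau> k *\<^sub>R l (G i) - (\<Sum>j\<in>J. c k j *\<^sub>R A k (G j) (G i))" for k
    proof -
      have "v k (G i) = \<tau> k *\<^sub>R l (G i) - \<tau> k *\<^sub>R A k (E k) (G i)"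
        using w(2)[OF X(3)[OF i], of k] unfolding v_def
        by (metis add_diff_cancel_left' scaleR_diff_right)
      then show ?thesis using scaled[OF A[OF X(3)[OF i]], of k k] by simp
    qed
    moreover have "(\<lambda>k. \<tau> (r k) *\<^sub>R l (G i) - (\<Sum>j\<in>J. c (r k) j *\<^sub>R A (r k) (G j) (G i)))
        \<longlonglongrightarrow> t *\<^sub>R l (G i) - (\<Sum>j\<in>J. d j *\<^sub>R B (G j) (G i))"
      by (intro tendsto_intros t d LIMSEQ_subseq_LIMSEQ[OF AB r, unfolded o_def] i)
    ultimately show ?thesis using Hlin[OF B(1)[OF X(3)[OF i]]] by simp
  qed
  \<comment> \<open>A functional in \<open>W\<close> is determined by its values on the
    \<open>G j\<close>: by linearity on \<open>X\<close>, and by the convention that it is zero off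
    \<open>X\<close>.\<close>
  have "\<exists>K. (\<forall>j\<in>(G ` J) \<times> Basis. K j \<in> W) \<and>
    (\<forall>u\<in>W. u = (\<lambda>x. \<Sum>j\<in>(G ` J) \<times> Basis. (u (fst j) \<bullet> snd j) *\<^sub>R K j x))"
  proof (rule fun_reconstruction[OF _ W(1)])
    show "u = (\<lambda>_. 0)" if "u \<in> W" "\<forall>p\<in>G ` J. u p = 0" for u
    proof
      fix F show "u F = 0"
        using W(3)[OF that(1), of F] expand[OF _ W(2)[OF that(1)], of F] that(2) by (cases "F \<in> X") auto
    qed
  qed (use X(2) in simp)
  then obtain K where K0: "\<forall>j\<in>(G ` J) \<times> Basis. K j \<in> W"
    "\<forall>u\<in>W. u = (\<lambda>x. \<Sum>j\<in>(G ` J) \<times> Basis. (u (fst j) \<bullet> snd j) *\<^sub>R K j x)"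
    by (elim exE conjE)
  note K = K0(1)[rule_format] and KW = K0(2)[rule_format]
  define y where "y F = t *\<^sub>R l F - B H F" for F
  \<comment> \<open>The limit values \<open>y\<close> are fed into the reconstruction formula, which
    produces a member of \<open>W\<close>. Uniqueness of limits then shows that \<open>w'\<close>
    takes the values \<open>y\<close> at the \<open>G j\<close>.\<close>
  define w' where "w' = (\<lambda>F. \<Sum>j\<in>(G ` J) \<times> Basis. (y (fst j) \<bullet> snd j) *\<^sub>R K j F)"
  have w'W: "w' \<in> W" unfolding w'_def using X(2) K by (intro fun_subspace_sum[OF W(1)]) auto
  have "(\<lambda>k. v (r k) F) \<longlonglongrightarrow> w' F" for F
  proof -
    have "v (r k) F = (\<Sum>j\<in>(G ` J) \<times> Basis. (v (r k) (fst j) \<bullet> snd j) *\<^sub>R K j F)" for k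
      using fun_cong[OF KW[OF vW]] .
    moreover have "(\<lambda>k. \<Sum>j\<in>(G ` J) \<times> Basis. (v (r k) (fst j) \<bullet> snd j) *\<^sub>R K j F)
        \<longlonglongrightarrow> (\<Sum>j\<in>(G ` J) \<times> Basis. (y (fst j) \<bullet> snd j) *\<^sub>R K j F)"
      unfolding y_def by (intro tendsto_intros) (auto intro: lim)
    ultimately show ?thesis unfolding w'_def by simp
  qed
  then have w'G: "w' (G i) = y (G i)" if "i \<in> J" for i
    using lim[OF that] LIMSEQ_unique unfolding y_def by blast
  have BH: "B H F + w' F = t *\<^sub>R l F" if "F \<in> X" for F
  proof -
    have "B H F + w' F = (\<Sum>j\<in>J. \<l> j F *\<^sub>R (B H (G j) + w' (G j)))"
      unfolding expand[OF that B(2)[OF HX]] expand[OF that W(2)[OF w'W]]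
      by (simp add: sum.distrib scaleR_add_right)
    also have "\<dots> = (\<Sum>j\<in>J. \<l> j F *\<^sub>R (t *\<^sub>R l (G j)))"
      by (intro sum.cong) (auto simp: w'G y_def)
    also have "\<dots> = t *\<^sub>R l F"
      unfolding expand[OF that l] by (simp add: scaleR_sum_right mult.commute)
    finally show ?thesis .
  qed
  have DH: "e H = 0" if "e \<in> D" for e
  proof -
    have "e (E k) = 0" for k using sol(1)[of k] that unfolding saddle_solution_def by auto
    then have "(\<Sum>j\<in>J. c (r k) j *\<^sub>R e (G j)) = 0" for k
      using scaled[OF D[OF that], of "r k"] by simp
    moreover have "(\<lambda>k. \<Sum>j\<in>J. c (r k) j *\<^sub>R e (G j)) \<longlonglongrightarrow> (\<Sum>j\<in>J. d j *\<^sub>R e (G j))"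
      by (intro tendsto_intros d)
    ultimately have "(\<Sum>j\<in>J. d j *\<^sub>R e (G j)) = 0" by (simp add: LIMSEQ_const_iff)
    then show ?thesis using Hlin[OF D[OF that]] by simp
  qed
  \<comment> \<open>\<open>H\<close> solves the limit problem with source
    \<open>t *\<^sub>R l\<close>. Adding \<open>1 - t\<close> times the known solution restores the
    full source without dividing by \<open>t\<close>, which could still be zero.\<close>
  define Z where "Z = (\<lambda>x. H x + (1 - t) *\<^sub>R E' x)"
  have "saddle_solution X W D B l Z"
    unfolding saddle_solution_def
  proof (intro conjI ballI)
    show "Z \<in> X" unfolding Z_def by (rule fun_subspaceD(2)[OF X(1) HX E'X])
    obtain w1 where w1: "w1 \<in> W" "\<And>F. F \<in> X \<Longrightarrow> B E' F + w1 F = l F"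
      using sol(2) unfolding saddle_solution_def by blast
    define w2 where "w2 = (\<lambda>F. w' F + (1 - t) *\<^sub>R w1 F)"
    have "w2 \<in> W" unfolding w2_def by (rule fun_subspaceD(2)[OF W(1) w'W w1(1)])
    moreover have "B Z F + w2 F = l F" if "F \<in> X" for F
    proof -
      have "B Z F + w2 F = (B H F + w' F) + (1 - t) *\<^sub>R (B E' F + w1 F)"
        unfolding Z_def w2_def using fun_linearD[OF B(1)[OF that] HX E'X, of "1 - t"]
        by (simp add: algebra_simps)
      also have "\<dots> = l F" unfolding BH[OF that] w1(2)[OF that] by (simp add: algebra_simps)
      finally show ?thesis .
    qed
    ultimately show "\<exists>w\<in>W. \<forall>F\<in>X. B Z F + w F = l F" by blast
    fix e assume e: "e \<in> D"
    have "e E' = 0" using sol(2) e unfolding saddle_solution_def by auto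
    then show "e Z = 0"
      unfolding Z_def using fun_linearD[OF D[OF e] HX E'X, of "1 - t"] DH[OF e] by simp
  qed
  then have "Z = E'" by (rule unique)
  have H_eq: "H = (\<lambda>x. t *\<^sub>R E' x)"
  proof
    fix x
    have "H x + (1 - t) *\<^sub>R E' x = E' x" using \<open>Z = E'\<close> unfolding Z_def by metis
    then show "H x = t *\<^sub>R E' x" by (simp add: algebra_simps)
  qed
  have d_eq: "d i = t * \<l> i E'" if "i \<in> J" for i
    using lH[OF that] fun_linear_scale[OF X(1) X(4)[OF that] E'X, of t] unfolding H_eq by simp
  \<comment> \<open>In the limit this excludes \<open>t = 0\<close>, since all \<open>d j\<close>
    carry the factor \<open>t\<close>; the scaling can then be undone.\<close>
  have "1 \<le> t + (\<Sum>j\<in>J. \<bar>d j\<bar>)"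
  proof (rule LIMSEQ_le_const)
    show "(\<lambda>k. \<tau> (r k) + (\<Sum>j\<in>J. \<bar>c (r k) j\<bar>)) \<longlonglongrightarrow> t + (\<Sum>j\<in>J. \<bar>d j\<bar>)"
      by (intro tendsto_intros t d)
  qed (use norm1 in auto)
  then have "t \<noteq> 0" using d_eq by auto
  have "(\<lambda>k. \<l> j (E (r k))) \<longlonglongrightarrow> \<l> j E'" if "j \<in> J" for j
  proof -
    have "(\<lambda>k. c (r k) j / \<tau> (r k)) \<longlonglongrightarrow> d j / t"
      by (intro tendsto_intros d t that \<open>t \<noteq> 0\<close>)
    moreover have "c k j / \<tau> k = \<l> j (E k)" for k using \<tau>(1)[of k] unfolding c_def by simp
    ultimately show ?thesis using d_eq[OF that] \<open>t \<noteq> 0\<close> by simp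
  qed
  then show ?thesis using r by blast
qed

section \<open>Essentially bounded integrands\<close>

text \<open>Completeness enters through the assumption that every subset of \<open>N\<close> is
  measurable: it absorbs whatever values \<open>f\<close> takes there.\<close>

lemma measurable_piecewise_null:
  fixes f :: "'a \<Rightarrow> 'b::topological_space"
  assumes "finite I" "\<And>i. i \<in> I \<Longrightarrow> A i \<in> sets M" "\<And>B. B \<subseteq> N \<Longrightarrow> B \<in> sets M"
    and "space M \<subseteq> N \<union> (\<Union>i\<in>I. A i)"
    and "\<And>i. i \<in> I \<Longrightarrow> g i \<in> borel_measurable M" "\<And>i x. i \<in> I \<Longrightarrow> x \<in> A i \<Longrightarrow> f x = g i x"
  shows "f \<in> borel_measurable M"
proof (rule measurableI)
  fix S :: "'b set" assume S: "S \<in> sets borel"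
  have "N \<in> sets M" by (rule assms(3)) simp
  then have N: "N \<subseteq> space M" using sets.sets_into_space by auto
  have sub: "A i \<subseteq> space M" if "i \<in> I" for i
    using assms(2)[OF that] sets.sets_into_space by auto
  have eq: "f -` S \<inter> space M = (f -` S \<inter> N) \<union> (\<Union>i\<in>I. (g i -` S \<inter> space M) \<inter> A i)"
    using assms(4,6) N sub by fastforce
  have "(\<Union>i\<in>I. (g i -` S \<inter> space M) \<inter> A i) \<in> sets M"
    using assms(1,2,5) S by (intro sets.finite_UN sets.Int measurable_sets)
  moreover have "f -` S \<inter> N \<in> sets M" by (intro assms(3)) simp
  ultimately show "f -` S \<inter> space M \<in> sets M" unfolding eq by (intro sets.Un)
qed simp

text \<open>A class closed under bilinear products and contained in the integrable functions on a
  finite measure space; edge fields, their curls and gradients of potentials all belong to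
  it.\<close>

definition ess_bounded :: "'a measure \<Rightarrow> ('a \<Rightarrow> 'b::euclidean_space) \<Rightarrow> bool" where
  "ess_bounded M f \<longleftrightarrow> f \<in> borel_measurable M \<and> (\<exists>B. AE x in M. norm (f x) \<le> B)"

lemma ess_bounded_measurable: "ess_bounded M f \<Longrightarrow> f \<in> borel_measurable M"
  unfolding ess_bounded_def by simp

lemma ess_boundedE:
  assumes "ess_bounded M f"
  obtains B where "0 \<le> B" "AE x in M. norm (f x) \<le> B"
proof -
  obtain B where "AE x in M. norm (f x) \<le> B" using assms unfolding ess_bounded_def by blast
  then have "AE x in M. norm (f x) \<le> max 0 B" by eventually_elim simp
  then show ?thesis using that[of "max 0 B"] by simp
qed

lemma borel_measurable_bilinear:
  fixes h :: "'b::euclidean_space \<Rightarrow> 'c::euclidean_space \<Rightarrow> 'd::euclidean_space"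
  assumes "bounded_bilinear h" "f \<in> borel_measurable M" "g \<in> borel_measurable M"
  shows "(\<lambda>x. h (f x) (g x)) \<in> borel_measurable M"
  using bounded_bilinear.continuous_on[OF assms(1) continuous_on_fst[OF continuous_on_id] continuous_on_snd[OF continuous_on_id]]
  by (intro borel_measurable_continuous_Pair[OF assms(2,3)]) simp

lemma integrable_bilinear:
  fixes h :: "'b::euclidean_space \<Rightarrow> 'c::euclidean_space \<Rightarrow> 'd::euclidean_space"
  assumes h: "bounded_bilinear h" and f: "integrable M f" and g: "ess_bounded M g"
  shows "integrable M (\<lambda>x. h (f x) (g x))"
proof -
  obtain K where K: "\<And>a b. norm (h a b) \<le> norm a * norm b * K" "K \<ge> 0"
    using bounded_bilinear.nonneg_bounded[OF h] by blast
  obtain B where B: "0 \<le> B" "AE x in M. norm (g x) \<le> B" using ess_boundedE[OF g] .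
  show ?thesis
  proof (rule Bochner_Integration.integrable_bound)
    show "integrable M (\<lambda>x. norm (f x) * (B * K))" using f by simp
    show "(\<lambda>x. h (f x) (g x)) \<in> borel_measurable M"
      using f ess_bounded_measurable[OF g] by (intro borel_measurable_bilinear[OF h]) auto
    show "AE x in M. norm (h (f x) (g x)) \<le> norm (norm (f x) * (B * K))"
      using B(2)
    proof eventually_elim
      case (elim x)
      have "norm (h (f x) (g x)) \<le> norm (f x) * norm (g x) * K" by (rule K(1))
      also have "\<dots> \<le> norm (f x) * B * K"
        using elim K(2) by (intro mult_right_mono mult_left_mono) auto
      finally show ?case using B(1) K(2) by (simp add: mult.assoc)
    qed
  qed
qed

lemma ess_bounded_bilinear:
  fixes h :: "'b::euclidean_space \<Rightarrow> 'c::euclidean_space \<Rightarrow> 'd::euclidean_space"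
  assumes h: "bounded_bilinear h" and f: "ess_bounded M f" and g: "ess_bounded M g"
  shows "ess_bounded M (\<lambda>x. h (f x) (g x))"
proof -
  obtain K where K: "\<And>a b. norm (h a b) \<le> norm a * norm b * K" "K \<ge> 0"
    using bounded_bilinear.nonneg_bounded[OF h] by blast
  obtain A where A: "0 \<le> A" "AE x in M. norm (f x) \<le> A" using ess_boundedE[OF f] .
  obtain B where B: "0 \<le> B" "AE x in M. norm (g x) \<le> B" using ess_boundedE[OF g] .
  have "AE x in M. norm (h (f x) (g x)) \<le> A * B * K"
    using A(2) B(2)
  proof eventually_elim
    case (elim x)
    have "norm (h (f x) (g x)) \<le> norm (f x) * norm (g x) * K" by (rule K(1))
    also have "\<dots> \<le> A * B * K"
      using elim K(2) A(1) by (intro mult_right_mono mult_mono) auto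
    finally show ?case .
  qed
  then show ?thesis
    unfolding ess_bounded_def
    using borel_measurable_bilinear[OF h ess_bounded_measurable[OF f] ess_bounded_measurable[OF g]] by blast
qed

lemma ess_bounded_integrable:
  assumes "finite_measure M" "ess_bounded M f"
  shows "integrable M f"
  using assms finite_measure.integrable_const_bound[OF assms(1)] unfolding ess_bounded_def by blast

lemma ess_bounded_continuous:
  assumes "bounded S" "S \<in> sets lebesgue" "continuous_on UNIV f"
  shows "ess_bounded (lebesgue_on S) f"
proof -
  have "compact (f ` closure S)"
    using assms by (intro compact_continuous_image continuous_on_subset[OF assms(3)]) auto
  then obtain B where "\<forall>y\<in>f ` closure S. norm y \<le> B" using compact_imp_bounded bounded_iff by blast
  then have "AE x in lebesgue_on S. norm (f x) \<le> B"
    using closure_subset by (intro AE_I2) (auto simp: space_restrict_space)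
  moreover have "f \<in> borel_measurable (lebesgue_on S)"
    using continuous_imp_measurable_on_sets_lebesgue[OF continuous_on_subset[OF assms(3)] assms(2)] by simp
  ultimately show ?thesis unfolding ess_bounded_def by blast
qed

text \<open>Linearity of the integrand is asked for almost everywhere only, because classical
  derivatives of finite element functions add up only off the element boundaries.\<close>

lemma fun_linear_integral:
  fixes f :: "('p \<Rightarrow> 'v::real_vector) \<Rightarrow> 'a \<Rightarrow> 'w::euclidean_space"
  assumes X: "fun_subspace X" and int: "\<And>u. u \<in> X \<Longrightarrow> integrable M (f u)"
    and lin: "\<And>u v c. u \<in> X \<Longrightarrow> v \<in> X \<Longrightarrow> AE x in M. f (\<lambda>x. u x + c *\<^sub>R v x) x = f u x + c *\<^sub>R f v x"
  shows "fun_linear X (\<lambda>u. LINT x|M. f u x)"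
  unfolding fun_linear_def
proof (intro ballI allI)
  fix u v c assume uv: "u \<in> X" "v \<in> X"
  have "(LINT x|M. f (\<lambda>x. u x + c *\<^sub>R v x) x) = (LINT x|M. f u x + c *\<^sub>R f v x)"
    using int[OF fun_subspaceD(2)[OF X uv]] int[OF uv(1)] int[OF uv(2)]
    by (intro integral_cong_AE lin uv borel_measurable_add borel_measurable_scaleR) auto
  also have "\<dots> = (LINT x|M. f u x) + c *\<^sub>R (LINT x|M. f v x)"
    using int uv by simp
  finally show "(LINT x|M. f (\<lambda>x. u x + c *\<^sub>R v x) x) = (LINT x|M. f u x) + c *\<^sub>R (LINT x|M. f v x)" .
qed

section \<open>Classical derivatives\<close>

lemma partial_eq: "(f has_derivative D) (at x) \<Longrightarrow> partial i f x = D (axis i 1)"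
  unfolding partial_def by (simp add: frechet_derivative_at[symmetric])

lemma grad_eq: "(f has_derivative D) (at x) \<Longrightarrow> grad f x = (\<chi> i. D (axis i 1))"
  unfolding grad_def by (simp add: partial_eq)

lemma curl_eq:
  assumes "(u has_derivative D) (at x)"
  shows "curl u x = vector [D (axis 2 1) $ 3 - D (axis 3 1) $ 2, D (axis 3 1) $ 1 - D (axis 1 1) $ 3,
    D (axis 1 1) $ 2 - D (axis 2 1) $ 1]"
proof -
  have "((\<lambda>y. u y $ k) has_derivative (\<lambda>h. D h $ k)) (at x)" for k
    using assms by (rule bounded_linear.has_derivative[OF bounded_linear_vec_nth])
  from partial_eq[OF this] show ?thesis unfolding curl_def by simp
qed

lemma divg_eq:
  assumes "(u has_derivative D) (at x)"
  shows "divg u x = (\<Sum>i\<in>UNIV. D (axis i 1) $ i)"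
proof -
  have "((\<lambda>y. u y $ k) has_derivative (\<lambda>h. D h $ k)) (at x)" for k
    using assms by (rule bounded_linear.has_derivative[OF bounded_linear_vec_nth])
  from partial_eq[OF this] show ?thesis unfolding divg_def by simp
qed

lemma C1_compact_continuous:
  assumes "g \<in> C1_compact S"
  shows "continuous_on UNIV g"
  using assms unfolding C1_compact_def
  by (auto intro!: differentiable_imp_continuous_on simp: differentiable_on_def differentiable_at_withinI)

text \<open>\<open>C1_compact\<close> speaks of the partial derivatives of the vector field. Its
  differentiability identifies their components with the partial derivatives of the components, from
  which curl and divergence are built.\<close>

lemma C1_compact_curl_divg:
  fixes g :: "pt \<Rightarrow> real^3"
  assumes "g \<in> C1_compact S"
  shows "continuous_on UNIV (curl g)" "continuous_on UNIV (divg g)"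
proof -
  have "(g has_derivative frechet_derivative g (at x)) (at x)" for x
    using assms frechet_derivative_works unfolding C1_compact_def by blast
  note D = curl_eq[OF this] divg_eq[OF this]
  have curl: "curl g = (\<lambda>x. vector [partial 2 g x $ 3 - partial 3 g x $ 2,
      partial 3 g x $ 1 - partial 1 g x $ 3, partial 1 g x $ 2 - partial 2 g x $ 1])"
    using D(1) by (auto simp: partial_def)
  have divg: "divg g = (\<lambda>x. \<Sum>i\<in>UNIV. partial i g x $ i)"
    using D(2) by (auto simp: partial_def)
  have cont: "continuous_on UNIV (\<lambda>x. partial i g x $ k)" for i k
    using assms unfolding C1_compact_def by (auto intro!: continuous_intros)
  show "continuous_on UNIV (divg g)" unfolding divg by (intro continuous_intros cont)
  have "continuous_on UNIV (\<lambda>x. curl g x $ k)" for k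
    using exhaust_3[of k] unfolding curl
    by (elim disjE; simp only: vector_3; intro continuous_intros cont)
  then show "continuous_on UNIV (curl g)"
    unfolding continuous_on_def by (auto intro!: vec_tendstoI)
qed

lemma curl_affine:
  assumes "open W" "x \<in> W" "\<And>y. y \<in> W \<Longrightarrow> u y = a + ccross b (cvec y)"
  shows "curl u x = 2 *\<^sub>R b"
proof -
  have lin: "bounded_linear (\<lambda>y. ccross b (cvec y))"
    by (rule bounded_linear_compose[OF bounded_bilinear.bounded_linear_right[OF bounded_bilinear_ccross]
          bounded_linear_cvec])
  have "((\<lambda>y. a + ccross b (cvec y)) has_derivative (\<lambda>h. ccross b (cvec h))) (at x)"
    using has_derivative_add[OF has_derivative_const[of a] bounded_linear_imp_has_derivative[OF lin]] by simp
  then have "(u has_derivative (\<lambda>h. ccross b (cvec h))) (at x)"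
    by (rule has_derivative_transform_within_open[OF _ assms(1,2)]) (simp add: assms(3))
  from curl_eq[OF this] show ?thesis
    by (simp add: vec_eq_iff forall_3 vector_3 cvec_def axis_def scaleR_conv_of_real[where 'a = complex])
qed

lemma grad_affine:
  fixes b :: "3 \<Rightarrow> 'b::real_normed_vector"
  assumes "open W" "x \<in> W" "\<And>y. y \<in> W \<Longrightarrow> u y = a + (\<Sum>i\<in>UNIV. y $ i *\<^sub>R b i)"
  shows "grad u x = (\<chi> i. b i)"
proof -
  have lin: "bounded_linear (\<lambda>y::pt. \<Sum>i\<in>UNIV. y $ i *\<^sub>R b i)"
    by (intro bounded_linear_sum bounded_linear_scaleR_left[THEN bounded_linear_compose] bounded_linear_vec_nth)
  have "((\<lambda>y. a + (\<Sum>i\<in>UNIV. y $ i *\<^sub>R b i)) has_derivative (\<lambda>h. \<Sum>i\<in>UNIV. h $ i *\<^sub>R b i)) (at x)"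
    using has_derivative_add[OF has_derivative_const[of a] bounded_linear_imp_has_derivative[OF lin]] by simp
  then have "(u has_derivative (\<lambda>h. \<Sum>i\<in>UNIV. h $ i *\<^sub>R b i)) (at x)"
    by (rule has_derivative_transform_within_open[OF _ assms(1,2)]) (simp add: assms(3))
  from grad_eq[OF this] show ?thesis
    by (simp add: vec_eq_iff axis_def if_distrib[of "\<lambda>r. r *\<^sub>R _"] sum.delta cong: if_cong)
qed

section \<open>Meshes\<close>

locale tetra_mesh =
  fixes T :: "pt set set" and S :: "pt set"
  assumes mesh: "tetrahedral_mesh T S" and open_domain: "open S" and bounded_domain: "bounded S"
begin

lemma finite_mesh: "finite T"
  using mesh unfolding tetrahedral_mesh_def triangulation_def by blast

lemma simplex_mesh: "t \<in> T \<Longrightarrow> 3 simplex t"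
  using mesh unfolding tetrahedral_mesh_def by blast

lemma Union_mesh: "\<Union>T = closure S"
  using mesh unfolding tetrahedral_mesh_def by blast

lemma interior_mesh_nonempty: "t \<in> T \<Longrightarrow> interior t \<noteq> {}"
proof -
  assume "t \<in> T"
  then have t: "convex t" "aff_dim t = 3"
    using simplex_mesh convex_simplex aff_dim_simplex by blast+
  then have "interior t = rel_interior t"
    using aff_dim_eq_full[of t] by (intro rel_interior_interior[symmetric]) simp
  moreover have "t \<noteq> {}" using t(2) by auto
  ultimately show ?thesis using rel_interior_eq_empty[OF t(1)] by simp
qed

lemma closure_interior_mesh: "t \<in> T \<Longrightarrow> closure (interior t) = t"
  using convex_closure_interior[of t] interior_mesh_nonempty[of t] simplex_mesh[of t]
    convex_simplex[of 3 t] closed_simplex[of 3 t] by simp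

lemma lmeasurable_domain: "S \<in> lmeasurable"
  using open_domain bounded_domain by (simp add: lmeasurable_open)

lemma finite_measure_domain: "finite_measure (lebesgue_on S)"
  by (rule finite_measure_lebesgue_on[OF lmeasurable_domain])

lemma negligible_skeleton: "negligible (S - (\<Union>t\<in>T. interior t))"
proof -
  have "S - (\<Union>t\<in>T. interior t) \<subseteq> (\<Union>t\<in>T. frontier t)"
    using Union_mesh closure_subset[of S] closed_simplex[OF simplex_mesh] by (fastforce simp: frontier_def)
  moreover have "negligible (\<Union>t\<in>T. frontier t)"
    using finite_mesh convex_simplex[OF simplex_mesh] by (auto intro!: negligible_convex_frontier)
  ultimately show ?thesis using negligible_subset by blast
qed

lemma AE_interior: "AE x in lebesgue_on S. x \<in> (\<Union>t\<in>T. interior t)"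
proof -
  have "AE x in lebesgue. x \<notin> S - (\<Union>t\<in>T. interior t)"
    using negligible_skeleton by (intro AE_not_in) (simp add: negligible_iff_null_sets)
  then have "AE x in lebesgue. x \<in> S \<longrightarrow> x \<in> (\<Union>t\<in>T. interior t)" by eventually_elim auto
  then show ?thesis using open_domain by (simp add: AE_restrict_space_iff)
qed

text \<open>The values on the skeleton, a negligible set, are arbitrary; elsewhere \<open>f\<close>
  agrees with one of finitely many functions that are bounded on compact tetrahedra.\<close>

lemma ess_bounded_piecewise:
  assumes "\<And>t. t \<in> T \<Longrightarrow> \<exists>g. continuous_on UNIV g \<and> (\<forall>x\<in>interior t. f x = g x)"
  shows "ess_bounded (lebesgue_on S) f"
proof -
  obtain g where g: "\<And>t. t \<in> T \<Longrightarrow> continuous_on UNIV (g t)" "\<And>t x. t \<in> T \<Longrightarrow> x \<in> interior t \<Longrightarrow> f x = g t x"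
    using assms by metis
  have S: "S \<in> sets lebesgue" using open_domain by simp
  define N where "N = S - (\<Union>t\<in>T. interior t)"
  have meas: "f \<in> borel_measurable (lebesgue_on S)"
  proof (rule measurable_piecewise_null[where I = T and A = "\<lambda>t. interior t \<inter> S" and N = N and g = g])
    show "B \<in> sets (lebesgue_on S)" if "B \<subseteq> N" for B
    proof -
      have "negligible B" using negligible_skeleton that unfolding N_def by (rule negligible_subset)
      then have "B \<in> sets lebesgue" by (simp add: negligible_imp_sets)
      then show ?thesis using that S unfolding N_def by (auto simp: sets_restrict_space_iff)
    qed
    show "interior t \<inter> S \<in> sets (lebesgue_on S)" if "t \<in> T" for t
      using S by (auto simp: sets_restrict_space_iff intro!: sets.Int)
    show "g t \<in> borel_measurable (lebesgue_on S)" if "t \<in> T" for t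
      using ess_bounded_measurable[OF ess_bounded_continuous[OF bounded_domain S g(1)[OF that]]] .
  qed (use finite_mesh g(2) in \<open>auto simp: N_def space_restrict_space\<close>)
  have "\<exists>B. \<forall>x\<in>t. norm (g t x) \<le> B" if "t \<in> T" for t
  proof -
    have "compact (g t ` t)"
      using compact_simplex[OF simplex_mesh[OF that]] continuous_on_subset[OF g(1)[OF that]]
      by (intro compact_continuous_image) auto
    then show ?thesis using compact_imp_bounded bounded_iff by (metis imageI)
  qed
  then obtain B where B: "\<And>t x. t \<in> T \<Longrightarrow> x \<in> t \<Longrightarrow> norm (g t x) \<le> B t" by metis
  have "AE x in lebesgue_on S. norm (f x) \<le> (\<Sum>t\<in>T. \<bar>B t\<bar>)"
    using AE_interior
  proof eventually_elim
    case (elim x)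
    then obtain t where t: "t \<in> T" "x \<in> interior t" by blast
    then have "norm (f x) \<le> B t" using g(2) B interior_subset by force
    also have "\<dots> \<le> \<bar>B t\<bar>" by simp
    also have "\<dots> \<le> (\<Sum>t\<in>T. \<bar>B t\<bar>)" using t finite_mesh by (intro member_le_sum) auto
    finally show ?case .
  qed
  then show ?thesis using meas unfolding ess_bounded_def by blast
qed

end

section \<open>Finite element spaces\<close>

lemma L2_integrable:
  assumes "finite_measure M" "u \<in> L2 M"
  shows "integrable M u"
proof (rule Bochner_Integration.integrable_bound)
  interpret finite_measure M by fact
  show "integrable M (\<lambda>x. 1 + (norm (u x))\<^sup>2)" using assms(2) unfolding L2_def by auto
  show "u \<in> borel_measurable M" using assms(2) unfolding L2_def by auto
  have "norm z \<le> 1 + (norm z)\<^sup>2" for z :: 'b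
    using zero_le_power2[of "norm z - 1 / 2"] by (simp add: power2_eq_square algebra_simps)
  then show "AE x in M. norm (u x) \<le> norm (1 + (norm (u x))\<^sup>2)" by simp
qed

lemma norm_add_sq_le:
  fixes a b :: "'a::real_normed_vector"
  shows "(norm (a + b))\<^sup>2 \<le> 2 * (norm a)\<^sup>2 + 2 * (norm b)\<^sup>2"
proof -
  have "(norm (a + b))\<^sup>2 \<le> (norm a + norm b)\<^sup>2" by (intro power_mono norm_triangle_ineq) simp
  also have "\<dots> \<le> 2 * (norm a)\<^sup>2 + 2 * (norm b)\<^sup>2"
    using zero_le_power2[of "norm a - norm b"] by (simp add: power2_eq_square algebra_simps)
  finally show ?thesis .
qed

lemma fun_subspace_L2: "fun_subspace (L2 M :: ('a \<Rightarrow> 'b::euclidean_space) set)"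
  unfolding fun_subspace_def
proof (intro conjI ballI allI)
  show "(\<lambda>_. 0 :: 'b) \<in> L2 M" unfolding L2_def by simp
  fix u v :: "'a \<Rightarrow> 'b" and c assume uv: "u \<in> L2 M" "v \<in> L2 M"
  have meas: "(\<lambda>x. u x + c *\<^sub>R v x) \<in> borel_measurable M" using uv unfolding L2_def by auto
  have "integrable M (\<lambda>x. (norm (u x + c *\<^sub>R v x))\<^sup>2)"
  proof (rule Bochner_Integration.integrable_bound)
    show "integrable M (\<lambda>x. 2 * (norm (u x))\<^sup>2 + 2 * (c\<^sup>2 * (norm (v x))\<^sup>2))"
      using uv unfolding L2_def by auto
    show "(\<lambda>x. (norm (u x + c *\<^sub>R v x))\<^sup>2) \<in> borel_measurable M" using meas by measurable
    show "AE x in M. norm ((norm (u x + c *\<^sub>R v x))\<^sup>2)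
        \<le> norm (2 * (norm (u x))\<^sup>2 + 2 * (c\<^sup>2 * (norm (v x))\<^sup>2))"
      using norm_add_sq_le[of "u _" "c *\<^sub>R v _"] by (intro AE_I2) (simp add: power_mult_distrib)
  qed
  then show "(\<lambda>x. u x + c *\<^sub>R v x) \<in> L2 M" using meas unfolding L2_def by simp
qed

text \<open>Additivity of the integrals in the weak identity rests on integrability: square
  integrable fields are integrable on a bounded set, and test fields and their curls are
  bounded.\<close>

lemma fun_subspace_H_curl:
  assumes "open \<Omega>" "bounded \<Omega>"
  shows "fun_subspace (H_curl \<Omega> \<Gamma>)"
  unfolding fun_subspace_def
proof (intro conjI ballI allI)
  let ?M = "lebesgue_on \<Omega>"
  have M: "finite_measure ?M" "\<Omega> \<in> sets lebesgue"
    using finite_measure_lebesgue_on lmeasurable_open[OF assms(2,1)] assms(1) by auto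
  have zero: "(\<lambda>_. 0) \<in> L2 ?M" by (rule fun_subspaceD(1)[OF fun_subspace_L2])
  then show "(\<lambda>_. 0) \<in> H_curl \<Omega> \<Gamma>"
    unfolding H_curl_def
    by (auto intro!: bexI[of _ "\<lambda>_. 0"] simp: bounded_bilinear.zero_left[OF bounded_bilinear_hdot])
  fix u v c assume "u \<in> H_curl \<Omega> \<Gamma>" "v \<in> H_curl \<Omega> \<Gamma>"
  then obtain cu cv where L2: "u \<in> L2 ?M" "v \<in> L2 ?M" "cu \<in> L2 ?M" "cv \<in> L2 ?M"
    and cu: "\<And>\<psi>. \<psi> \<in> C1_compact (- \<Gamma>) \<Longrightarrow> (LINT x|?M. hdot (u x) (cvec (curl \<psi> x))) =
      (LINT x|?M. hdot (cu x) (cvec (\<psi> x)))"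
    and cv: "\<And>\<psi>. \<psi> \<in> C1_compact (- \<Gamma>) \<Longrightarrow> (LINT x|?M. hdot (v x) (cvec (curl \<psi> x))) =
      (LINT x|?M. hdot (cv x) (cvec (\<psi> x)))"
    unfolding H_curl_def by blast
  have add: "(LINT x|?M. hdot (p x + c *\<^sub>R q x) (cvec (f x)))
      = (LINT x|?M. hdot (p x) (cvec (f x))) + c *\<^sub>R (LINT x|?M. hdot (q x) (cvec (f x)))"
    if "p \<in> L2 ?M" "q \<in> L2 ?M" "continuous_on UNIV f" for p q f
  proof -
    have "continuous_on UNIV (\<lambda>x. cvec (f x))"
      using bounded_linear.continuous_on[OF bounded_linear_cvec that(3)] .
    then have "ess_bounded ?M (\<lambda>x. cvec (f x))" by (rule ess_bounded_continuous[OF assms(2) M(2)])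
    then have "integrable ?M (\<lambda>x. hdot (p x) (cvec (f x)))" "integrable ?M (\<lambda>x. hdot (q x) (cvec (f x)))"
      using integrable_bilinear[OF bounded_bilinear_hdot L2_integrable[OF M(1)]] that by blast+
    then show ?thesis
      by (simp add: bounded_bilinear.add_left[OF bounded_bilinear_hdot]
          bounded_bilinear.scaleR_left[OF bounded_bilinear_hdot])
  qed
  show "(\<lambda>x. u x + c *\<^sub>R v x) \<in> H_curl \<Omega> \<Gamma>"
    unfolding H_curl_def
  proof (intro CollectI conjI bexI ballI)
    show "(\<lambda>x. u x + c *\<^sub>R v x) \<in> L2 ?M" "(\<lambda>x. cu x + c *\<^sub>R cv x) \<in> L2 ?M"
      using L2 by (auto intro: fun_subspaceD(2)[OF fun_subspace_L2])
    fix \<psi> :: "pt \<Rightarrow> real^3" assume \<psi>: "\<psi> \<in> C1_compact (- \<Gamma>)"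
    show "(LINT x|?M. hdot (u x + c *\<^sub>R v x) (cvec (curl \<psi> x))) =
        (LINT x|?M. hdot (cu x + c *\<^sub>R cv x) (cvec (\<psi> x)))"
      unfolding add[OF L2(1,2) C1_compact_curl_divg(1)[OF \<psi>]] add[OF L2(3,4) C1_compact_continuous[OF \<psi>]]
        cu[OF \<psi>] cv[OF \<psi>] ..
  qed
qed

lemma nedelec_affine:
  assumes "u \<in> nedelec_space T \<Omega> \<Gamma>" "t \<in> T"
  shows "\<exists>a b. \<forall>x\<in>interior t. u x = a + ccross b (cvec x)"
  using assms unfolding nedelec_space_def by blast

lemma nedelec_comb_affine:
  assumes "\<And>x. x \<in> W \<Longrightarrow> u x = a + ccross b (cvec x)" "\<And>x. x \<in> W \<Longrightarrow> v x = a' + ccross b' (cvec x)"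
    and "x \<in> W"
  shows "u x + c *\<^sub>R v x = (a + c *\<^sub>R a') + ccross (b + c *\<^sub>R b') (cvec x)"
  using assms by (simp add: bounded_bilinear.add_left[OF bounded_bilinear_ccross]
      bounded_bilinear.scaleR_left[OF bounded_bilinear_ccross] algebra_simps)

lemma continuous_on_edge_field: "continuous_on UNIV (\<lambda>x. a + ccross b (cvec x))"
  by (intro continuous_intros bounded_bilinear.continuous_on[OF bounded_bilinear_ccross]
      bounded_linear.continuous_on[OF bounded_linear_cvec])

lemma fun_subspace_nedelec:
  assumes "open \<Omega>" "bounded \<Omega>"
  shows "fun_subspace (nedelec_space T \<Omega> \<Gamma>)"
  unfolding fun_subspace_def
proof (intro conjI ballI allI)
  note H = fun_subspaceD[OF fun_subspace_H_curl[OF assms]]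
  have "\<exists>a b. \<forall>x\<in>interior t. (0::cvec) = a + ccross b (cvec x)" for t
    by (intro exI[of _ 0]) (simp add: bounded_bilinear.zero_left[OF bounded_bilinear_ccross])
  then show "(\<lambda>_. 0) \<in> nedelec_space T \<Omega> \<Gamma>"
    unfolding nedelec_space_def using H(1) by auto
  fix u v c assume uv: "u \<in> nedelec_space T \<Omega> \<Gamma>" "v \<in> nedelec_space T \<Omega> \<Gamma>"
  have "\<exists>a b. \<forall>x\<in>interior t. u x + c *\<^sub>R v x = a + ccross b (cvec x)" if t: "t \<in> T" for t
  proof -
    obtain a b where ab: "\<And>x. x \<in> interior t \<Longrightarrow> u x = a + ccross b (cvec x)"
      using nedelec_affine[OF uv(1) t] by blast
    obtain a' b' where ab': "\<And>x. x \<in> interior t \<Longrightarrow> v x = a' + ccross b' (cvec x)"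
      using nedelec_affine[OF uv(2) t] by blast
    show ?thesis using nedelec_comb_affine[OF ab ab'] by blast
  qed
  then show "(\<lambda>x. u x + c *\<^sub>R v x) \<in> nedelec_space T \<Omega> \<Gamma>"
    using uv H(2) unfolding nedelec_space_def by auto
qed

lemma lagrange_affine:
  assumes "u \<in> lagrange_space T D" "t \<in> T"
  shows "\<exists>a b. \<forall>x\<in>t. u x = a + (\<Sum>i\<in>UNIV. x $ i *\<^sub>R b i)"
  using assms unfolding lagrange_space_def by blast

lemma lagrange_comb_affine:
  fixes u v :: "pt \<Rightarrow> 'b::real_vector"
  assumes "\<And>x. x \<in> W \<Longrightarrow> u x = a + (\<Sum>i\<in>UNIV. x $ i *\<^sub>R b i)"
    "\<And>x. x \<in> W \<Longrightarrow> v x = a' + (\<Sum>i\<in>UNIV. x $ i *\<^sub>R b' i)" and "x \<in> W"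
  shows "u x + c *\<^sub>R v x = (a + c *\<^sub>R a') + (\<Sum>i\<in>UNIV. x $ i *\<^sub>R (b i + c *\<^sub>R b' i))"
  using assms by (simp add: scaleR_sum_right sum.distrib scaleR_add_right mult.commute)

lemma fun_subspace_lagrange: "fun_subspace (lagrange_space T D)"
  unfolding fun_subspace_def
proof (intro conjI ballI allI)
  have "\<exists>a b. \<forall>x\<in>t. (0::'a) = a + (\<Sum>i\<in>UNIV. x $ i *\<^sub>R b i)" for t :: "pt set"
    by (intro exI[of _ 0] exI[of _ "\<lambda>_. 0"]) simp
  then show "(\<lambda>_. 0 :: 'a) \<in> lagrange_space T D" unfolding lagrange_space_def by auto
  fix u v :: "pt \<Rightarrow> 'a" and c assume uv: "u \<in> lagrange_space T D" "v \<in> lagrange_space T D"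
  have "\<exists>a b. \<forall>x\<in>t. u x + c *\<^sub>R v x = a + (\<Sum>i\<in>UNIV. x $ i *\<^sub>R b i)" if t: "t \<in> T" for t
  proof -
    obtain a b where ab: "\<And>x. x \<in> t \<Longrightarrow> u x = a + (\<Sum>i\<in>UNIV. x $ i *\<^sub>R b i)"
      using lagrange_affine[OF uv(1) t] by blast
    obtain a' b' where ab': "\<And>x. x \<in> t \<Longrightarrow> v x = a' + (\<Sum>i\<in>UNIV. x $ i *\<^sub>R b' i)"
      using lagrange_affine[OF uv(2) t] by blast
    show ?thesis
      using lagrange_comb_affine[OF ab ab', where c = c]
      by (intro exI[of _ "a + c *\<^sub>R a'"] exI[of _ "\<lambda>i. b i + c *\<^sub>R b' i"]) blast
  qed
  then show "(\<lambda>x. u x + c *\<^sub>R v x) \<in> lagrange_space T D"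
    using uv unfolding lagrange_space_def by auto
qed

lemma lagrange_convex_combination:
  assumes "u \<in> lagrange_space T D" "t \<in> T" "C \<subseteq> t" "(\<Sum>v\<in>C. l v) = 1" "(\<Sum>v\<in>C. l v *\<^sub>R v) \<in> t"
  shows "u (\<Sum>v\<in>C. l v *\<^sub>R v) = (\<Sum>v\<in>C. l v *\<^sub>R u v)"
proof -
  obtain a b where ab: "\<And>x. x \<in> t \<Longrightarrow> u x = a + (\<Sum>i\<in>UNIV. x $ i *\<^sub>R b i)"
    using lagrange_affine[OF assms(1,2)] by blast
  have "(\<Sum>v\<in>C. l v *\<^sub>R u v) = (\<Sum>v\<in>C. l v *\<^sub>R (a + (\<Sum>i\<in>UNIV. v $ i *\<^sub>R b i)))"
    using ab assms(3) by (intro sum.cong) auto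
  also have "\<dots> = (\<Sum>v\<in>C. l v *\<^sub>R a) + (\<Sum>v\<in>C. \<Sum>i\<in>UNIV. (l v * v $ i) *\<^sub>R b i)"
    by (simp add: scaleR_add_right sum.distrib scaleR_sum_right)
  also have "(\<Sum>v\<in>C. l v *\<^sub>R a) = a" using assms(4) by (simp flip: scaleR_sum_left)
  also have "(\<Sum>v\<in>C. \<Sum>i\<in>UNIV. (l v * v $ i) *\<^sub>R b i)
      = (\<Sum>i\<in>UNIV. (\<Sum>v\<in>C. l v *\<^sub>R v) $ i *\<^sub>R b i)"
    by (subst sum.swap) (simp add: scaleR_sum_left)
  finally show ?thesis using ab[OF assms(5)] by simp
qed

context tetra_mesh
begin

text \<open>The field may belong to a mesh \<open>T'\<close> larger than the mesh \<open>T\<close>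
  of the integration domain; the form \<open>b\<close> pairs edge fields of the whole mesh over the
  non-conducting part alone.\<close>

lemma nedelec_ess_bounded:
  assumes "T \<subseteq> T'" "u \<in> nedelec_space T' \<Omega> \<Gamma>"
  shows "ess_bounded (lebesgue_on S) u" "ess_bounded (lebesgue_on S) (curl u)"
proof -
  have "\<exists>g. continuous_on UNIV g \<and> (\<forall>x\<in>interior t. u x = g x)"
    "\<exists>g. continuous_on UNIV g \<and> (\<forall>x\<in>interior t. curl u x = g x)" if t: "t \<in> T" for t
  proof -
    obtain a b where ab: "\<And>x. x \<in> interior t \<Longrightarrow> u x = a + ccross b (cvec x)"
      using nedelec_affine[OF assms(2)] assms(1) t by blast
    show "\<exists>g. continuous_on UNIV g \<and> (\<forall>x\<in>interior t. u x = g x)"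
      using continuous_on_edge_field ab by blast
    show "\<exists>g. continuous_on UNIV g \<and> (\<forall>x\<in>interior t. curl u x = g x)"
      using curl_affine[OF open_interior _ ab] by (intro exI[of _ "\<lambda>_. 2 *\<^sub>R b"]) simp
  qed
  then show "ess_bounded (lebesgue_on S) u" "ess_bounded (lebesgue_on S) (curl u)"
    by (auto intro!: ess_bounded_piecewise)
qed

lemma curl_nedelec_linear:
  assumes "T \<subseteq> T'" "u \<in> nedelec_space T' \<Omega> \<Gamma>" "v \<in> nedelec_space T' \<Omega> \<Gamma>"
  shows "AE x in lebesgue_on S. curl (\<lambda>x. u x + c *\<^sub>R v x) x = curl u x + c *\<^sub>R curl v x"
  using AE_interior
proof eventually_elim
  case (elim x)
  then obtain t where t: "t \<in> T" "x \<in> interior t" by blast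
  obtain a b where ab: "\<And>x. x \<in> interior t \<Longrightarrow> u x = a + ccross b (cvec x)"
    using nedelec_affine[OF assms(2)] assms(1) t by blast
  obtain a' b' where ab': "\<And>x. x \<in> interior t \<Longrightarrow> v x = a' + ccross b' (cvec x)"
    using nedelec_affine[OF assms(3)] assms(1) t by blast
  show ?case
    using curl_affine[OF open_interior t(2) ab] curl_affine[OF open_interior t(2) ab']
      curl_affine[OF open_interior t(2) nedelec_comb_affine[OF ab ab', where c = c]]
    by (simp add: scaleR_add_right)
qed

lemma grad_lagrange_ess_bounded:
  fixes u :: "pt \<Rightarrow> complex"
  assumes "u \<in> lagrange_space T D"
  shows "ess_bounded (lebesgue_on S) (grad u)"
proof (rule ess_bounded_piecewise)
  fix t assume "t \<in> T"
  then obtain a b where ab: "\<And>x. x \<in> t \<Longrightarrow> u x = a + (\<Sum>i\<in>UNIV. x $ i *\<^sub>R b i)"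
    using lagrange_affine[OF assms] by blast
  have "grad u x = (\<chi> i. b i)" if "x \<in> interior t" for x
    using ab interior_subset by (intro grad_affine[OF open_interior that]) blast
  then show "\<exists>g. continuous_on UNIV g \<and> (\<forall>x\<in>interior t. grad u x = g x)"
    by (intro exI[of _ "\<lambda>_. \<chi> i. b i"]) simp
qed

lemma grad_lagrange_linear:
  fixes u v :: "pt \<Rightarrow> complex"
  assumes "u \<in> lagrange_space T D" "v \<in> lagrange_space T D"
  shows "AE x in lebesgue_on S. grad (\<lambda>x. u x + c *\<^sub>R v x) x = grad u x + c *\<^sub>R grad v x"
  using AE_interior
proof eventually_elim
  case (elim x)
  then obtain t where t: "t \<in> T" "x \<in> interior t" by blast
  obtain a b where ab: "\<And>x. x \<in> t \<Longrightarrow> u x = a + (\<Sum>i\<in>UNIV. x $ i *\<^sub>R b i)"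
    using lagrange_affine[OF assms(1) t(1)] by blast
  obtain a' b' where ab': "\<And>x. x \<in> t \<Longrightarrow> v x = a' + (\<Sum>i\<in>UNIV. x $ i *\<^sub>R b' i)"
    using lagrange_affine[OF assms(2) t(1)] by blast
  have "grad u x = (\<chi> i. b i)" "grad v x = (\<chi> i. b' i)"
    "grad (\<lambda>x. u x + c *\<^sub>R v x) x = (\<chi> i. b i + c *\<^sub>R b' i)"
    using ab ab' lagrange_comb_affine[OF ab ab', where c = c] interior_subset
    by (blast intro: grad_affine[OF open_interior t(2)])+
  then show ?case by (simp add: vec_eq_iff)
qed

text \<open>Four affinely independent points inside each tetrahedron suffice, since an edge field is
  affine there; off the interiors the space prescribes the value 0. Interior points are chosen
  because the affine formula is available only there.\<close>

lemma nedelec_determined: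
  "\<exists>P. finite P \<and> (\<forall>u\<in>nedelec_space T \<Omega> \<Gamma>. (\<forall>p\<in>P. u p = 0) \<longrightarrow> u = (\<lambda>_. 0))"
proof -
  have "\<exists>p r. 0 < r \<and> ball p r \<subseteq> interior t" if "t \<in> T" for t
    using interior_mesh_nonempty[OF that] open_contains_ball[of "interior t"] by auto
  then obtain p r where pr: "\<And>t. t \<in> T \<Longrightarrow> 0 < r t" "\<And>t. t \<in> T \<Longrightarrow> ball (p t) (r t) \<subseteq> interior t"
    by metis
  define P where "P = p ` T \<union> (\<lambda>(t, e). p t + (r t / 2) *\<^sub>R e) ` (T \<times> Basis)"
  have "u x = 0" if u: "u \<in> nedelec_space T \<Omega> \<Gamma>" and z: "\<forall>p\<in>P. u p = 0" for u x
  proof (cases "x \<in> (\<Union>t\<in>T. interior t)")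
    case False
    then show ?thesis using u unfolding nedelec_space_def by blast
  next
    case True
    then obtain t where t: "t \<in> T" "x \<in> interior t" by blast
    obtain a b where ab: "\<And>x. x \<in> interior t \<Longrightarrow> u x = a + ccross b (cvec x)"
      using nedelec_affine[OF u t(1)] by blast
    have lin: "linear (\<lambda>y. ccross b (cvec y))"
      using bounded_linear_compose[OF bounded_bilinear.bounded_linear_right[OF bounded_bilinear_ccross]
          bounded_linear_cvec] by (simp add: linear_conv_bounded_linear)
    have pt: "p t \<in> interior t" using pr[OF t(1)] by (meson centre_in_ball subsetD)
    have "u (p t) = 0" using z t unfolding P_def by blast
    then have a: "a + ccross b (cvec (p t)) = 0" using ab[OF pt] by simp
    have "ccross b (cvec e) = 0" if e: "e \<in> Basis" for e
    proof -
      have "p t + (r t / 2) *\<^sub>R e \<in> interior t"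
        using pr[OF t(1)] e by (intro subsetD[OF pr(2)[OF t(1)]]) (simp add: dist_norm)
      moreover have "u (p t + (r t / 2) *\<^sub>R e) = 0" using z t e unfolding P_def by auto
      ultimately have "a + (ccross b (cvec (p t)) + (r t / 2) *\<^sub>R ccross b (cvec e)) = 0"
        using ab linear_add[OF lin] linear_scale[OF lin] by simp
      then show ?thesis using a pr(1)[OF t(1)] by (simp flip: add.assoc)
    qed
    then have "ccross b (cvec y) = 0" for y
      using linear_eq_stdbasis[OF lin linear_zero] fun_cong by simp
    then show ?thesis using ab[OF t(2)] a by simp
  qed
  moreover have "finite P" unfolding P_def using finite_mesh by simp
  ultimately show ?thesis by (intro exI[of _ P]) auto
qed

end

section \<open>The discrete forms\<close>

lemmas hdot_simps =
  bounded_bilinear.add_left[OF bounded_bilinear_hdot] bounded_bilinear.scaleR_left[OF bounded_bilinear_hdot]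
  bounded_bilinear.add_right[OF bounded_bilinear_hdot] bounded_bilinear.scaleR_right[OF bounded_bilinear_hdot]

lemma form_a_scaleR:
  "form_a \<Omega> \<mu> \<omega> s E F = (LINT x|lebesgue_on \<Omega>. complex_of_real (1 / \<mu>) * hdot (curl E x) (curl F x)
      - (\<i> * complex_of_real \<omega>) * (s x *\<^sub>R hdot (E x) (F x)))"
  unfolding form_a_def by (simp add: scaleR_conv_of_real mult.assoc)

lemma form_b_scaleR:
  "form_b \<Omega> \<epsilon> E F = (LINT x|lebesgue_on \<Omega>. \<epsilon> x *\<^sub>R hdot (E x) (F x))"
  unfolding form_b_def by (simp add: scaleR_conv_of_real)

context tetra_mesh
begin

lemma fun_subspace_edge: "fun_subspace (nedelec_space T S \<Gamma>)"
  by (rule fun_subspace_nedelec[OF open_domain bounded_domain])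

lemma form_a_integrable:
  assumes "ess_bounded (lebesgue_on S) s" "E \<in> nedelec_space T S \<Gamma>" "F \<in> nedelec_space T S \<Gamma>"
  shows "integrable (lebesgue_on S) (\<lambda>x. hdot (curl E x) (curl F x))"
    "integrable (lebesgue_on S) (\<lambda>x. s x *\<^sub>R hdot (E x) (F x))"
  using nedelec_ess_bounded[OF subset_refl assms(2)] nedelec_ess_bounded[OF subset_refl assms(3)] assms(1)
  by (auto intro!: ess_bounded_integrable[OF finite_measure_domain] ess_bounded_bilinear[OF bounded_bilinear_hdot]
      ess_bounded_bilinear[OF bounded_bilinear_scaleR])

lemma form_a_linear:
  assumes "ess_bounded (lebesgue_on S) s" "G \<in> nedelec_space T S \<Gamma>"
  shows "fun_linear (nedelec_space T S \<Gamma>) (\<lambda>E. form_a S \<mu> \<omega> s E G)"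
    "fun_linear (nedelec_space T S \<Gamma>) (\<lambda>F. form_a S \<mu> \<omega> s G F)"
  unfolding form_a_scaleR
proof -
  note curl = curl_nedelec_linear[OF subset_refl]
  show "fun_linear (nedelec_space T S \<Gamma>) (\<lambda>E. LINT x|lebesgue_on S.
      complex_of_real (1 / \<mu>) * hdot (curl E x) (curl G x)
      - (\<i> * complex_of_real \<omega>) * (s x *\<^sub>R hdot (E x) (G x)))"
  proof (rule fun_linear_integral[OF fun_subspace_edge])
    fix u v c assume uv: "u \<in> nedelec_space T S \<Gamma>" "v \<in> nedelec_space T S \<Gamma>"
    show "AE x in lebesgue_on S. complex_of_real (1 / \<mu>) * hdot (curl (\<lambda>x. u x + c *\<^sub>R v x) x) (curl G x)
        - (\<i> * complex_of_real \<omega>) * (s x *\<^sub>R hdot (u x + c *\<^sub>R v x) (G x))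
      = complex_of_real (1 / \<mu>) * hdot (curl u x) (curl G x) - (\<i> * complex_of_real \<omega>) * (s x *\<^sub>R hdot (u x) (G x))
        + c *\<^sub>R (complex_of_real (1 / \<mu>) * hdot (curl v x) (curl G x)
          - (\<i> * complex_of_real \<omega>) * (s x *\<^sub>R hdot (v x) (G x)))"
      using curl[OF uv, of c] by eventually_elim (simp only: hdot_simps, simp add: algebra_simps)
  qed (intro Bochner_Integration.integrable_diff integrable_mult_right form_a_integrable[OF assms(1) _ assms(2)])
  show "fun_linear (nedelec_space T S \<Gamma>) (\<lambda>F. LINT x|lebesgue_on S.
      complex_of_real (1 / \<mu>) * hdot (curl G x) (curl F x)
      - (\<i> * complex_of_real \<omega>) * (s x *\<^sub>R hdot (G x) (F x)))"
  proof (rule fun_linear_integral[OF fun_subspace_edge])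
    fix u v c assume uv: "u \<in> nedelec_space T S \<Gamma>" "v \<in> nedelec_space T S \<Gamma>"
    show "AE x in lebesgue_on S. complex_of_real (1 / \<mu>) * hdot (curl G x) (curl (\<lambda>x. u x + c *\<^sub>R v x) x)
        - (\<i> * complex_of_real \<omega>) * (s x *\<^sub>R hdot (G x) (u x + c *\<^sub>R v x))
      = complex_of_real (1 / \<mu>) * hdot (curl G x) (curl u x) - (\<i> * complex_of_real \<omega>) * (s x *\<^sub>R hdot (G x) (u x))
        + c *\<^sub>R (complex_of_real (1 / \<mu>) * hdot (curl G x) (curl v x)
          - (\<i> * complex_of_real \<omega>) * (s x *\<^sub>R hdot (G x) (v x)))"
      using curl[OF uv, of c] by eventually_elim (simp only: hdot_simps, simp add: algebra_simps)
  qed (intro Bochner_Integration.integrable_diff integrable_mult_right form_a_integrable[OF assms(1) assms(2)])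
qed

text \<open>With both fields fixed only the conductivity varies; its uniform bound provides an
  integrable majorant.\<close>

lemma form_a_tendsto:
  assumes "E \<in> nedelec_space T S \<Gamma>" "F \<in> nedelec_space T S \<Gamma>"
    and s: "\<And>k. s k \<in> borel_measurable (lebesgue_on S)" "\<And>k. AE x in lebesgue_on S. \<bar>s k x\<bar> \<le> B"
    and lim: "\<And>x. (\<lambda>k. s k x) \<longlonglongrightarrow> s' x"
  shows "(\<lambda>k. form_a S \<mu> \<omega> (s k) E F) \<longlonglongrightarrow> form_a S \<mu> \<omega> s' E F"
  unfolding form_a_scaleR
proof (rule integral_dominated_convergence)
  let ?P = "\<lambda>x. hdot (curl E x) (curl F x)" and ?Q = "\<lambda>x. hdot (E x) (F x)"
  \<comment> \<open>The constant weight 1 turns the integrability of the weighted product into that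
    of \<open>hdot (E x) (F x)\<close> itself.\<close>
  have one: "ess_bounded (lebesgue_on S) (\<lambda>_. 1 :: real)"
    unfolding ess_bounded_def by (auto intro!: exI[of _ 1])
  have P: "integrable (lebesgue_on S) ?P" and Q: "integrable (lebesgue_on S) ?Q"
    using form_a_integrable[OF one assms(1,2)] by simp_all
  have s': "s' \<in> borel_measurable (lebesgue_on S)"
    by (rule borel_measurable_LIMSEQ_real[OF lim s(1)])
  show "(\<lambda>x. complex_of_real (1 / \<mu>) * ?P x - (\<i> * complex_of_real \<omega>) * (s' x *\<^sub>R ?Q x))
      \<in> borel_measurable (lebesgue_on S)"
    using P Q s' by (intro borel_measurable_diff borel_measurable_times borel_measurable_scaleR) auto
  show "(\<lambda>x. complex_of_real (1 / \<mu>) * ?P x - (\<i> * complex_of_real \<omega>) * (s k x *\<^sub>R ?Q x))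
      \<in> borel_measurable (lebesgue_on S)" for k
    using P Q s(1) by (intro borel_measurable_diff borel_measurable_times borel_measurable_scaleR) auto
  show "integrable (lebesgue_on S) (\<lambda>x. \<bar>1 / \<mu>\<bar> * norm (?P x) + \<bar>\<omega>\<bar> * (\<bar>B\<bar> * norm (?Q x)))"
    using P Q by auto
  show "AE x in lebesgue_on S. (\<lambda>k. complex_of_real (1 / \<mu>) * ?P x
        - (\<i> * complex_of_real \<omega>) * (s k x *\<^sub>R ?Q x))
      \<longlonglongrightarrow> complex_of_real (1 / \<mu>) * ?P x - (\<i> * complex_of_real \<omega>) * (s' x *\<^sub>R ?Q x)"
    by (intro AE_I2 tendsto_intros lim)
  show "AE x in lebesgue_on S. norm (complex_of_real (1 / \<mu>) * ?P x
        - (\<i> * complex_of_real \<omega>) * (s k x *\<^sub>R ?Q x))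
      \<le> \<bar>1 / \<mu>\<bar> * norm (?P x) + \<bar>\<omega>\<bar> * (\<bar>B\<bar> * norm (?Q x))" for k
    using s(2)[of k]
  proof eventually_elim
    case (elim x)
    have "norm (complex_of_real (1 / \<mu>) * ?P x - (\<i> * complex_of_real \<omega>) * (s k x *\<^sub>R ?Q x))
        \<le> norm (complex_of_real (1 / \<mu>) * ?P x) + norm ((\<i> * complex_of_real \<omega>) * (s k x *\<^sub>R ?Q x))"
      by (rule norm_triangle_ineq4)
    also have "\<dots> = \<bar>1 / \<mu>\<bar> * norm (?P x) + \<bar>\<omega>\<bar> * (\<bar>s k x\<bar> * norm (?Q x))"
      by (simp only: norm_mult norm_of_real norm_scaleR norm_ii mult_1)
    also have "\<dots> \<le> \<bar>1 / \<mu>\<bar> * norm (?P x) + \<bar>\<omega>\<bar> * (\<bar>B\<bar> * norm (?Q x))"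
      using elim by (intro add_left_mono mult_left_mono mult_right_mono) auto
    finally show ?case .
  qed
qed

context
  fixes \<epsilon> :: "pt \<Rightarrow> real" and T' :: "pt set set" and \<Omega> \<Gamma> D :: "pt set"
  assumes \<epsilon>: "ess_bounded (lebesgue_on S) \<epsilon>" and sub: "T \<subseteq> T'"
    and \<Omega>: "open \<Omega>" "bounded \<Omega>"
begin

lemma form_b_integrable:
  assumes "E \<in> nedelec_space T' \<Omega> \<Gamma>" "\<psi> \<in> lagrange_space T D"
  shows "integrable (lebesgue_on S) (\<lambda>x. \<epsilon> x *\<^sub>R hdot (E x) (grad \<psi> x))"
    "integrable (lebesgue_on S) (\<lambda>x. \<epsilon> x *\<^sub>R hdot (grad \<psi> x) (E x))"
  using nedelec_ess_bounded(1)[OF sub assms(1)] grad_lagrange_ess_bounded[OF assms(2)] \<epsilon>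
  by (auto intro!: ess_bounded_integrable[OF finite_measure_domain] ess_bounded_bilinear[OF bounded_bilinear_hdot]
      ess_bounded_bilinear[OF bounded_bilinear_scaleR])

lemma form_b_linear_field:
  assumes "\<psi> \<in> lagrange_space T D"
  shows "fun_linear (nedelec_space T' \<Omega> \<Gamma>) (\<lambda>E. form_b S \<epsilon> E (grad \<psi>))"
    "fun_linear (nedelec_space T' \<Omega> \<Gamma>) (form_b S \<epsilon> (grad \<psi>))"
  unfolding form_b_scaleR[abs_def]
  using form_b_integrable[OF _ assms]
  by (intro fun_linear_integral[OF fun_subspace_nedelec[OF \<Omega>]] AE_I2;
      simp add: hdot_simps algebra_simps)+

text \<open>Linearity in the potential makes the functionals induced by potentials a linear
  space.\<close>

lemma form_b_linear_potential:
  assumes "E \<in> nedelec_space T' \<Omega> \<Gamma>"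
  shows "fun_linear (lagrange_space T D) (\<lambda>\<phi>. form_b S \<epsilon> (grad \<phi>) E)"
  unfolding form_b_scaleR
proof (rule fun_linear_integral[OF fun_subspace_lagrange])
  show "integrable (lebesgue_on S) (\<lambda>x. \<epsilon> x *\<^sub>R hdot (grad u x) (E x))"
    if "u \<in> lagrange_space T D" for u :: "pt \<Rightarrow> complex"
    using form_b_integrable(2)[OF assms that] .
  fix u v :: "pt \<Rightarrow> complex" and c assume uv: "u \<in> lagrange_space T D" "v \<in> lagrange_space T D"
  show "AE x in lebesgue_on S. \<epsilon> x *\<^sub>R hdot (grad (\<lambda>x. u x + c *\<^sub>R v x) x) (E x)
      = \<epsilon> x *\<^sub>R hdot (grad u x) (E x) + c *\<^sub>R (\<epsilon> x *\<^sub>R hdot (grad v x) (E x))"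
    using grad_lagrange_linear[OF uv, of c] by eventually_elim (simp add: hdot_simps algebra_simps)
qed

end

lemma source_linear:
  assumes "J \<in> L2 (lebesgue_on S)"
  shows "fun_linear (nedelec_space T S \<Gamma>)
    (\<lambda>F. \<i> * complex_of_real \<omega> * (LINT x|lebesgue_on S. hdot (J x) (F x)))"
proof -
  have "fun_linear (nedelec_space T S \<Gamma>) (\<lambda>F. LINT x|lebesgue_on S. hdot (J x) (F x))"
    using integrable_bilinear[OF bounded_bilinear_hdot L2_integrable[OF finite_measure_domain assms]
        nedelec_ess_bounded(1)[OF subset_refl]]
    by (intro fun_linear_integral[OF fun_subspace_edge]) (auto simp: hdot_simps)
  then show ?thesis unfolding fun_linear_def by (simp add: algebra_simps)
qed

end

section \<open>The boundary misfit\<close>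

lemma borel_measurable_surface:
  assumes "f \<in> borel_measurable borel"
  shows "f \<in> borel_measurable (surface_on \<Gamma>)"
proof -
  have "f \<in> borel_measurable (measure_of UNIV (sets borel) hausdorff2)"
    using assms measurable_cong_sets[OF sets_hausdorff2 refl] by blast
  then show ?thesis
    unfolding surface_on_def by (intro measurable_restrict_space1 measurable_completion)
qed

text \<open>A point of the closure outside \<open>S\<close> is a limit point of \<open>S\<close>, so
  the limit is unique; near it \<open>u\<close> coincides with a continuous field.\<close>

lemma boundary_trace_edge_field:
  assumes "x \<in> closure S" "x \<notin> S" "\<forall>\<^sub>F y in at x within S. y \<in> W"
    and "\<And>y. y \<in> W \<Longrightarrow> u y = a + ccross b (cvec y)"
  shows "boundary_trace S u x = a + ccross b (cvec x)"
proof -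
  have "isCont (\<lambda>y. a + ccross b (cvec y)) x"
    using continuous_on_edge_field by (simp add: continuous_on_eq_continuous_at)
  then have "((\<lambda>y. a + ccross b (cvec y)) \<longlongrightarrow> a + ccross b (cvec x)) (at x within S)"
    using continuous_at_imp_continuous_at_within continuous_within by blast
  moreover have "\<forall>\<^sub>F y in at x within S. a + ccross b (cvec y) = u y"
    using assms(3) by eventually_elim (simp add: assms(4))
  ultimately have "(u \<longlongrightarrow> a + ccross b (cvec x)) (at x within S)"
    by (rule Lim_transform_eventually)
  moreover have "at x within S \<noteq> bot"
    using assms(1,2) by (simp add: trivial_limit_within closure_def)
  ultimately show ?thesis unfolding boundary_trace_def by (intro tendsto_Lim)
qed

lemma cross_normal_comb:
  assumes "w x = p x + c *\<^sub>R q x"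
  shows "cross_normal S w x = cross_normal S p x + c *\<^sub>R cross_normal S q x"
  unfolding cross_normal_def assms
  by (simp add: bounded_bilinear.add_left[OF bounded_bilinear_ccross]
      bounded_bilinear.scaleR_left[OF bounded_bilinear_ccross])

locale convex_tetra_mesh = tetra_mesh +
  fixes \<Gamma> :: "pt set"
  assumes convex_domain: "convex S" and nonempty_domain: "S \<noteq> {}"
    and facets: "\<exists>\<F>. (\<forall>F\<in>\<F>. F facet_of closure S) \<and> \<Gamma> = \<Union>\<F>"
begin

text \<open>A polytope has finitely many facets, which makes \<Gamma> a finite union of compact
  sets. By convexity the hull of all mesh vertices is the closure itself.\<close>

lemma polytope_closure_domain: "polytope (closure S)"
proof -
  have "\<forall>t\<in>T. \<exists>C. finite C \<and> t = convex hull C"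
    using simplex_mesh simplex by blast
  then obtain C where C: "\<And>t. t \<in> T \<Longrightarrow> finite (C t)" "\<And>t. t \<in> T \<Longrightarrow> t = convex hull C t" by metis
  have "closure S = convex hull (\<Union>t\<in>T. C t)"
  proof
    have "t \<subseteq> convex hull (\<Union>t\<in>T. C t)" if "t \<in> T" for t
      using hull_mono[of "C t" "\<Union>t\<in>T. C t" convex] C(2)[OF that] that by auto
    then show "closure S \<subseteq> convex hull (\<Union>t\<in>T. C t)" unfolding Union_mesh[symmetric] by blast
    have "C t \<subseteq> closure S" if "t \<in> T" for t
      using C(2)[OF that] hull_subset[of "C t" convex] Union_mesh that by blast
    then show "convex hull (\<Union>t\<in>T. C t) \<subseteq> closure S"
      by (intro hull_minimal convex_closure convex_domain) blast
  qed
  then show ?thesis unfolding polytope_def using C(1) finite_mesh by blast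
qed

lemma Gamma: "compact \<Gamma>" "\<Gamma> \<subseteq> closure S - S"
proof -
  obtain \<F> where \<F>: "\<forall>F\<in>\<F>. F facet_of closure S" "\<Gamma> = \<Union>\<F>" using facets by blast
  have "finite \<F>"
    by (rule finite_subset[OF _ finite_polytope_facets[OF polytope_closure_domain]]) (use \<F>(1) in blast)
  moreover have "compact F" if "F \<in> \<F>" for F
    using \<F>(1) that face_of_imp_compact[OF convex_closure[OF convex_domain]] bounded_domain
    unfolding facet_of_def by auto
  ultimately show "compact \<Gamma>" unfolding \<F>(2) by (rule compact_Union) auto
  have "F \<subseteq> closure S - S" if "F \<in> \<F>" for F
  proof -
    have "F face_of closure S" "F \<noteq> closure S" using \<F>(1) that unfolding facet_of_def by auto
    note face_of_disjoint_interior[OF this] face_of_imp_subset[OF this(1)]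
    moreover have "interior (closure S) = S"
      using convex_interior_closure[OF convex_domain] open_domain by (simp add: interior_open)
    ultimately show ?thesis by blast
  qed
  then show "\<Gamma> \<subseteq> closure S - S" unfolding \<F>(2) by blast
qed

text \<open>The interiors of the tetrahedra lie in the open convex set \<open>S\<close>, so a point
  of \<Gamma> is on the boundary of any tetrahedron containing it, and the pieces of the single
  tetrahedra cover \<Gamma>.\<close>

lemma boundary_pieces:
  obtains \<P> B where "finite \<P>" "B \<in> null_sets area" "\<Gamma> \<subseteq> B \<union> (\<Union>(P, t, \<nu>)\<in>\<P>. P)"
    "\<And>P t \<nu>. (P, t, \<nu>) \<in> \<P> \<Longrightarrow> P \<in> sets borel \<and> emeasure area P < \<infinity> \<and> t \<in> T \<and>
      (\<forall>x\<in>P - S. outer_normal S x = \<nu> \<and> (\<forall>\<^sub>F y in at x within S. y \<in> interior t))"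
proof -
  define Q where "Q t \<P> B \<longleftrightarrow> finite \<P> \<and> B \<in> null_sets area \<and> t - interior t \<subseteq> B \<union> (\<Union>(P, s, \<nu>)\<in>\<P>. P) \<and>
    (\<forall>(P, s, \<nu>)\<in>\<P>. P \<in> sets borel \<and> emeasure area P < \<infinity> \<and> s = t \<and>
      (\<forall>x\<in>P - S. outer_normal S x = \<nu> \<and> (\<forall>\<^sub>F y in at x within S. y \<in> interior t)))" for t \<P> B
  have "\<exists>\<P> B. Q t \<P> B" if "t \<in> T" for t
    unfolding Q_def
    by (rule simplex_boundary_pieces[OF open_domain convex_domain nonempty_domain simplex_mesh[OF that]])
      (use Union_mesh that in blast)
  then obtain \<P> B where "\<And>t. t \<in> T \<Longrightarrow> Q t (\<P> t) (B t)" by metis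
  note PB = this[unfolded Q_def, THEN conjunct1] this[unfolded Q_def, THEN conjunct2, THEN conjunct1]
    this[unfolded Q_def, THEN conjunct2, THEN conjunct2, THEN conjunct1]
    this[unfolded Q_def, THEN conjunct2, THEN conjunct2, THEN conjunct2]
  show ?thesis
  proof (rule that[of "\<Union>t\<in>T. \<P> t" "\<Union>t\<in>T. B t"])
    show "finite (\<Union>t\<in>T. \<P> t)" "(\<Union>t\<in>T. B t) \<in> null_sets area"
      using finite_mesh PB(1,2) by auto
    show "\<Gamma> \<subseteq> (\<Union>t\<in>T. B t) \<union> (\<Union>(P, t, \<nu>)\<in>\<Union>t\<in>T. \<P> t. P)"
    proof
      fix x assume "x \<in> \<Gamma>"
      then have x: "x \<in> closure S" "x \<notin> S" using Gamma by auto
      then obtain t where t: "t \<in> T" "x \<in> t" using Union_mesh by blast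
      have "interior t \<subseteq> interior (closure S)" using Union_mesh t(1) by (intro interior_mono) blast
      then have "x \<notin> interior t"
        using x(2) convex_interior_closure[OF convex_domain] open_domain by (auto simp: interior_open)
      then have "x \<in> B t \<union> (\<Union>(P, s, \<nu>)\<in>\<P> t. P)" using PB(3)[OF t(1)] t(2) by blast
      then show "x \<in> (\<Union>t\<in>T. B t) \<union> (\<Union>(P, t, \<nu>)\<in>\<Union>t\<in>T. \<P> t. P)" using t(1) by blast
    qed
  qed (use PB(4) in fastforce)
qed

abbreviation tangential_trace :: "(pt \<Rightarrow> cvec) \<Rightarrow> pt \<Rightarrow> cvec" where
  "tangential_trace u \<equiv> cross_normal S (boundary_trace S u)"

lemma sets_surface: "A \<subseteq> \<Gamma> \<Longrightarrow> A \<in> sets area \<Longrightarrow> A \<in> sets (surface_on \<Gamma>)"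
  unfolding surface_on_def
  using borel_sets_area[OF borel_compact[OF Gamma(1)]]
  by (subst sets_restrict_space_iff) (auto simp: space_hausdorff2)

lemma emeasure_surface: "A \<subseteq> \<Gamma> \<Longrightarrow> emeasure (surface_on \<Gamma>) A = emeasure area A"
  unfolding surface_on_def
  using borel_sets_area[OF borel_compact[OF Gamma(1)]]
  by (intro emeasure_restrict_space) (auto simp: space_hausdorff2)

lemma space_surface: "space (surface_on \<Gamma>) = \<Gamma>"
  unfolding surface_on_def by (simp add: space_restrict_space space_hausdorff2)

text \<open>Finiteness, a consequence of the cover by finitely many facets, is what makes constants
  integrable majorants on \<Gamma>.\<close>

lemma finite_measure_surface: "finite_measure (surface_on \<Gamma>)"
proof
  obtain \<P> B where P: "finite \<P>" "B \<in> null_sets area" "\<Gamma> \<subseteq> B \<union> (\<Union>(P, t, \<nu>)\<in>\<P>. P)"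
    "\<And>P t \<nu>. (P, t, \<nu>) \<in> \<P> \<Longrightarrow> P \<in> sets borel \<and> emeasure area P < \<infinity> \<and> t \<in> T \<and>
      (\<forall>x\<in>P - S. outer_normal S x = \<nu> \<and> (\<forall>\<^sub>F y in at x within S. y \<in> interior t))"
    by (rule boundary_pieces) (rule that; assumption)
  have sets: "fst ` \<P> \<subseteq> sets area" using P(4) borel_sets_area by fastforce
  have "emeasure area \<Gamma> \<le> emeasure area (B \<union> \<Union>(fst ` \<P>))"
    using P(1,2,3) sets by (intro emeasure_mono sets.Un sets.finite_Union) fastforce+
  also have "\<dots> \<le> emeasure area B + emeasure area (\<Union>(fst ` \<P>))"
    using P(1,2) sets by (intro emeasure_subadditive sets.finite_Union) auto
  also have "\<dots> \<le> 0 + (\<Sum>A\<in>fst ` \<P>. emeasure area A)"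
    using P(1,2) sets emeasure_subadditive_finite[of "fst ` \<P>" "\<lambda>A. A" area]
    by (intro add_mono) (auto simp: null_setsD1)
  also have "\<dots> < \<infinity>" using P(1,4) by (fastforce simp: ennreal_sum_less_top)
  finally show "emeasure (surface_on \<Gamma>) (space (surface_on \<Gamma>)) \<noteq> \<infinity>"
    by (simp add: space_surface emeasure_surface)
qed

text \<open>Off the edges the trace is the affine field of one tetrahedron continued to the boundary
  point, and the normal is constant on each piece. The exceptional set depends on the mesh only, so
  linearity holds outside one null set for all fields at once.\<close>

lemma tangential_trace_properties:
  shows "u \<in> nedelec_space T S \<Gamma> \<Longrightarrow> ess_bounded (surface_on \<Gamma>) (tangential_trace u)" (is "_ \<Longrightarrow> ?bd u")
    and "AE x in surface_on \<Gamma>. fun_linear (nedelec_space T S \<Gamma>) (\<lambda>u. tangential_trace u x)" (is ?lin)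
proof -
  obtain \<P> B where P: "finite \<P>" "B \<in> null_sets area" "\<Gamma> \<subseteq> B \<union> (\<Union>(P, t, \<nu>)\<in>\<P>. P)"
    and piece: "\<And>P t \<nu>. (P, t, \<nu>) \<in> \<P> \<Longrightarrow> P \<in> sets borel \<and> emeasure area P < \<infinity> \<and> t \<in> T \<and>
      (\<forall>x\<in>P - S. outer_normal S x = \<nu> \<and> (\<forall>\<^sub>F y in at x within S. y \<in> interior t))"
    by (rule boundary_pieces) (rule that; assumption)
  \<comment> \<open>Completion of the area measure makes all subsets of the edge set
    measurable.\<close>
  have null: "A \<in> null_sets (surface_on \<Gamma>)" if "A \<subseteq> B \<inter> \<Gamma>" for A
  proof -
    have "A \<in> null_sets area"
      using that P(2) null_sets_completion_subset[of A B] by blast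
    then show ?thesis using that by (intro null_setsI sets_surface) (auto simp: emeasure_surface)
  qed
  have AE: "AE x in surface_on \<Gamma>. x \<in> \<Gamma> - B"
    using AE_not_in[OF null[OF subset_refl]] AE_space by eventually_elim (auto simp: space_surface)
  have trace: "boundary_trace S u x = a + ccross b (cvec x)"
    if "(P, t, \<nu>) \<in> \<P>" "x \<in> P \<inter> \<Gamma>" "\<And>x. x \<in> interior t \<Longrightarrow> u x = a + ccross b (cvec x)" for P t \<nu> x u a b
    using piece[OF that(1)] Gamma(2) that(2) by (intro boundary_trace_edge_field[OF _ _ _ that(3)]) auto
  show ?lin
    using AE
  proof eventually_elim
    case (elim x)
    then obtain P t \<nu> where x: "(P, t, \<nu>) \<in> \<P>" "x \<in> P \<inter> \<Gamma>" using P(3) by blast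
    show ?case
      unfolding fun_linear_def
    proof (intro ballI allI cross_normal_comb)
      fix u v c assume uv: "u \<in> nedelec_space T S \<Gamma>" "v \<in> nedelec_space T S \<Gamma>"
      have t: "t \<in> T" using piece[OF x(1)] by blast
      obtain a b where ab: "\<And>x. x \<in> interior t \<Longrightarrow> u x = a + ccross b (cvec x)"
        using nedelec_affine[OF uv(1) t] by blast
      obtain a' b' where ab': "\<And>x. x \<in> interior t \<Longrightarrow> v x = a' + ccross b' (cvec x)"
        using nedelec_affine[OF uv(2) t] by blast
      show "boundary_trace S (\<lambda>x. u x + c *\<^sub>R v x) x = boundary_trace S u x + c *\<^sub>R boundary_trace S v x"
        using trace[OF x ab] trace[OF x ab'] trace[OF x nedelec_comb_affine[OF ab ab', where c = c]]
        by (simp add: bounded_bilinear.add_left[OF bounded_bilinear_ccross]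
            bounded_bilinear.scaleR_left[OF bounded_bilinear_ccross] scaleR_add_right)
    qed
  qed
  show "?bd u" if u: "u \<in> nedelec_space T S \<Gamma>"
  proof -
    have "\<forall>t\<in>T. \<exists>a b. \<forall>x\<in>interior t. u x = a + ccross b (cvec x)"
      using nedelec_affine[OF u] by blast
    then obtain a b where ab: "\<And>t x. t \<in> T \<Longrightarrow> x \<in> interior t \<Longrightarrow> u x = a t + ccross (b t) (cvec x)"
      by metis
    define g where "g = (\<lambda>(P :: pt set, t, \<nu>) x. ccross (a t + ccross (b t) (cvec x)) (cvec \<nu>))"
    have g: "continuous_on UNIV (g p)" for p
      unfolding g_def
      by (auto simp: split_beta intro!: bounded_bilinear.continuous_on[OF bounded_bilinear_ccross]
          continuous_on_edge_field continuous_on_const)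
    have eq: "tangential_trace u x = g p x" if "p \<in> \<P>" "x \<in> fst p \<inter> \<Gamma>" for p x
    proof -
      obtain P t \<nu> where p: "p = (P, t, \<nu>)" by (cases p) auto
      have pP: "(P, t, \<nu>) \<in> \<P>" "x \<in> P \<inter> \<Gamma>" using that p by auto
      have "outer_normal S x = \<nu>" "t \<in> T" using piece[OF pP(1)] pP(2) Gamma(2) by auto
      then show ?thesis unfolding cross_normal_def p g_def using trace[OF pP ab] by simp
    qed
    have cover: "\<exists>p\<in>\<P>. x \<in> fst p \<inter> \<Gamma>" if "x \<in> \<Gamma> - B" for x
    proof -
      obtain P t \<nu> where "(P, t, \<nu>) \<in> \<P>" "x \<in> P" using P(3) \<open>x \<in> \<Gamma> - B\<close> by blast
      then show ?thesis using that by (intro bexI[of _ "(P, t, \<nu>)"]) auto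
    qed
    have "tangential_trace u \<in> borel_measurable (surface_on \<Gamma>)"
    proof (rule measurable_piecewise_null[where I = \<P> and A = "\<lambda>p. fst p \<inter> \<Gamma>" and N = "B \<inter> \<Gamma>" and g = g])
      show "fst p \<inter> \<Gamma> \<in> sets (surface_on \<Gamma>)" if "p \<in> \<P>" for p
        using piece[of "fst p" "fst (snd p)" "snd (snd p)"] that borel_compact[OF Gamma(1)]
        by (intro sets_surface borel_sets_area) auto
      show "g p \<in> borel_measurable (surface_on \<Gamma>)" for p
        by (intro borel_measurable_surface borel_measurable_continuous_onI g)
      show "space (surface_on \<Gamma>) \<subseteq> B \<inter> \<Gamma> \<union> (\<Union>p\<in>\<P>. fst p \<inter> \<Gamma>)"
        unfolding space_surface using cover by blast
    qed (use P(1) null eq in auto)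
    moreover have "\<exists>K. \<forall>x\<in>\<Gamma>. norm (g p x) \<le> K" for p
    proof -
      have "compact (g p ` \<Gamma>)"
        using Gamma(1) continuous_on_subset[OF g] by (intro compact_continuous_image) auto
      then show ?thesis using compact_imp_bounded bounded_iff by (metis imageI)
    qed
    then obtain K where K: "\<And>p x. x \<in> \<Gamma> \<Longrightarrow> norm (g p x) \<le> K p" by metis
    have "AE x in surface_on \<Gamma>. norm (tangential_trace u x) \<le> (\<Sum>p\<in>\<P>. \<bar>K p\<bar>)"
      using AE
    proof eventually_elim
      case (elim x)
      then obtain p where p: "p \<in> \<P>" "x \<in> fst p \<inter> \<Gamma>" using cover by blast
      then have "norm (tangential_trace u x) \<le> \<bar>K p\<bar>" using eq[OF p] K[of x p] by auto
      also have "\<dots> \<le> (\<Sum>p\<in>\<P>. \<bar>K p\<bar>)" using p P(1) by (intro member_le_sum) auto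
      finally show ?case .
    qed
    ultimately show ?thesis unfolding ess_bounded_def by blast
  qed
qed

lemma misfit_tendsto:
  assumes data: "cross_normal S Eobs \<in> L2 (surface_on \<Gamma>)"
    and J: "finite J" "\<And>j. j \<in> J \<Longrightarrow> G j \<in> nedelec_space T S \<Gamma>"
    and c: "\<And>j. j \<in> J \<Longrightarrow> (\<lambda>k. c k j) \<longlonglongrightarrow> c' j"
  shows "(\<lambda>k. misfit S \<Gamma> Eobs (\<lambda>x. \<Sum>j\<in>J. c k j *\<^sub>R G j x))
    \<longlonglongrightarrow> misfit S \<Gamma> Eobs (\<lambda>x. \<Sum>j\<in>J. c' j *\<^sub>R G j x)"
proof -
  interpret finite_measure "surface_on \<Gamma>" by (rule finite_measure_surface)
  define d where "d = cross_normal S Eobs"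
  let ?u = "\<lambda>c x. \<Sum>j\<in>J. c j *\<^sub>R G j x"
  have d: "d \<in> borel_measurable (surface_on \<Gamma>)" "integrable (surface_on \<Gamma>) (\<lambda>x. (norm (d x))\<^sup>2)"
    using data unfolding d_def L2_def by auto
  have u: "?u e \<in> nedelec_space T S \<Gamma>" for e :: "_ \<Rightarrow> real"
    by (rule fun_subspace_sum[OF fun_subspace_edge J])
  \<comment> \<open>The quantifier over coefficients stands inside, so one null set serves all
    members of the sequence and the limit.\<close>
  have lin: "AE x in surface_on \<Gamma>. \<forall>e. tangential_trace (?u e) x = (\<Sum>j\<in>J. e j *\<^sub>R tangential_trace (G j) x)"
    using tangential_trace_properties(2)
    by eventually_elim (intro allI fun_linear_sum[OF fun_subspace_edge _ J])
  have "\<forall>j\<in>J. \<exists>K\<ge>0. AE x in surface_on \<Gamma>. norm (tangential_trace (G j) x) \<le> K"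
  proof
    fix j assume "j \<in> J"
    then show "\<exists>K\<ge>0. AE x in surface_on \<Gamma>. norm (tangential_trace (G j) x) \<le> K"
      using ess_boundedE[OF tangential_trace_properties(1)[OF J(2)]] by blast
  qed
  then obtain K where K: "\<And>j. j \<in> J \<Longrightarrow> 0 \<le> K j"
    "\<And>j. j \<in> J \<Longrightarrow> AE x in surface_on \<Gamma>. norm (tangential_trace (G j) x) \<le> K j" by metis
  have "\<forall>j\<in>J. \<exists>L\<ge>0. \<forall>k. \<bar>c k j\<bar> \<le> L"
  proof
    fix j assume "j \<in> J"
    then have "Bseq (\<lambda>k. c k j)" using c convergentI convergent_imp_Bseq by blast
    then show "\<exists>L\<ge>0. \<forall>k. \<bar>c k j\<bar> \<le> L" by (auto elim!: BseqE intro: less_imp_le)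
  qed
  then obtain L where L: "\<And>j. j \<in> J \<Longrightarrow> 0 \<le> L j" "\<And>j k. j \<in> J \<Longrightarrow> \<bar>c k j\<bar> \<le> L j" by metis
  \<comment> \<open>\<open>L j\<close> bounds the convergent coefficients and \<open>K j\<close> the
    traces of the \<open>G j\<close>, so \<open>N\<close> bounds all traces of the sequence
    uniformly.\<close>
  define N where "N = (\<Sum>j\<in>J. L j * K j)"
  have Kall: "AE x in surface_on \<Gamma>. \<forall>j\<in>J. norm (tangential_trace (G j) x) \<le> K j"
    using J(1) K(2) by (intro AE_finite_allI)
  have meas: "(\<lambda>x. (norm (tangential_trace (?u e) x - d x))\<^sup>2) \<in> borel_measurable (surface_on \<Gamma>)"
    for e :: "_ \<Rightarrow> real"
  proof -
    have "(\<lambda>x. tangential_trace (?u e) x - d x) \<in> borel_measurable (surface_on \<Gamma>)"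
      using ess_bounded_measurable[OF tangential_trace_properties(1)[OF u]] d(1)
      by (rule borel_measurable_diff)
    then show ?thesis by measurable
  qed
  have "(\<lambda>k. LINT x|surface_on \<Gamma>. (norm (tangential_trace (?u (c k)) x - d x))\<^sup>2)
      \<longlonglongrightarrow> (LINT x|surface_on \<Gamma>. (norm (tangential_trace (?u c') x - d x))\<^sup>2)"
  proof (rule integral_dominated_convergence[where w = "\<lambda>x. 2 * N\<^sup>2 + 2 * (norm (d x))\<^sup>2"])
    show "integrable (surface_on \<Gamma>) (\<lambda>x. 2 * N\<^sup>2 + 2 * (norm (d x))\<^sup>2)" using d(2) by simp
    show "AE x in surface_on \<Gamma>. (\<lambda>k. (norm (tangential_trace (?u (c k)) x - d x))\<^sup>2)
        \<longlonglongrightarrow> (norm (tangential_trace (?u c') x - d x))\<^sup>2"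
      using lin
    proof eventually_elim
      case (elim x)
      have "(\<lambda>k. \<Sum>j\<in>J. c k j *\<^sub>R tangential_trace (G j) x) \<longlonglongrightarrow> (\<Sum>j\<in>J. c' j *\<^sub>R tangential_trace (G j) x)"
        by (intro tendsto_intros c)
      then show ?case using elim by (auto intro!: tendsto_intros)
    qed
    show "AE x in surface_on \<Gamma>. norm ((norm (tangential_trace (?u (c k)) x - d x))\<^sup>2)
        \<le> 2 * N\<^sup>2 + 2 * (norm (d x))\<^sup>2" for k
      using lin Kall
    proof eventually_elim
      case (elim x)
      have "norm (tangential_trace (?u (c k)) x) \<le> (\<Sum>j\<in>J. norm (c k j *\<^sub>R tangential_trace (G j) x))"
        unfolding elim(1)[rule_format] by (rule norm_sum)
      also have "\<dots> \<le> N"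
        unfolding N_def using elim(2) L by (intro sum_mono) (auto intro!: mult_mono)
      finally have "(norm (tangential_trace (?u (c k)) x))\<^sup>2 \<le> N\<^sup>2" by (intro power_mono) auto
      then show ?case
        using norm_add_sq_le[of "tangential_trace (?u (c k)) x" "- d x"] by simp
    qed
  qed (rule meas)+
  then show ?thesis unfolding misfit_def d_def by (intro tendsto_mult tendsto_const)
qed

end

section \<open>Discrete conductivities\<close>

text \<open>By continuity the points violating the condition form an open set; being null, it is
  empty.\<close>

lemma AE_open_imp_all:
  fixes f :: "'a::euclidean_space \<Rightarrow> 'b::topological_space"
  assumes "open W" "W \<subseteq> S" "S \<in> sets lebesgue" "continuous_on W f" "closed A"
    and AE: "AE x in lebesgue_on S. x \<in> W \<longrightarrow> f x \<in> A"
    and "x \<in> W"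
  shows "f x \<in> A"
proof -
  define V where "V = W \<inter> f -` (- A)"
  have V: "open V" unfolding V_def using assms(1,4,5) by (intro continuous_open_preimage) auto
  have "AE x in lebesgue. x \<in> S \<longrightarrow> x \<in> W \<longrightarrow> f x \<in> A"
    using AE assms(3) by (simp add: AE_restrict_space_iff)
  then have "AE x in lebesgue. x \<notin> V" by eventually_elim (use assms(2) in \<open>auto simp: V_def\<close>)
  then have "negligible V"
    using V by (simp add: AE_iff_null_sets negligible_iff_null_sets)
  then have "V = {}" using V open_not_negligible by blast
  then show ?thesis using assms(7) unfolding V_def by blast
qed

lemma continuous_on_affine_sum:
  fixes b :: "3 \<Rightarrow> 'b::real_normed_vector"
  shows "continuous_on UNIV (\<lambda>x::pt. a + (\<Sum>i\<in>UNIV. x $ i *\<^sub>R b i))"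
  by (intro continuous_intros)

lemma total_variation_ge:
  assumes "g \<in> C1_compact S" "\<And>x. x \<in> S \<Longrightarrow> norm (g x) \<le> 1"
  shows "ereal (LINT x|lebesgue_on S. u x * divg g x) \<le> total_variation S u"
  unfolding total_variation_def by (rule SUP_upper) (use assms in auto)

text \<open>The zero field is an admissible test field.\<close>

lemma total_variation_nonneg: "0 \<le> total_variation S u"
proof -
  have D: "((\<lambda>_. 0 :: real^3) has_derivative (\<lambda>_. 0)) (at x)" for x :: pt by (rule has_derivative_const)
  then have "partial i (\<lambda>_. 0 :: real^3) = (\<lambda>_. 0)" for i using partial_eq by blast
  then have "(\<lambda>_. 0 :: real^3) \<in> C1_compact S" unfolding C1_compact_def by simp
  from total_variation_ge[OF this, of u] divg_eq[OF D] show ?thesis by (simp add: zero_ereal_def)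
qed

lemma total_variation_le:
  assumes "\<And>g. g \<in> C1_compact S \<Longrightarrow> (\<And>x. x \<in> S \<Longrightarrow> norm (g x) \<le> 1) \<Longrightarrow>
    ereal (LINT x|lebesgue_on S. u x * divg g x) \<le> c"
  shows "total_variation S u \<le> c"
  unfolding total_variation_def by (rule SUP_least) (use assms in auto)

context tetra_mesh
begin

text \<open>Regularity of \<open>S\<close> places the interiors of the tetrahedra inside
  \<open>S\<close>, where the bounds hold everywhere by continuity; they extend to the closed
  tetrahedra because these are the closures of their interiors.\<close>

lemma lagrange_bounds:
  fixes u :: "pt \<Rightarrow> real"
  assumes regular: "interior (closure S) = S" and u: "u \<in> lagrange_space T D"
    and AE: "AE x in lebesgue_on S. m \<le> u x \<and> u x \<le> M" and t: "t \<in> T" "x \<in> t"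
  shows "m \<le> u x \<and> u x \<le> M"
proof -
  obtain a b where ab: "\<And>x. x \<in> t \<Longrightarrow> u x = a + (\<Sum>i\<in>UNIV. x $ i *\<^sub>R b i)"
    using lagrange_affine[OF u t(1)] by blast
  define f where "f = (\<lambda>x::pt. a + (\<Sum>i\<in>UNIV. x $ i *\<^sub>R b i))"
  have f: "continuous_on UNIV f" unfolding f_def by (rule continuous_on_affine_sum)
  have fu: "f x = u x" if "x \<in> t" for x using ab that unfolding f_def by simp
  have "interior t \<subseteq> interior (closure S)" using Union_mesh t(1) by (intro interior_mono) blast
  then have "interior t \<subseteq> S" unfolding regular .
  moreover have "AE x in lebesgue_on S. x \<in> interior t \<longrightarrow> f x \<in> {m..M}"
    using AE by eventually_elim (use fu interior_subset[of t] in force)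
  ultimately have "f y \<in> {m..M}" if "y \<in> interior t" for y
    using open_domain that
    by (intro AE_open_imp_all[of "interior t" S f "{m..M}"] continuous_on_subset[OF f]) auto
  then have "interior t \<subseteq> f -` {m..M}" by blast
  moreover have "closed (f -` {m..M})" using f by (intro closed_vimage) auto
  ultimately have "t \<subseteq> f -` {m..M}" using closure_minimal closure_interior_mesh[OF t(1)] by metis
  then show ?thesis using fu[OF t(2)] t(2) by auto
qed

text \<open>A point of \<open>t\<close> outside \<open>S\<close> has a neighbourhood missing the
  compact set \<open>C\<close>, so \<open>u\<close> is zero on a nonempty open part of
  \<open>t\<close>. An affine function with this property is zero on all of
  \<open>t\<close>.\<close>

lemma lagrange_vanish:
  fixes u :: "pt \<Rightarrow> real"
  assumes regular: "interior (closure S) = S" and u: "u \<in> lagrange_space T D"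
    and C: "compact C" "C \<subseteq> S" and AE: "AE x in lebesgue_on S. x \<notin> C \<longrightarrow> u x = 0"
    and t: "t \<in> T" "\<not> t \<subseteq> S" "z \<in> t"
  shows "u z = 0"
proof -
  obtain a b where ab: "\<And>x. x \<in> t \<Longrightarrow> u x = a + (\<Sum>i\<in>UNIV. x $ i *\<^sub>R b i)"
    using lagrange_affine[OF u t(1)] by blast
  define f where "f = (\<lambda>x::pt. a + (\<Sum>i\<in>UNIV. x $ i *\<^sub>R b i))"
  have f: "continuous_on UNIV f" unfolding f_def by (rule continuous_on_affine_sum)
  have fu: "f x = u x" if "x \<in> t" for x using ab that unfolding f_def by simp
  define W where "W = - C \<inter> interior t"
  have W: "open W" "W \<subseteq> t"
    unfolding W_def using compact_imp_closed[OF C(1)] interior_subset by auto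
  have "interior t \<subseteq> interior (closure S)" using Union_mesh t(1) by (intro interior_mono) blast
  then have "interior t \<subseteq> S" unfolding regular .
  then have "f y \<in> {0}" if "y \<in> W" for y
    using AE fu W(2) open_domain that
    by (intro AE_open_imp_all[of W S f "{0}"] continuous_on_subset[OF f] W(1))
      (auto elim!: eventually_mono simp: W_def)
  then have zero: "f y = 0" if "y \<in> W" for y using that by blast
  obtain x0 where "x0 \<in> t" "x0 \<notin> S" using t(2) by blast
  then have "x0 \<in> closure (interior t)" "x0 \<in> - C" using closure_interior_mesh[OF t(1)] C(2) by auto
  then have "W \<noteq> {}"
    unfolding W_def using open_Int_closure_eq_empty[of "- C" "interior t"] compact_imp_closed[OF C(1)]
    by blast
  then obtain p r where p: "0 < r" "ball p r \<subseteq> W" using W(1) open_contains_ball by (metis all_not_in_conv)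
  \<comment> \<open>The step from \<open>p\<close> towards \<open>z\<close> must stay in the ball;
    the summand 1 avoids division by zero when \<open>z = p\<close>. As \<open>f\<close> is affine
    and zero at both \<open>p\<close> and the new point, it is zero at \<open>z\<close>.\<close>
  define s where "s = r / (2 * (1 + norm (z - p)))"
  have s: "s > 0" unfolding s_def using p(1) by (simp add: add_pos_nonneg)
  have "s * norm (z - p) < r"
    unfolding s_def using p(1) norm_ge_zero[of "z - p"]
    by (simp add: divide_simps add_pos_nonneg) (simp add: algebra_simps add_pos_nonneg)
  then have "p + s *\<^sub>R (z - p) \<in> W" using s by (intro subsetD[OF p(2)]) (simp add: dist_norm)
  moreover have "f (p + s *\<^sub>R (z - p)) = (1 - s) * f p + s * f z"
    unfolding f_def by (simp add: algebra_simps sum.distrib sum_subtractf sum_distrib_left)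
  moreover have "f p = 0" using p by (intro zero subsetD[OF p(2)]) simp
  ultimately have "s * f z = 0" using zero by force
  then show ?thesis using s fu[OF t(3)] by simp
qed

lemma lagrange_determined:
  "\<exists>P. finite P \<and> P \<subseteq> \<Union>T \<and> (\<forall>u :: pt \<Rightarrow> 'b::real_normed_vector. u \<in> lagrange_space T S \<longrightarrow>
    (\<forall>p\<in>P. u p = 0) \<longrightarrow> u = (\<lambda>_. 0))"
proof -
  have "\<forall>t\<in>T. \<exists>C. finite C \<and> t = convex hull C"
    using simplex_mesh simplex by blast
  then obtain C where C: "\<And>t. t \<in> T \<Longrightarrow> finite (C t)" "\<And>t. t \<in> T \<Longrightarrow> t = convex hull C t" by metis
  have Ct: "C t \<subseteq> t" if "t \<in> T" for t using C(2)[OF that] hull_subset by metis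
  have "u x = 0" if u: "u \<in> lagrange_space T S" "\<forall>p\<in>(\<Union>t\<in>T. C t). u p = 0"
    for u :: "pt \<Rightarrow> 'b" and x
  proof (cases "x \<in> \<Union>T")
    case True
    then obtain t where t: "t \<in> T" "x \<in> t" by blast
    then have "x \<in> convex hull C t" using C(2) by blast
    then obtain l where l: "(\<Sum>v\<in>C t. l v) = 1" "(\<Sum>v\<in>C t. l v *\<^sub>R v) = x"
      unfolding convex_hull_finite[OF C(1)[OF t(1)]] by blast
    have "u x = (\<Sum>v\<in>C t. l v *\<^sub>R u v)"
      using lagrange_convex_combination[OF u(1) t(1) Ct[OF t(1)] l(1)] t(2) unfolding l(2) by simp
    then show ?thesis using u(2) t(1) by simp
  next
    case False
    then have "x \<notin> S" using Union_mesh closure_subset by blast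
    then show ?thesis using u(1) unfolding lagrange_space_def by blast
  qed
  moreover have "finite (\<Union>t\<in>T. C t)" "(\<Union>t\<in>T. C t) \<subseteq> \<Union>T" using C(1) finite_mesh Ct by auto
  ultimately show ?thesis by (intro exI[of _ "\<Union>t\<in>T. C t"] conjI allI impI ext) auto
qed

text \<open>The sum of absolute values bounds both signs of \<open>m\<close> and \<open>M\<close>
  and also the value 0 outside \<open>S\<close>.\<close>

lemma admissible_bounded:
  fixes u :: "pt \<Rightarrow> real"
  assumes "interior (closure S) = S" "u \<in> lagrange_space T S \<inter> admissible S m M"
  shows "\<bar>u x\<bar> \<le> \<bar>m\<bar> + \<bar>M\<bar>"
proof (cases "x \<in> \<Union>T")
  case True
  then obtain t where "t \<in> T" "x \<in> t" by blast
  then have "m \<le> u x \<and> u x \<le> M" using assms unfolding admissible_def by (intro lagrange_bounds) auto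
  then show ?thesis by linarith
next
  case False
  then have "x \<notin> S" using Union_mesh closure_subset by blast
  then have "u x = 0" using assms(2) unfolding lagrange_space_def by blast
  then show ?thesis by simp
qed

lemma lagrange_measurable:
  fixes u :: "pt \<Rightarrow> real"
  assumes "u \<in> lagrange_space T D"
  shows "u \<in> borel_measurable (lebesgue_on S)"
proof (rule ess_bounded_measurable, rule ess_bounded_piecewise)
  fix t assume "t \<in> T"
  then obtain a b where "\<And>x. x \<in> t \<Longrightarrow> u x = a + (\<Sum>i\<in>UNIV. x $ i *\<^sub>R b i)"
    using lagrange_affine[OF assms] by blast
  then show "\<exists>g. continuous_on UNIV g \<and> (\<forall>x\<in>interior t. u x = g x)"
    using continuous_on_affine_sum[of a b] interior_subset by blast
qed

text \<open>Finite total variation of the limit is left as a premise of membership; it will come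
  from the bound on the objective along the minimizing sequence.\<close>

lemma admissible_subsequence:
  assumes regular: "interior (closure S) = S"
    and u: "\<And>k. u k \<in> lagrange_space T S \<inter> admissible S m M"
  shows "\<exists>r u'. strict_mono (r :: nat \<Rightarrow> nat) \<and> u' \<in> lagrange_space T S \<and>
    (\<forall>x. (\<lambda>k. u (r k) x) \<longlonglongrightarrow> u' x) \<and> (total_variation S u' < \<infinity> \<longrightarrow> u' \<in> admissible S m M)"
proof -
  let ?X = "lagrange_space T S :: (pt \<Rightarrow> real) set"
  obtain P where P: "finite P" "P \<subseteq> \<Union>T" "\<And>v :: pt \<Rightarrow> real. v \<in> ?X \<Longrightarrow> (\<forall>p\<in>P. v p = 0) \<Longrightarrow> v = (\<lambda>_. 0)"
    using lagrange_determined[where 'b = real] by blast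
  have uX: "u k \<in> ?X" for k using u by blast
  have "\<exists>G. (\<forall>j\<in>P \<times> Basis. G j \<in> ?X) \<and>
    (\<forall>v\<in>?X. v = (\<lambda>x. \<Sum>j\<in>P \<times> Basis. (v (fst j) \<bullet> snd j) *\<^sub>R G j x))"
    by (rule fun_reconstruction[OF P(1) fun_subspace_lagrange P(3)])
  then obtain G where G: "\<forall>j\<in>P \<times> Basis. G j \<in> ?X"
    "\<forall>v\<in>?X. v = (\<lambda>x. \<Sum>j\<in>P \<times> Basis. (v (fst j) \<bullet> snd j) *\<^sub>R G j x)" by (elim exE conjE)
  have "\<exists>r d. strict_mono (r :: nat \<Rightarrow> nat) \<and>
      (\<forall>j\<in>P \<times> Basis. (\<lambda>k. u (r k) (fst j) \<bullet> snd j) \<longlonglongrightarrow> d j)"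
  proof (rule bounded_family_convergent_subseq)
    show "bounded (range (\<lambda>k. u k (fst j) \<bullet> snd j))" if "j \<in> P \<times> Basis" for j
      using that admissible_bounded[OF regular u]
      by (intro boundedI[of _ "\<bar>m\<bar> + \<bar>M\<bar>"]) auto
  qed (use P(1) in simp)
  then obtain r d where r: "strict_mono (r :: nat \<Rightarrow> nat)"
    and d: "\<And>j. j \<in> P \<times> Basis \<Longrightarrow> (\<lambda>k. u (r k) (fst j) \<bullet> snd j) \<longlonglongrightarrow> d j" by blast
  define u' where "u' = (\<lambda>x. \<Sum>j\<in>P \<times> Basis. d j *\<^sub>R G j x)"
  have u'X: "u' \<in> ?X"
    unfolding u'_def using P(1) G(1) by (intro fun_subspace_sum[OF fun_subspace_lagrange]) auto
  have lim: "(\<lambda>k. u (r k) x) \<longlonglongrightarrow> u' x" for x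
  proof -
    have "u (r k) x = (\<Sum>j\<in>P \<times> Basis. (u (r k) (fst j) \<bullet> snd j) *\<^sub>R G j x)" for k
      using fun_cong[OF G(2)[rule_format, OF uX]] .
    moreover have "(\<lambda>k. \<Sum>j\<in>P \<times> Basis. (u (r k) (fst j) \<bullet> snd j) *\<^sub>R G j x) \<longlonglongrightarrow> u' x"
      unfolding u'_def by (intro tendsto_intros d)
    ultimately show ?thesis by simp
  qed
  have bounds: "m \<le> u' x \<and> u' x \<le> M" if "x \<in> S" for x
  proof -
    have "x \<in> \<Union>T" using that closure_subset[of S] unfolding Union_mesh by blast
    then obtain t where t: "t \<in> T" "x \<in> t" by blast
    have "m \<le> u k x \<and> u k x \<le> M" for k
      using u[of k] unfolding admissible_def by (intro lagrange_bounds[OF regular uX _ t]) auto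
    then show ?thesis using LIMSEQ_le_const[OF lim] LIMSEQ_le_const2[OF lim] by blast
  qed
  \<comment> \<open>The functions \<open>u k\<close> may have different compact supports. All of
    them vanish on each tetrahedron not contained in \<open>S\<close>, so the union of the others is
    a common one and serves the limit.\<close>
  define C where "C = \<Union>{t \<in> T. t \<subseteq> S}"
  have C: "compact C" "C \<subseteq> S"
    unfolding C_def using finite_mesh compact_simplex[OF simplex_mesh] by (auto intro!: compact_Union)
  have supp: "u' x = 0" if "x \<in> S" "x \<notin> C" for x
  proof -
    have "x \<in> \<Union>T" using that closure_subset[of S] unfolding Union_mesh by blast
    then obtain t where t: "t \<in> T" "x \<in> t" by blast
    then have "\<not> t \<subseteq> S" using that(2) unfolding C_def by blast
    have "u k x = 0" for k
    proof -
      obtain C where "compact C" "C \<subseteq> S" "AE x in lebesgue_on S. x \<notin> C \<longrightarrow> u k x = 0"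
        using u[of k] unfolding admissible_def by blast
      then show ?thesis using \<open>\<not> t \<subseteq> S\<close> t by (intro lagrange_vanish[OF regular uX])
    qed
    then show ?thesis using LIMSEQ_unique[OF lim[of x]] tendsto_const[of 0] by simp
  qed
  have "u' \<in> admissible S m M" if "total_variation S u' < \<infinity>"
    unfolding admissible_def BV_def
  proof (intro CollectI conjI that exI[of _ C] C)
    have "ess_bounded (lebesgue_on S) u'"
      unfolding ess_bounded_def using lagrange_measurable[OF u'X] bounds
      by (intro conjI exI[of _ "\<bar>m\<bar> + \<bar>M\<bar>"] AE_I2) (force simp: space_restrict_space)+
    then show "integrable (lebesgue_on S) u'" by (rule ess_bounded_integrable[OF finite_measure_domain])
    show "\<forall>x. x \<notin> S \<longrightarrow> u' x = 0" using u'X unfolding lagrange_space_def by blast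
    show "AE x in lebesgue_on S. x \<notin> C \<longrightarrow> u' x = 0"
      using supp by (intro AE_I2) (simp add: space_restrict_space)
    show "AE x in lebesgue_on S. m \<le> u' x \<and> u' x \<le> M"
      using bounds by (intro AE_I2) (simp add: space_restrict_space)
  qed
  then show ?thesis using r u'X lim by blast
qed

text \<open>The limit passage behind lower semicontinuity: the divergence of a test field is
  bounded, so dominated convergence applies.\<close>

lemma test_integral_tendsto:
  fixes g :: "pt \<Rightarrow> real^3" and u :: "nat \<Rightarrow> pt \<Rightarrow> real"
  assumes "\<And>k. u k \<in> borel_measurable (lebesgue_on S)" "\<And>k x. \<bar>u k x\<bar> \<le> B"
    and lim: "\<And>x. (\<lambda>k. u k x) \<longlonglongrightarrow> u' x" and g: "g \<in> C1_compact S"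
  shows "(\<lambda>k. LINT x|lebesgue_on S. u k x * divg g x) \<longlonglongrightarrow> (LINT x|lebesgue_on S. u' x * divg g x)"
proof (rule integral_dominated_convergence[where w = "\<lambda>x. B * \<bar>divg g x\<bar>"])
  have "ess_bounded (lebesgue_on S) (divg g)"
    using ess_bounded_continuous[OF bounded_domain _ C1_compact_curl_divg(2)[OF g]] open_domain by simp
  then have div: "integrable (lebesgue_on S) (divg g)" "divg g \<in> borel_measurable (lebesgue_on S)"
    using ess_bounded_integrable[OF finite_measure_domain] ess_bounded_measurable by auto
  show "integrable (lebesgue_on S) (\<lambda>x. B * \<bar>divg g x\<bar>)" using div(1) by auto
  show "(\<lambda>x. u k x * divg g x) \<in> borel_measurable (lebesgue_on S)" for k
    by (intro borel_measurable_times assms(1) div(2))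
  show "(\<lambda>x. u' x * divg g x) \<in> borel_measurable (lebesgue_on S)"
    by (intro borel_measurable_times borel_measurable_LIMSEQ_real[OF lim assms(1)] div(2))
  show "AE x in lebesgue_on S. (\<lambda>k. u k x * divg g x) \<longlonglongrightarrow> u' x * divg g x"
    by (intro AE_I2 tendsto_intros lim)
  show "AE x in lebesgue_on S. norm (u k x * divg g x) \<le> B * \<bar>divg g x\<bar>" for k
    using assms(2)[of k] by (intro AE_I2) (simp add: abs_mult mult_right_mono)
qed

end

section \<open>Existence of a minimizer\<close>

context convex_tetra_mesh
begin

text \<open>Uniqueness is demanded at the limit conductivity; the \<open>E k\<close> may be any
  solutions of their problems.\<close>

lemma discrete_state_subsequence:
  fixes \<Omega>0 D :: "pt set" and T0 :: "pt set set" and J :: "pt \<Rightarrow> cvec"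
  defines "R \<equiv> nedelec_space T S \<Gamma>" and "U \<equiv> lagrange_space T0 D :: (pt \<Rightarrow> complex) set"
  assumes sub: "tetra_mesh T0 \<Omega>0" "T0 \<subseteq> T"
    and eps: "ess_bounded (lebesgue_on \<Omega>0) \<epsilon>" and J: "J \<in> L2 (lebesgue_on S)"
    and data: "cross_normal S Eobs \<in> L2 (surface_on \<Gamma>)"
    and s: "\<And>k. s k \<in> borel_measurable (lebesgue_on S)" "\<And>k x. \<bar>s k x\<bar> \<le> B"
      "\<And>x. (\<lambda>k. s k x) \<longlonglongrightarrow> s' x"
    and E: "\<And>k. is_discrete_state S \<Omega>0 R U \<mu> \<epsilon> \<omega> J (s k) (E k)"
    and E': "is_discrete_state S \<Omega>0 R U \<mu> \<epsilon> \<omega> J s' E'"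
      "\<And>F. is_discrete_state S \<Omega>0 R U \<mu> \<epsilon> \<omega> J s' F \<Longrightarrow> F = E'"
  shows "\<exists>r. strict_mono (r :: nat \<Rightarrow> nat) \<and>
    (\<lambda>k. misfit S \<Gamma> Eobs (E (r k))) \<longlonglongrightarrow> misfit S \<Gamma> Eobs E'"
proof -
  interpret sub: tetra_mesh T0 \<Omega>0 by (rule sub(1))
  note form_b_field = sub.form_b_linear_field[OF eps sub(2) open_domain bounded_domain]
    and form_b_potential = sub.form_b_linear_potential[OF eps sub(2) open_domain bounded_domain]
  have R: "fun_subspace R" unfolding R_def by (rule fun_subspace_edge)
  have s_bounded: "ess_bounded (lebesgue_on S) (s k)" for k
    unfolding ess_bounded_def using s(1,2) by (auto intro!: exI[of _ B])
  have s'_bounded: "ess_bounded (lebesgue_on S) s'"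
    unfolding ess_bounded_def
  proof (intro conjI exI[of _ B] AE_I2)
    show "s' \<in> borel_measurable (lebesgue_on S)" by (rule borel_measurable_LIMSEQ_real[OF s(3,1)])
    show "norm (s' x) \<le> B" for x
      using tendsto_norm[OF s(3)[of x]] s(2) by (intro LIMSEQ_le_const2) auto
  qed
  \<comment> \<open>The value 0 off \<open>R\<close> makes each functional depend only on its
    restriction to \<open>R\<close>, so that finitely many of its values determine it.\<close>
  define W where "W = (\<lambda>\<phi> F. if F \<in> R then form_b \<Omega>0 \<epsilon> (grad \<phi>) F else 0) ` U"
  define Cs where "Cs = (\<lambda>\<psi> E. form_b \<Omega>0 \<epsilon> E (grad \<psi>)) ` U"
  define l where "l F = \<i> * complex_of_real \<omega> * (LINT x|lebesgue_on S. hdot (J x) (F x))" for F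
  have state_iff: "is_discrete_state S \<Omega>0 R U \<mu> \<epsilon> \<omega> J \<sigma> F \<longleftrightarrow>
      saddle_solution R W Cs (form_a S \<mu> \<omega> \<sigma>) l F" for \<sigma> F
    unfolding is_discrete_state_def saddle_solution_def W_def Cs_def l_def by auto
  have W: "fun_subspace W"
    unfolding fun_subspace_def
  proof (intro conjI ballI allI)
    have U0: "(\<lambda>_. 0) \<in> U" unfolding U_def by (rule fun_subspaceD(1)[OF fun_subspace_lagrange])
    have "form_b \<Omega>0 \<epsilon> (grad (\<lambda>_. 0)) F = 0" if "F \<in> R" for F
      using fun_linear_zero[OF fun_subspace_lagrange form_b_potential] that unfolding R_def by blast
    then have "(\<lambda>_. 0) = (\<lambda>F. if F \<in> R then form_b \<Omega>0 \<epsilon> (grad (\<lambda>_. 0)) F else 0)" by auto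
    then show "(\<lambda>_. 0) \<in> W" unfolding W_def by (rule image_eqI[OF _ U0])
    fix v w c assume "v \<in> W" "w \<in> W"
    then obtain p q where pq: "p \<in> U" "q \<in> U"
      "v = (\<lambda>F. if F \<in> R then form_b \<Omega>0 \<epsilon> (grad p) F else 0)"
      "w = (\<lambda>F. if F \<in> R then form_b \<Omega>0 \<epsilon> (grad q) F else 0)" unfolding W_def by blast
    have "(\<lambda>x. p x + c *\<^sub>R q x) \<in> U"
      using pq(1,2) unfolding U_def by (rule fun_subspaceD(2)[OF fun_subspace_lagrange])
    moreover have "form_b \<Omega>0 \<epsilon> (grad (\<lambda>x. p x + c *\<^sub>R q x)) F
        = form_b \<Omega>0 \<epsilon> (grad p) F + c *\<^sub>R form_b \<Omega>0 \<epsilon> (grad q) F" if "F \<in> R" for F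
      using that pq(1,2) unfolding R_def U_def by (rule fun_linearD[OF form_b_potential])
    then have "v F + c *\<^sub>R w F = (if F \<in> R then form_b \<Omega>0 \<epsilon> (grad (\<lambda>x. p x + c *\<^sub>R q x)) F else 0)" for F
      unfolding pq(3,4) by simp
    ultimately show "(\<lambda>F. v F + c *\<^sub>R w F) \<in> W" unfolding W_def by auto
  qed
  have W_linear: "fun_linear R w" if w: "w \<in> W" for w
  proof -
    obtain p where p: "p \<in> U" "w = (\<lambda>F. if F \<in> R then form_b \<Omega>0 \<epsilon> (grad p) F else 0)"
      using w unfolding W_def by blast
    have "fun_linear R (form_b \<Omega>0 \<epsilon> (grad p))"
      using form_b_field(2) p(1) unfolding R_def U_def by blast
    then show ?thesis
      unfolding fun_linear_def p(2) using fun_subspaceD(2)[OF R] by auto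
  qed
  obtain P where P: "finite P" "\<forall>u\<in>R. (\<forall>p\<in>P. u p = 0) \<longrightarrow> u = (\<lambda>_. 0)"
    using nedelec_determined unfolding R_def by blast
  let ?J = "P \<times> (Basis :: cvec set)"
  have "\<exists>G. (\<forall>j\<in>?J. G j \<in> R) \<and> (\<forall>u\<in>R. u = (\<lambda>x. \<Sum>j\<in>?J. (u (fst j) \<bullet> snd j) *\<^sub>R G j x))"
    by (rule fun_reconstruction[OF P(1) R]) (use P(2) in blast)
  then obtain G where G0: "\<forall>j\<in>?J. G j \<in> R" "\<forall>u\<in>R. u = (\<lambda>x. \<Sum>j\<in>?J. (u (fst j) \<bullet> snd j) *\<^sub>R G j x)"
    by (elim exE conjE)
  note G = G0(1)[rule_format] and rec = G0(2)[rule_format]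
  have "\<exists>r. strict_mono (r :: nat \<Rightarrow> nat) \<and>
      (\<forall>j\<in>?J. (\<lambda>k. E (r k) (fst j) \<bullet> snd j) \<longlonglongrightarrow> E' (fst j) \<bullet> snd j)"
  proof (rule saddle_solution_limit[where X = R and J = ?J and G = G and W = W and D = Cs and l = l
        and A = "\<lambda>k. form_a S \<mu> \<omega> (s k)" and B = "form_a S \<mu> \<omega> s'" and \<l> = "\<lambda>j u. u (fst j) \<bullet> snd j"])
    show "finite ?J" using P(1) by simp
    show "fun_linear R (\<lambda>u. u (fst j) \<bullet> snd j)" for j
      unfolding fun_linear_def by (simp add: inner_add_left)
    show "w F = 0" if "w \<in> W" "F \<notin> R" for w F using that unfolding W_def by auto
    show "fun_linear R d" if "d \<in> Cs" for d
      using that form_b_field(1) unfolding Cs_def R_def U_def by blast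
    show "fun_linear R l" unfolding l_def R_def by (rule source_linear[OF J])
    show "fun_linear R (\<lambda>E. form_a S \<mu> \<omega> (s k) E F)" if "F \<in> R" for k F
      using form_a_linear(1)[OF s_bounded] that unfolding R_def .
    show "fun_linear R (\<lambda>E. form_a S \<mu> \<omega> s' E F)" if "F \<in> R" for F
      using form_a_linear(1)[OF s'_bounded] that unfolding R_def .
    show "fun_linear R (form_a S \<mu> \<omega> s' F)" if "F \<in> R" for F
      using form_a_linear(2)[OF s'_bounded] that unfolding R_def .
    show "(\<lambda>k. form_a S \<mu> \<omega> (s k) (G i) (G j)) \<longlonglongrightarrow> form_a S \<mu> \<omega> s' (G i) (G j)"
      if "i \<in> ?J" "j \<in> ?J" for i j
      using G[OF that(1)] G[OF that(2)] s unfolding R_def by (intro form_a_tendsto[where B = B]) auto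
    show "saddle_solution R W Cs (form_a S \<mu> \<omega> (s k)) l (E k)" for k using E state_iff by blast
    show "saddle_solution R W Cs (form_a S \<mu> \<omega> s') l E'" using E'(1) state_iff by blast
    show "F = E'" if "saddle_solution R W Cs (form_a S \<mu> \<omega> s') l F" for F
      using E'(2) that state_iff by blast
  qed (fact R G rec W W_linear)+
  then obtain r where r: "strict_mono (r :: nat \<Rightarrow> nat)"
    and lim: "\<And>j. j \<in> ?J \<Longrightarrow> (\<lambda>k. E (r k) (fst j) \<bullet> snd j) \<longlonglongrightarrow> E' (fst j) \<bullet> snd j" by blast
  have mem: "E k \<in> R" "E' \<in> R" for k using E E'(1) unfolding is_discrete_state_def by auto
  have "(\<lambda>k. misfit S \<Gamma> Eobs (\<lambda>x. \<Sum>j\<in>?J. (E (r k) (fst j) \<bullet> snd j) *\<^sub>R G j x))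
      \<longlonglongrightarrow> misfit S \<Gamma> Eobs (\<lambda>x. \<Sum>j\<in>?J. (E' (fst j) \<bullet> snd j) *\<^sub>R G j x)"
    by (rule misfit_tendsto[OF data _ G[unfolded R_def] lim]) (use P(1) in auto)
  then have "(\<lambda>k. misfit S \<Gamma> Eobs (E (r k))) \<longlonglongrightarrow> misfit S \<Gamma> Eobs E'"
    unfolding rec[OF mem(1), symmetric] rec[OF mem(2), symmetric] .
  then show ?thesis using r by blast
qed

end

theorem theorem3p1:
  fixes \<Omega> \<Omega>0 \<Omega>1 \<Omega>2 \<Omega>C \<Gamma> :: "pt set"
    and \<mu> \<omega> s0 m M \<alpha> h \<kappa> :: real
    and \<epsilon> \<sigma>0 :: "pt \<Rightarrow> real"
    and J Eobs :: "pt \<Rightarrow> cvec"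
    and Th T0 TC :: "pt set set"
    and R :: "(pt \<Rightarrow> cvec) set" and U :: "(pt \<Rightarrow> complex) set" and V Kh :: "(pt \<Rightarrow> real) set"
    and Eh :: "(pt \<Rightarrow> real) \<Rightarrow> pt \<Rightarrow> cvec"
    and Gh :: "(pt \<Rightarrow> real) \<Rightarrow> real" and \<phi> :: "(pt \<Rightarrow> real) \<Rightarrow> ereal"
  assumes domain: "open \<Omega>" "convex \<Omega>" "bounded \<Omega>" "\<Omega> \<noteq> {}"
    and conductor: "open \<Omega>1" "open \<Omega>2" "\<Omega>C = \<Omega>1 \<union> closure \<Omega>2"
    and polyhedra: "polyhedral \<Omega>0" "polyhedral \<Omega>C"
    and decomposition: "\<Omega>0 \<inter> \<Omega>C = {}" "\<Omega>0 \<union> \<Omega>C \<subseteq> \<Omega>" "closure \<Omega> = closure \<Omega>0 \<union> closure \<Omega>C"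
    and gamma: "\<exists>\<F>. (\<forall>F\<in>\<F>. F facet_of closure \<Omega>) \<and> \<Gamma> = \<Union>\<F>" "\<Gamma> \<subseteq> frontier \<Omega>0"
    and mu: "\<mu> > 0" and omega: "\<omega> > 0"
    and eps: "\<epsilon> \<in> borel_measurable (lebesgue_on \<Omega>0)"
      "\<exists>c>0. \<exists>C. \<forall>x\<in>\<Omega>0. c \<le> \<epsilon> x \<and> \<epsilon> x \<le> C"
    and source: "J \<in> L2 (lebesgue_on \<Omega>)" "weakly_div_free \<Omega> J"
    and sigma0: "s0 > 0" "\<sigma>0 = (\<lambda>x. if x \<in> \<Omega>C then s0 else 0)"
    and data: "cross_normal \<Omega> Eobs \<in> L2 (surface_on \<Gamma>)"
    and mesh: "tetrahedral_mesh Th \<Omega>" "h = Max (diameter ` Th)"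
      "shape_regular \<kappa> Th" "quasi_uniform \<kappa> h Th"
    and submeshes: "Th = T0 \<union> TC" "tetrahedral_mesh T0 \<Omega>0" "tetrahedral_mesh TC \<Omega>C"
    and spaces: "R = nedelec_space Th \<Omega> \<Gamma>"
      "U = lagrange_space T0 (\<Omega>0 \<union> \<Gamma>)" "V = lagrange_space TC \<Omega>C"
    and bounds: "m < M" "- s0 < m"
    and admissible_set: "Kh = V \<inter> admissible \<Omega>C m M" "Kh \<noteq> {}"
    and well_posed: "\<And>\<sigma>. \<sigma> \<in> Kh \<Longrightarrow>
      \<exists>!E. is_discrete_state \<Omega> \<Omega>0 R U \<mu> \<epsilon> \<omega> J (\<lambda>x. \<sigma> x + \<sigma>0 x) E"
    and state: "\<And>\<sigma>. \<sigma> \<in> Kh \<Longrightarrow>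
      is_discrete_state \<Omega> \<Omega>0 R U \<mu> \<epsilon> \<omega> J (\<lambda>x. \<sigma> x + \<sigma>0 x) (Eh \<sigma>)"
    and objective: "\<And>\<sigma>. Gh \<sigma> = misfit \<Omega> \<Gamma> Eobs (Eh \<sigma>)"
      "\<And>\<sigma>. \<phi> \<sigma> = ereal (Gh \<sigma>) + ereal \<alpha> * total_variation \<Omega>C \<sigma>"
    and alpha: "\<alpha> > 0"
  shows "\<exists>\<sigma>\<in>Kh. \<forall>\<tau>\<in>Kh. \<phi> \<sigma> \<le> \<phi> \<tau>"
proof -
  have regC: "interior (closure \<Omega>C) = \<Omega>C" and reg0: "interior (closure \<Omega>0) = \<Omega>0"
    using polyhedra unfolding polyhedral_def by auto
  have openC: "open \<Omega>C" "bounded \<Omega>C" and open0: "open \<Omega>0" "bounded \<Omega>0"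
    using open_interior[of "closure \<Omega>C"] open_interior[of "closure \<Omega>0"] regC reg0
      decomposition(2) bounded_subset[OF domain(3)] by auto
  interpret C: tetra_mesh TC \<Omega>C using submeshes(3) openC by unfold_locales
  have sub: "tetra_mesh T0 \<Omega>0" using submeshes(2) open0 by unfold_locales
  interpret convex_tetra_mesh Th \<Omega> \<Gamma> using mesh(1) domain gamma(1) by unfold_locales
  have eps_bounded: "ess_bounded (lebesgue_on \<Omega>0) \<epsilon>"
  proof -
    obtain c K where "c > 0" "\<forall>x\<in>\<Omega>0. c \<le> \<epsilon> x \<and> \<epsilon> x \<le> K" using eps(2) by blast
    then have "AE x in lebesgue_on \<Omega>0. norm (\<epsilon> x) \<le> K"
      by (intro AE_I2) (force simp: space_restrict_space)
    then show ?thesis using eps(1) unfolding ess_bounded_def by blast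
  qed
  \<comment> \<open>Measurability is known on the conductor; vanishing outside carries it over to
    \<Omega>.\<close>
  have extend: "u \<in> borel_measurable (lebesgue_on \<Omega>)" if "u \<in> V" for u
  proof -
    have zero: "u x = 0" if "x \<notin> \<Omega>C" for x using that \<open>u \<in> V\<close> unfolding spaces lagrange_space_def by blast
    have "(\<lambda>x. indicator \<Omega>C x *\<^sub>R u x) \<in> borel_measurable lebesgue"
      using C.lagrange_measurable[OF that[unfolded spaces]] openC(1)
      by (subst (asm) borel_measurable_restrict_space_iff) auto
    also have "(\<lambda>x. indicator \<Omega>C x *\<^sub>R u x) = u"
    proof
      show "indicator \<Omega>C x *\<^sub>R u x = u x" for x by (cases "x \<in> \<Omega>C") (simp_all add: zero)
    qed
    finally show ?thesis by (rule measurable_restrict_space1)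
  qed
  have sigma0_meas: "\<sigma>0 \<in> borel_measurable (lebesgue_on \<Omega>)"
    unfolding sigma0(2) using openC(1) by (intro measurable_restrict_space1 measurable_If_set) auto
  have Gh_nonneg: "0 \<le> Gh \<sigma>" for \<sigma>
    unfolding objective(1) misfit_def by (intro mult_nonneg_nonneg integral_nonneg_AE) auto

  define I where "I = Inf (\<phi> ` Kh)"
  \<comment> \<open>The infimum is approached by a decreasing sequence of attained values, so
    \<open>f 0\<close> bounds all later ones.\<close>
  obtain f where f: "decseq f" "range f \<subseteq> \<phi> ` Kh" "I = (INF k. f k)"
    using Inf_countable_INF[of "\<phi> ` Kh"] admissible_set(2) unfolding I_def by blast
  have "\<forall>k. \<exists>\<sigma>\<in>Kh. f k = \<phi> \<sigma>" using f(2) by blast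
  then obtain u where u: "\<And>k. u k \<in> Kh" "\<And>k. f k = \<phi> (u k)" by metis
  have f_lim: "f \<longlonglongrightarrow> I" unfolding f(3) by (rule LIMSEQ_INF[OF f(1)])
  have uK: "u k \<in> lagrange_space TC \<Omega>C \<inter> admissible \<Omega>C m M" for k
    using u(1) unfolding admissible_set(1) spaces .
  obtain r \<sigma> where r: "strict_mono (r :: nat \<Rightarrow> nat)" and \<sigma>: "\<sigma> \<in> lagrange_space TC \<Omega>C"
    and lim: "\<And>x. (\<lambda>k. u (r k) x) \<longlonglongrightarrow> \<sigma> x"
    and adm: "total_variation \<Omega>C \<sigma> < \<infinity> \<Longrightarrow> \<sigma> \<in> admissible \<Omega>C m M"
    using C.admissible_subsequence[where u = u, OF regC uK] by blast
  define B where "B = \<bar>m\<bar> + \<bar>M\<bar>"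
  have uB: "\<bar>u k x\<bar> \<le> B" for k x unfolding B_def by (rule C.admissible_bounded[OF regC uK])
  \<comment> \<open>Replacing the total variation by one test integral leaves a real number that
    passes to the limit.\<close>
  have test_le: "ereal (Gh (u k) + \<alpha> * (LINT x|lebesgue_on \<Omega>C. u k x * divg g x)) \<le> f k"
    if "g \<in> C1_compact \<Omega>C" "\<And>x. x \<in> \<Omega>C \<Longrightarrow> norm (g x) \<le> 1" for k g
  proof -
    have "ereal \<alpha> * ereal (LINT x|lebesgue_on \<Omega>C. u k x * divg g x) \<le> ereal \<alpha> * total_variation \<Omega>C (u k)"
      using alpha by (intro ereal_mult_left_mono total_variation_ge that) auto
    then show ?thesis
      unfolding u(2) objective(2) plus_ereal.simps(1)[symmetric] times_ereal.simps(1)[symmetric]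
      by (intro add_left_mono)
  qed
  \<comment> \<open>The index map \<open>q\<close> is arbitrary because two are needed: the first
    subsequence, and its refinement along which the states converge as well.\<close>
  have test_lim: "(\<lambda>k. LINT x|lebesgue_on \<Omega>C. u (q k) x * divg g x)
      \<longlonglongrightarrow> (LINT x|lebesgue_on \<Omega>C. \<sigma> x * divg g x)"
    if "g \<in> C1_compact \<Omega>C" "\<And>x. (\<lambda>k. u (q k) x) \<longlonglongrightarrow> \<sigma> x" for g :: "pt \<Rightarrow> real^3" and q
    using that uK uB C.lagrange_measurable by (intro C.test_integral_tendsto[where B = B]) blast+

  have "f 0 < \<infinity>"
  proof -
    have "total_variation \<Omega>C (u 0) < \<infinity>" using uK[of 0] unfolding admissible_def BV_def by blast
    then obtain v where "total_variation \<Omega>C (u 0) = ereal v"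
      using total_variation_nonneg[of \<Omega>C "u 0"] by (cases "total_variation \<Omega>C (u 0)") auto
    then show ?thesis unfolding u(2) objective(2) by simp
  qed
  moreover have "0 \<le> f 0"
    unfolding u(2) objective(2) using Gh_nonneg alpha total_variation_nonneg
    by (intro add_nonneg_nonneg) auto
  ultimately obtain c where c: "f 0 = ereal c" by (cases "f 0") auto
  \<comment> \<open>The crude bound: the nonnegative misfit is dropped and all values are at most
    \<open>f 0 = c\<close>. Nothing is known yet about the state of the limit.\<close>
  have "total_variation \<Omega>C \<sigma> \<le> ereal (c / \<alpha>)"
  proof (rule total_variation_le)
    fix g :: "pt \<Rightarrow> real^3" assume g: "g \<in> C1_compact \<Omega>C" "\<And>x. x \<in> \<Omega>C \<Longrightarrow> norm (g x) \<le> 1"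
    have "(LINT x|lebesgue_on \<Omega>C. u (r k) x * divg g x) \<le> c / \<alpha>" for k
    proof -
      have "f (r k) \<le> f 0" using f(1) by (simp add: decseq_def)
      from order_trans[OF test_le[OF g] this]
      have "Gh (u (r k)) + \<alpha> * (LINT x|lebesgue_on \<Omega>C. u (r k) x * divg g x) \<le> c" unfolding c by simp
      then have "\<alpha> * (LINT x|lebesgue_on \<Omega>C. u (r k) x * divg g x) \<le> c"
        using Gh_nonneg[of "u (r k)"] by linarith
      then show ?thesis using alpha by (simp add: field_simps)
    qed
    then have "(LINT x|lebesgue_on \<Omega>C. \<sigma> x * divg g x) \<le> c / \<alpha>"
      using LIMSEQ_le_const2[OF test_lim[OF g(1) lim]] by blast
    then show "ereal (LINT x|lebesgue_on \<Omega>C. \<sigma> x * divg g x) \<le> ereal (c / \<alpha>)" by simp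
  qed
  then have TV: "total_variation \<Omega>C \<sigma> < \<infinity>" by (auto simp: le_less_trans)
  have \<sigma>K: "\<sigma> \<in> Kh" unfolding admissible_set(1) spaces using \<sigma> adm[OF TV] by blast

  \<comment> \<open>With \<sigma> in \<open>Kh\<close>, well-posedness now provides the unique limit
    state.\<close>
  have "\<exists>q. strict_mono (q :: nat \<Rightarrow> nat) \<and>
      (\<lambda>k. misfit \<Omega> \<Gamma> Eobs (Eh (u (r (q k))))) \<longlonglongrightarrow> misfit \<Omega> \<Gamma> Eobs (Eh \<sigma>)"
  proof (rule discrete_state_subsequence[OF sub _ eps_bounded source(1) data,
        where s = "\<lambda>k x. u (r k) x + \<sigma>0 x" and s' = "\<lambda>x. \<sigma> x + \<sigma>0 x" and B = "B + s0"
          and \<mu> = \<mu> and \<omega> = \<omega> and D = "\<Omega>0 \<union> \<Gamma>", folded spaces])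
    show "T0 \<subseteq> Th" using submeshes(1) by blast
    show "(\<lambda>x. u (r k) x + \<sigma>0 x) \<in> borel_measurable (lebesgue_on \<Omega>)" for k
      using extend u(1) sigma0_meas unfolding admissible_set(1) by (intro borel_measurable_add) auto
    show "\<bar>u (r k) x + \<sigma>0 x\<bar> \<le> B + s0" for k x
      using uB[of "r k" x] sigma0 by auto
    show "(\<lambda>k. u (r k) x + \<sigma>0 x) \<longlonglongrightarrow> \<sigma> x + \<sigma>0 x" for x by (intro tendsto_intros lim)
    show "is_discrete_state \<Omega> \<Omega>0 R U \<mu> \<epsilon> \<omega> J (\<lambda>x. u (r k) x + \<sigma>0 x) (Eh (u (r k)))" for k
      by (rule state[OF u(1)])
    show "is_discrete_state \<Omega> \<Omega>0 R U \<mu> \<epsilon> \<omega> J (\<lambda>x. \<sigma> x + \<sigma>0 x) (Eh \<sigma>)" by (rule state[OF \<sigma>K])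
    show "F = Eh \<sigma>" if "is_discrete_state \<Omega> \<Omega>0 R U \<mu> \<epsilon> \<omega> J (\<lambda>x. \<sigma> x + \<sigma>0 x) F" for F
      using well_posed[OF \<sigma>K] that state[OF \<sigma>K] by blast
  qed
  then obtain q where q: "strict_mono (q :: nat \<Rightarrow> nat)"
    and G_lim: "(\<lambda>k. Gh (u (r (q k)))) \<longlonglongrightarrow> Gh \<sigma>"
    unfolding objective(1) by blast
  have lim_q: "(\<lambda>k. u (r (q k)) x) \<longlonglongrightarrow> \<sigma> x" for x
    using LIMSEQ_subseq_LIMSEQ[OF lim q] by (simp add: o_def)
  have f_lim_q: "(\<lambda>k. f (r (q k))) \<longlonglongrightarrow> I"
    using LIMSEQ_subseq_LIMSEQ[OF LIMSEQ_subseq_LIMSEQ[OF f_lim r] q] by (simp add: o_def)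
  have test_I: "ereal (Gh \<sigma> + \<alpha> * (LINT x|lebesgue_on \<Omega>C. \<sigma> x * divg g x)) \<le> I"
    if g: "g \<in> C1_compact \<Omega>C" "\<And>x. x \<in> \<Omega>C \<Longrightarrow> norm (g x) \<le> 1" for g
  proof (rule LIMSEQ_le[OF _ f_lim_q])
    show "(\<lambda>k. ereal (Gh (u (r (q k))) + \<alpha> * (LINT x|lebesgue_on \<Omega>C. u (r (q k)) x * divg g x)))
        \<longlonglongrightarrow> ereal (Gh \<sigma> + \<alpha> * (LINT x|lebesgue_on \<Omega>C. \<sigma> x * divg g x))"
      by (intro tendsto_intros G_lim test_lim[OF g(1) lim_q])
  qed (use test_le[OF g] in blast)
  have "0 \<le> I"
    unfolding I_def objective(2) using Gh_nonneg alpha total_variation_nonneg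
    by (intro INF_greatest add_nonneg_nonneg) auto
  moreover have "I \<le> f 0" unfolding f(3) by (rule INF_lower) simp
  ultimately obtain i where i: "I = ereal i" using c by (cases I) auto
  \<comment> \<open>The sharp bound: \<open>Gh \<sigma>\<close> does not depend on the test field
    and can be moved to the right before the supremum is taken. Multiplying by \<alpha> gives the
    infimum back exactly.\<close>
  have "total_variation \<Omega>C \<sigma> \<le> ereal ((i - Gh \<sigma>) / \<alpha>)"
  proof (rule total_variation_le)
    fix g :: "pt \<Rightarrow> real^3" assume g: "g \<in> C1_compact \<Omega>C" "\<And>x. x \<in> \<Omega>C \<Longrightarrow> norm (g x) \<le> 1"
    show "ereal (LINT x|lebesgue_on \<Omega>C. \<sigma> x * divg g x) \<le> ereal ((i - Gh \<sigma>) / \<alpha>)"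
      using test_I[OF g] alpha unfolding i by (simp add: field_simps)
  qed
  then have "ereal \<alpha> * total_variation \<Omega>C \<sigma> \<le> ereal \<alpha> * ereal ((i - Gh \<sigma>) / \<alpha>)"
    using alpha by (intro ereal_mult_left_mono) auto
  then have "\<phi> \<sigma> \<le> ereal (Gh \<sigma>) + ereal \<alpha> * ereal ((i - Gh \<sigma>) / \<alpha>)"
    unfolding objective(2) by (rule add_left_mono)
  also have "\<dots> = I" unfolding i using alpha by simp
  finally have "\<phi> \<sigma> \<le> I" .
  then have "\<forall>\<tau>\<in>Kh. \<phi> \<sigma> \<le> \<phi> \<tau>" unfolding I_def by (auto intro: order_trans INF_lower)
  then show ?thesis using \<sigma>K by blast
qed

end
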